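(* (Laplace expansions.) Let $I,J_1,J_2$ be subsets of $\{1,\dots,n\}$ with $\#I=\#J_1+\#J_2$. In the sums below, $I_1\cup I_2=I$ runs over all partitions of $I$ into disjoint subsets with $\#I_1=\#J_1$, $\#I_2=\#J_2$. If $J_1\cap J_2=\emptyset$ and $J=J_1\cup J_2$, then in $\mathcal F_R(M(n))$ $$\mu_r(\mathrm{sign}(J_1;J_2))\,\xi^I_J=\sum_{I_1\cup I_2=I}\mu_l(\mathrm{sign}(I_1;I_2))\,\xi^{I_1}_{J_1}\xi^{I_2}_{J_2},$$ $$\mu_l\big(T_{-\omega(J_1)}\mathrm{sign}(J_2;J_1)^{-1}\big)\,\xi^J_I=\sum_{I_1\cup I_2=I}\mu_r\big(T_{-\omega(I_1)}\mathrm{sign}(I_2;I_1)^{-1}\big)\,\xi^{J_1}_{I_1}\xi^{J_2}_{I_2}.$$ If $J_1\cap J_2\neq\emptyset$, the same formulas hold with the left hand sides replaced by $0$.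
   Context: Setting. Fix $n\ge 1$ and $q\in\mathbb C^\times$ not a root of unity, with a fixed choice of $\log q$ and $q^z=\exp(z\log q)$. Identify $\mathfrak h^*\cong\mathbb C^n$ with unit vectors $e_i$, put $\omega(i)=e_i$, $\omega(I)=\sum_{i\in I}e_i$. $M_{\mathfrak h^*}$ is the field of meromorphic functions on $\mathfrak h^*$ (in $\underline\lambda=(\lambda_1,\dots,\lambda_n)$), $(T_\alpha f)(\lambda)=f(\lambda+\alpha)$. Put $h_0(z)=\frac{q^{-1}-q}{q^{-2z}-1}$, $g(z)=\frac{(q^{-2z}-q^{-2})(q^{-2z}-q^2)}{(q^{-2z}-1)^2}$, $h(z)=q-h_0(z)=q\frac{q^{-2z}-q^{-2}}{q^{-2z}-1}$. The algebra $\mathcal F_R(M(n))$. It is the unital associative $\mathbb C$-algebra generated by $t_{ij}$ ($1\le i,j\le n$) and two commuting copies of $M_{\mathfrak h^*}$, written $f(\underline\lambda)=\mu_l(f)$ and $f(\underline\mu)=\mu_r(f)$, with relations $f(\underline\lambda)t_{ij}=t_{ij}f(\underline\lambda+\omega(i))$, $f(\underline\mu)t_{ij}=t_{ij}f(\underline\mu+\omega(j))$ and, for all $a,b,c,d$, the RLL-relations $\sum_{x,y}R^{xy}_{ac}(\underline\lambda)t_{xb}t_{yd}=\sum_{x,y}R^{bd}_{xy}(\underline\mu)t_{cy}t_{ax}$. The nonzero $R$-entries are $R^{aa}_{aa}=q$; $R^{ab}_{ab}(\underline\lambda)=1$ if $a<b$ and $g(\lambda_a-\lambda_b)$ if $a>b$;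 $R^{ab}_{ba}(\underline\lambda)=h_0(\lambda_a-\lambda_b)$ if $a\ne b$. It is bigraded by $\mathfrak h^*$: $t_{ij}$ has bidegree $(\omega(i),\omega(j))$, and $f(\underline\lambda),f(\underline\mu)$ have bidegree $(0,0)$. Dynamical quantum minor determinants $\xi^I_J$. $W$ is the unital associative algebra generated by $w_1,\dots,w_n$ and a copy of $M_{\mathfrak h^*}$ (elements $f(\underline\lambda)=\mu_W(f)$), with relations $w_i^2=0$, $w_jw_i=-h(\lambda_j-\lambda_i)w_iw_j$ for $i<j$, $f(\underline\lambda)w_i=w_if(\underline\lambda+\omega(i))$. For $I=\{i_1<\dots<i_r\}$ put $w_I=w_{i_1}\cdots w_{i_r}$ ($w_\emptyset=1$), of degree $\omega(I)$; the $w_I$ form an $M_{\mathfrak h^*}$-basis of $W$. $W\widetilde\otimes\mathcal F_R(M(n))=\bigoplus_{\alpha,\beta}W_\alpha\otimes\mathcal F_R(M(n))_{\alpha\beta}$ modulo $w\otimes\mu_l(f)a=\mu_W(f)w\otimes a$, with product $(v\otimes a)(w\otimes b)=vw\otimes ab$. There is a unique unital algebra homomorphism $R\colon W\to W\widetilde\otimes\mathcal F_R(M(n))$ with $R(w_i)=\sum_jw_j\otimes t_{ji}$ and $R(\mu_W(f)w)=(1\otimes\mu_r(f))R(w)$. For $\#I=\#J$, $\xi^I_J$ is defined by $R(w_J)=\sum_{\#I=\#J}w_I\otimes\xi^I_J$; explicitly, for $J=\{j_1<\dots<j_r\}$, $\xi^I_J=\sum_{\sigma\in S_r}\mu_l(S(\sigma,I))\,t_{i_{\sigma(1)}j_1}\cdots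 t_{i_{\sigma(r)}j_r}$ with $S(\sigma,I)(\underline\lambda)=\prod_{k<l,\,\sigma(k)>\sigma(l)}\big(-h(\lambda_{i_{\sigma(k)}}-\lambda_{i_{\sigma(l)}})\big)$. Signs. For disjoint subsets $I_1,I_2$ of $\{1,\dots,n\}$, $\mathrm{sign}(I_1;I_2)\in M_{\mathfrak h^*}$ is $\mathrm{sign}(I_1;I_2)(\underline\lambda)=\prod_{k\in I_1,\,m\in I_2,\,k>m}\big(-h(\lambda_k-\lambda_m)\big)$. In $T_{-\omega(J_1)}\mathrm{sign}(J_2;J_1)^{-1}$ the shift is applied to the function $\mathrm{sign}(J_2;J_1)^{-1}$. *)

theory Defs
  imports "HOL-Complex_Analysis.Complex_Analysis" "HOL-Algebra.QuotRing" "HOL-Library.Poly_Mapping"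
begin

section \<open>The field of meromorphic functions on complex n-space\<close>

text \<open>
  The dual of the Cartan subalgebra is \<open>complex^'n\<close>.  The index set \<open>{1,...,n}\<close> is rendered by an
  arbitrary finite (nonempty) linearly ordered type \<open>'n\<close>, where \<open>n = CARD('n)\<close>.

  Holomorphy of functions of several variables means complex Frechet differentiability.  A function is
  meromorphic if it is locally a quotient \<open>p / d\<close> of holomorphic functions whose denominator does not
  vanish identically on any nonempty open set.  The values at zeros of the denominators are
  irrelevant, so the field consists of classes of such functions modulo equality on a dense open set.
\<close>

definition holo_on :: "(complex^'n \<Rightarrow> complex) \<Rightarrow> (complex^'n) set \<Rightarrow> bool" where
  "holo_on f U \<longleftrightarrow> (\<forall>x\<in>U. \<exists>D. (f has_derivative D) (at x) \<and> (\<forall>c v. D (c *s v) = c * D v))"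

definition mero_fun :: "(complex^'n \<Rightarrow> complex) \<Rightarrow> bool" where
  "mero_fun f \<longleftrightarrow> (\<forall>z. \<exists>U p d. open U \<and> z \<in> U \<and> holo_on p U \<and> holo_on d U \<and>
     (\<forall>V. open V \<and> V \<noteq> {} \<and> V \<subseteq> U \<longrightarrow> (\<exists>x\<in>V. d x \<noteq> 0)) \<and>
     (\<forall>x\<in>U. d x \<noteq> 0 \<longrightarrow> f x = p x / d x))"

definition generically :: "('a::topological_space \<Rightarrow> bool) \<Rightarrow> bool" where
  "generically P \<longleftrightarrow> (\<exists>D. open D \<and> closure D = UNIV \<and> (\<forall>x\<in>D. P x))"

definition mero_eq :: "(complex^'n \<Rightarrow> complex) \<Rightarrow> (complex^'n \<Rightarrow> complex) \<Rightarrow> bool" where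
  "mero_eq f g \<longleftrightarrow> mero_fun f \<and> mero_fun g \<and> generically (\<lambda>x. f x = g x)"

lemma genericallyI:
  fixes P :: "'a::topological_space \<Rightarrow> bool"
  assumes "\<And>V. open V \<Longrightarrow> V \<noteq> {} \<Longrightarrow> \<exists>W. open W \<and> W \<noteq> {} \<and> W \<subseteq> V \<and> (\<forall>x\<in>W. P x)"
  shows "generically P"
proof -
  have "closure (interior {x. P x}) = UNIV"
  proof (rule ccontr)
    assume "closure (interior {x. P x}) \<noteq> UNIV"
    then have "- closure (interior {x. P x}) \<noteq> {}" "open (- closure (interior {x. P x}))" by auto
    then obtain W where W: "open W" "W \<noteq> {}" "W \<subseteq> - closure (interior {x. P x})" "\<forall>x\<in>W. P x"
      using assms by meson
    then have "W \<subseteq> interior {x. P x}" by (intro interior_maximal) auto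
    with W closure_subset show False by blast
  qed
  then show ?thesis unfolding generically_def
    by (intro exI[of _ "interior {x. P x}"]) (use interior_subset in auto)
qed

lemma genericallyD:
  assumes "generically P" "open V" "V \<noteq> {}"
  obtains W where "open W" "W \<noteq> {}" "W \<subseteq> V" "\<forall>x\<in>W. P x"
proof -
  obtain D where D: "open D" "closure D = UNIV" "\<forall>x\<in>D. P x"
    using assms(1) unfolding generically_def by blast
  have "V \<inter> D \<noteq> {}" using D assms open_Int_closure_eq_empty[of V D] by auto
  then show ?thesis using D assms(2) by (intro that[of "V \<inter> D"]) auto
qed

lemma generically_True: "(\<And>x. P x) \<Longrightarrow> generically P"
  by (auto simp: generically_def intro!: exI[of _ UNIV])

lemma generically_conj:
  assumes "generically P" "generically Q"
  shows "generically (\<lambda>x. P x \<and> Q x)"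
proof (rule genericallyI)
  fix V :: "'a set" assume V: "open V" "V \<noteq> {}"
  obtain W where W: "open W" "W \<noteq> {}" "W \<subseteq> V" "\<forall>x\<in>W. P x"
    using genericallyD[OF assms(1) V] .
  obtain W' where "open W'" "W' \<noteq> {}" "W' \<subseteq> W" "\<forall>x\<in>W'. Q x"
    using genericallyD[OF assms(2) W(1,2)] .
  with W show "\<exists>W. open W \<and> W \<noteq> {} \<and> W \<subseteq> V \<and> (\<forall>x\<in>W. P x \<and> Q x)" by blast
qed

lemma generically_mono: "generically P \<Longrightarrow> (\<And>x. P x \<Longrightarrow> Q x) \<Longrightarrow> generically Q"
  by (auto simp: generically_def)

lemma holo_on_subset: "holo_on f U \<Longrightarrow> V \<subseteq> U \<Longrightarrow> holo_on f V"
  by (auto simp: holo_on_def)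

lemma holo_on_const: "holo_on (\<lambda>x. c) U"
  by (auto simp: holo_on_def intro!: exI[of _ "\<lambda>x. 0"])

lemma holo_on_add:
  assumes "holo_on f U" "holo_on g U" shows "holo_on (\<lambda>x. f x + g x) U"
  unfolding holo_on_def
proof
  fix x assume "x \<in> U"
  with assms obtain D E where "(f has_derivative D) (at x)" "\<forall>c v. D (c *s v) = c * D v"
    "(g has_derivative E) (at x)" "\<forall>c v. E (c *s v) = c * E v" unfolding holo_on_def by metis
  then show "\<exists>D. ((\<lambda>x. f x + g x) has_derivative D) (at x) \<and> (\<forall>c v. D (c *s v) = c * D v)"
    by (intro exI[of _ "\<lambda>h. D h + E h"]) (auto intro!: has_derivative_add simp: algebra_simps)
qed

lemma holo_on_mult:
  assumes "holo_on f U" "holo_on g U" shows "holo_on (\<lambda>x. f x * g x) U"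
  unfolding holo_on_def
proof
  fix x assume "x \<in> U"
  with assms obtain D E where "(f has_derivative D) (at x)" "\<forall>c v. D (c *s v) = c * D v"
    "(g has_derivative E) (at x)" "\<forall>c v. E (c *s v) = c * E v" unfolding holo_on_def by metis
  then show "\<exists>D. ((\<lambda>x. f x * g x) has_derivative D) (at x) \<and> (\<forall>c v. D (c *s v) = c * D v)"
    by (intro exI[of _ "\<lambda>h. f x * E h + D h * g x"] conjI has_derivative_mult) (auto simp: algebra_simps)
qed

lemma holo_on_shift:
  assumes "holo_on f U" shows "holo_on (\<lambda>x. f (x + a)) ((\<lambda>x. x + a) -` U)"
  unfolding holo_on_def
proof
  fix x assume "x \<in> (\<lambda>x. x + a) -` U"
  then obtain D where D: "(f has_derivative D) (at (x + a))" "\<forall>c v. D (c *s v) = c * D v"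
    using assms unfolding holo_on_def by auto
  have "((\<lambda>x. x + a) has_derivative (\<lambda>h. h)) (at x)" by (auto intro!: derivative_eq_intros)
  from has_derivative_compose[OF this D(1)]
  have "((\<lambda>x. f (x + a)) has_derivative D) (at x)" .
  with D show "\<exists>D. ((\<lambda>x. f (x + a)) has_derivative D) (at x) \<and> (\<forall>c v. D (c *s v) = c * D v)" by blast
qed

lemma holo_on_continuous: "holo_on f U \<Longrightarrow> continuous_on U f"
  by (metis continuous_at_imp_continuous_on has_derivative_continuous holo_on_def)

lemma holo_on_open_nonzero:
  assumes "holo_on f U" "open U" shows "open {x\<in>U. f x \<noteq> 0}"
proof -
  have "open (f -` (- {0}) \<inter> U)"
    using holo_on_continuous[OF assms(1)] assms(2) by (simp add: continuous_on_open_vimage open_Compl)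
  also have "f -` (- {0}) \<inter> U = {x\<in>U. f x \<noteq> 0}" by auto
  finally show ?thesis .
qed

lemma holo_on_ball_zero:
  fixes z :: "complex^'n"
  assumes p: "holo_on p (ball z r)"
    and W: "open W" "W \<noteq> {}" "W \<subseteq> ball z r" "\<And>x. x \<in> W \<Longrightarrow> p x = 0"
    and x: "x \<in> ball z r"
  shows "p x = 0"
proof -
  obtain a where a: "a \<in> W" using W by auto
  define v where "v = x - a"
  define \<phi> where "\<phi> t = a + t *s v" for t :: complex
  have bl: "bounded_linear (\<lambda>t::complex. t *s v)"
    by (rule linear_conv_bounded_linear[THEN iffD1], rule linearI)
       (auto simp: vec_eq_iff algebra_simps)
  have d\<phi>: "(\<phi> has_derivative (\<lambda>t. t *s v)) (at t)" for t
    unfolding \<phi>_def using bounded_linear_imp_has_derivative[OF bl]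
    by (auto intro!: derivative_eq_intros)
  have cont: "continuous_on UNIV \<phi>"
    by (metis continuous_at_imp_continuous_on d\<phi> has_derivative_continuous)
  define S where "S = \<phi> -` ball z r"
  define S' where "S' = \<phi> -` W"
  have "open S" "open S'"
    unfolding S_def S'_def using cont W(1) by (auto intro!: open_vimage)
  have "convex S"
  proof (rule convexI)
    fix s t :: complex and u w :: real
    assume *: "s \<in> S" "t \<in> S" "0 \<le> u" "0 \<le> w" "u + w = 1"
    have "\<phi> (u *\<^sub>R s + w *\<^sub>R t) = u *\<^sub>R \<phi> s + w *\<^sub>R \<phi> t"
    proof -
      have "u *\<^sub>R \<phi> s + w *\<^sub>R \<phi> t = (u + w) *\<^sub>R a + (u *\<^sub>R s + w *\<^sub>R t) *s v"
        unfolding \<phi>_def by (simp add: vec_eq_iff algebra_simps)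
      then show ?thesis using * by (simp add: \<phi>_def)
    qed
    then show "u *\<^sub>R s + w *\<^sub>R t \<in> S"
      using * convexD[OF convex_ball, of "\<phi> s" z r "\<phi> t" u w] by (auto simp: S_def)
  qed
  have "(p \<circ> \<phi>) holomorphic_on S"
  proof (unfold holomorphic_on_def, intro ballI)
    fix t assume "t \<in> S"
    then obtain D where D: "(p has_derivative D) (at (\<phi> t))" "\<forall>c v. D (c *s v) = c * D v"
      using p unfolding holo_on_def S_def by blast
    have "(p \<circ> \<phi> has_derivative (\<lambda>s. D (s *s v))) (at t)"
      using has_derivative_compose[OF d\<phi> D(1)] by (simp add: o_def)
    then have "(p \<circ> \<phi> has_derivative (*) (D v)) (at t)"
      using D(2) by (simp add: mult.commute[of _ "D v"])
    then show "p \<circ> \<phi> field_differentiable at t within S"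
      by (metis field_differentiable_at_within field_differentiable_def has_field_derivative_def)
  qed
  have "0 \<in> S'" using a by (simp add: S'_def \<phi>_def)
  then have "S' \<subseteq> S" "S' \<noteq> {}" using W(3) unfolding S_def S'_def by auto
  have "1 \<in> S" using x by (auto simp: S_def \<phi>_def v_def)
  have "(p \<circ> \<phi>) 1 = 0"
    using analytic_continuation_open[OF \<open>open S'\<close> \<open>open S\<close> \<open>S' \<noteq> {}\<close> convex_connected[OF \<open>convex S\<close>]
        \<open>S' \<subseteq> S\<close> \<open>(p \<circ> \<phi>) holomorphic_on S\<close>, of "\<lambda>_. 0" 1] \<open>1 \<in> S\<close> W(4)
    by (auto simp: S'_def)
  then show ?thesis by (simp add: \<phi>_def v_def)
qed

lemma mero_funI:
  assumes "\<And>z. \<exists>U p d. open U \<and> z \<in> U \<and> holo_on p U \<and> holo_on d U \<and>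
     (\<forall>V. open V \<and> V \<noteq> {} \<and> V \<subseteq> U \<longrightarrow> (\<exists>x\<in>V. d x \<noteq> 0)) \<and>
     (\<forall>x\<in>U. d x \<noteq> 0 \<longrightarrow> f x = p x / d x)"
  shows "mero_fun f"
  using assms unfolding mero_fun_def by blast

lemma mero_funE:
  assumes "mero_fun f"
  obtains U p d where "open U" "z \<in> U" "holo_on p U" "holo_on d U"
    "\<And>V. open V \<Longrightarrow> V \<noteq> {} \<Longrightarrow> V \<subseteq> U \<Longrightarrow> \<exists>x\<in>V. d x \<noteq> 0"
    "\<And>x. x \<in> U \<Longrightarrow> d x \<noteq> 0 \<Longrightarrow> f x = p x / d x"
  using assms unfolding mero_fun_def by metis

lemma mult_nonvanishing:
  assumes "holo_on d U" "open U"
    "\<And>V. open V \<Longrightarrow> V \<noteq> {} \<Longrightarrow> V \<subseteq> U \<Longrightarrow> \<exists>x\<in>V. d x \<noteq> 0"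
    "\<And>V. open V \<Longrightarrow> V \<noteq> {} \<Longrightarrow> V \<subseteq> U \<Longrightarrow> \<exists>x\<in>V. e x \<noteq> 0"
    "open V" "V \<noteq> {}" "V \<subseteq> U"
  shows "\<exists>x\<in>V. d x * e x \<noteq> 0"
proof -
  have "open ({x\<in>U. d x \<noteq> 0} \<inter> V)" using holo_on_open_nonzero assms by blast
  moreover have "{x\<in>U. d x \<noteq> 0} \<inter> V \<noteq> {}" using assms(3)[OF assms(5-7)] assms(7) by auto
  ultimately obtain x where "x \<in> {x\<in>U. d x \<noteq> 0} \<inter> V" "e x \<noteq> 0"
    using assms(4)[of "{x\<in>U. d x \<noteq> 0} \<inter> V"] by auto
  then show ?thesis by auto
qed

lemma mero_fun_const: "mero_fun (\<lambda>x. c)"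
  by (rule mero_funI, rule exI[of _ UNIV], rule exI[of _ "\<lambda>x. c"], rule exI[of _ "\<lambda>x. 1"])
     (auto simp: holo_on_const)

lemma mero_fun_common_denominator:
  assumes f: "mero_fun f" and g: "mero_fun g"
  obtains U p p' d where "open U" "z \<in> U" "holo_on p U" "holo_on p' U" "holo_on d U"
    "\<And>V. open V \<Longrightarrow> V \<noteq> {} \<Longrightarrow> V \<subseteq> U \<Longrightarrow> \<exists>x\<in>V. d x \<noteq> 0"
    "\<And>x. x \<in> U \<Longrightarrow> d x \<noteq> 0 \<Longrightarrow> f x = p x / d x"
    "\<And>x. x \<in> U \<Longrightarrow> d x \<noteq> 0 \<Longrightarrow> g x = p' x / d x"
proof -
  obtain U p d where 1: "open U" "z \<in> U" "holo_on p U" "holo_on d U"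
    "\<And>V. open V \<Longrightarrow> V \<noteq> {} \<Longrightarrow> V \<subseteq> U \<Longrightarrow> \<exists>x\<in>V. d x \<noteq> 0"
    "\<And>x. x \<in> U \<Longrightarrow> d x \<noteq> 0 \<Longrightarrow> f x = p x / d x"
    using mero_funE[OF f, of z] by blast
  obtain U' p' d' where 2: "open U'" "z \<in> U'" "holo_on p' U'" "holo_on d' U'"
    "\<And>V. open V \<Longrightarrow> V \<noteq> {} \<Longrightarrow> V \<subseteq> U' \<Longrightarrow> \<exists>x\<in>V. d' x \<noteq> 0"
    "\<And>x. x \<in> U' \<Longrightarrow> d' x \<noteq> 0 \<Longrightarrow> g x = p' x / d' x"
    using mero_funE[OF g, of z] by blast
  have h: "holo_on p (U \<inter> U')" "holo_on d (U \<inter> U')" "holo_on p' (U \<inter> U')" "holo_on d' (U \<inter> U')"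
    using 1 2 by (auto intro: holo_on_subset)
  have nz: "\<exists>x\<in>V. d x * d' x \<noteq> 0" if "open V" "V \<noteq> {}" "V \<subseteq> U \<inter> U'" for V
    by (rule mult_nonvanishing[of d "U \<inter> U'" d' V]) (use h 1 2 that in auto)
  show thesis
  proof (rule that[of "U \<inter> U'" "\<lambda>x. p x * d' x" "\<lambda>x. p' x * d x" "\<lambda>x. d x * d' x"])
    show "open (U \<inter> U')" "z \<in> U \<inter> U'" using 1 2 by auto
    show "holo_on (\<lambda>x. p x * d' x) (U \<inter> U')" "holo_on (\<lambda>x. p' x * d x) (U \<inter> U')"
      "holo_on (\<lambda>x. d x * d' x) (U \<inter> U')" by (intro h holo_on_mult)+
  qed (use nz 1(6) 2(6) in auto)
qed

lemma mero_fun_add_mult: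
  assumes f: "mero_fun f" and g: "mero_fun g"
  shows "mero_fun (\<lambda>x. f x + g x)" "mero_fun (\<lambda>x. f x * g x)"
proof -
  have "\<exists>U p d. open U \<and> z \<in> U \<and> holo_on p U \<and> holo_on d U \<and>
     (\<forall>V. open V \<and> V \<noteq> {} \<and> V \<subseteq> U \<longrightarrow> (\<exists>x\<in>V. d x \<noteq> 0)) \<and>
     (\<forall>x\<in>U. d x \<noteq> 0 \<longrightarrow> f x + g x = p x / d x)" for z
  proof -
    obtain U p p' d where *: "open U" "z \<in> U" "holo_on p U" "holo_on p' U" "holo_on d U"
      "\<And>V. open V \<Longrightarrow> V \<noteq> {} \<Longrightarrow> V \<subseteq> U \<Longrightarrow> \<exists>x\<in>V. d x \<noteq> 0"
      "\<And>x. x \<in> U \<Longrightarrow> d x \<noteq> 0 \<Longrightarrow> f x = p x / d x"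
      "\<And>x. x \<in> U \<Longrightarrow> d x \<noteq> 0 \<Longrightarrow> g x = p' x / d x"
      using mero_fun_common_denominator[OF f g, of z] by blast
    then show ?thesis
      by (intro exI[of _ U] exI[of _ "\<lambda>x. p x + p' x"] exI[of _ d])
         (auto simp: add_divide_distrib intro: holo_on_add)
  qed
  then show "mero_fun (\<lambda>x. f x + g x)" by (rule mero_funI)
  have "\<exists>U p d. open U \<and> z \<in> U \<and> holo_on p U \<and> holo_on d U \<and>
     (\<forall>V. open V \<and> V \<noteq> {} \<and> V \<subseteq> U \<longrightarrow> (\<exists>x\<in>V. d x \<noteq> 0)) \<and>
     (\<forall>x\<in>U. d x \<noteq> 0 \<longrightarrow> f x * g x = p x / d x)" for z
  proof -
    obtain U p p' d where *: "open U" "z \<in> U" "holo_on p U" "holo_on p' U" "holo_on d U"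
      "\<And>V. open V \<Longrightarrow> V \<noteq> {} \<Longrightarrow> V \<subseteq> U \<Longrightarrow> \<exists>x\<in>V. d x \<noteq> 0"
      "\<And>x. x \<in> U \<Longrightarrow> d x \<noteq> 0 \<Longrightarrow> f x = p x / d x"
      "\<And>x. x \<in> U \<Longrightarrow> d x \<noteq> 0 \<Longrightarrow> g x = p' x / d x"
      using mero_fun_common_denominator[OF f g, of z] by blast
    then show ?thesis
      by (intro exI[of _ U] exI[of _ "\<lambda>x. p x * p' x"] exI[of _ "\<lambda>x. d x * d x"])
         (auto intro: holo_on_mult)
  qed
  then show "mero_fun (\<lambda>x. f x * g x)" by (rule mero_funI)
qed

lemma mero_fun_shift:
  assumes "mero_fun f" shows "mero_fun (\<lambda>x. f (x + a))"
proof (rule mero_funI)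
  fix z
  obtain U p d where 1: "open U" "z + a \<in> U" "holo_on p U" "holo_on d U"
      "\<And>V. open V \<Longrightarrow> V \<noteq> {} \<Longrightarrow> V \<subseteq> U \<Longrightarrow> \<exists>x\<in>V. d x \<noteq> 0"
      "\<And>x. x \<in> U \<Longrightarrow> d x \<noteq> 0 \<Longrightarrow> f x = p x / d x"
    using mero_funE[OF assms, of "z + a"] by blast
  let ?U = "(\<lambda>x. x + a) -` U"
  have "open ?U" by (rule open_vimage[OF 1(1)]) (auto intro!: continuous_intros)
  moreover have "\<exists>x\<in>V. d (x + a) \<noteq> 0" if "open V" "V \<noteq> {}" "V \<subseteq> ?U" for V
  proof -
    have "open ((+) a ` V)" using that(1) by (rule open_translation)
    moreover have "(+) a ` V \<noteq> {}" "(+) a ` V \<subseteq> U" using that by (auto simp: add.commute)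
    ultimately have "\<exists>y\<in>(+) a ` V. d y \<noteq> 0" by (rule 1(5))
    then show ?thesis by (auto simp: add.commute)
  qed
  ultimately show "\<exists>U p d. open U \<and> z \<in> U \<and> holo_on p U \<and> holo_on d U \<and>
     (\<forall>V. open V \<and> V \<noteq> {} \<and> V \<subseteq> U \<longrightarrow> (\<exists>x\<in>V. d x \<noteq> 0)) \<and>
     (\<forall>x\<in>U. d x \<noteq> 0 \<longrightarrow> f (x + a) = p x / d x)"
    by (intro exI[of _ ?U] exI[of _ "\<lambda>x. p (x + a)"] exI[of _ "\<lambda>x. d (x + a)"])
       (use 1 holo_on_shift in auto)
qed

lemma generically_shift:
  fixes P :: "'a::real_normed_vector \<Rightarrow> bool"
  assumes "generically P" shows "generically (\<lambda>x. P (x + a))"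
proof (rule genericallyI)
  fix V :: "'a set" assume V: "open V" "V \<noteq> {}"
  then have "open ((+) a ` V)" "(+) a ` V \<noteq> {}" by (auto simp: open_translation)
  from genericallyD[OF assms this] obtain W where W: "open W" "W \<noteq> {}" "W \<subseteq> (+) a ` V" "\<forall>x\<in>W. P x" .
  then show "\<exists>W. open W \<and> W \<noteq> {} \<and> W \<subseteq> V \<and> (\<forall>x\<in>W. P (x + a))"
    by (intro exI[of _ "(+) (-a) ` W"] conjI open_translation) auto
qed

lemma mero_fun_zero_or_nonvanishing:
  fixes f :: "complex^'n \<Rightarrow> complex"
  assumes f: "mero_fun f" and nz: "\<not> generically (\<lambda>x. f x = 0)"
    and U: "open U" "holo_on p U" "holo_on d U"
      "\<And>V. open V \<Longrightarrow> V \<noteq> {} \<Longrightarrow> V \<subseteq> U \<Longrightarrow> \<exists>x\<in>V. d x \<noteq> 0"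
      "\<And>x. x \<in> U \<Longrightarrow> d x \<noteq> 0 \<Longrightarrow> f x = p x / d x"
    and V: "open V" "V \<noteq> {}" "V \<subseteq> U"
  shows "\<exists>x\<in>V. p x \<noteq> 0"
proof (rule ccontr)
  assume "\<not> ?thesis"
  then have p0: "\<And>x. x \<in> V \<Longrightarrow> p x = 0" by auto
  define A where "A = \<Union>{V. open V \<and> (\<forall>W. open W \<and> W \<noteq> {} \<and> W \<subseteq> V \<longrightarrow>
     (\<exists>X. open X \<and> X \<noteq> {} \<and> X \<subseteq> W \<and> (\<forall>x\<in>X. f x = 0)))}"
  have AI: "V \<subseteq> A" if V: "open V" "V \<subseteq> U" and "open U" and p0: "\<And>x. x \<in> V \<Longrightarrow> p x = 0"
    and U: "holo_on d U" "\<And>V. open V \<Longrightarrow> V \<noteq> {} \<Longrightarrow> V \<subseteq> U \<Longrightarrow> \<exists>x\<in>V. d x \<noteq> 0"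
      "\<And>x. x \<in> U \<Longrightarrow> d x \<noteq> 0 \<Longrightarrow> f x = p x / d x" for V U p d
  proof -
    have "\<exists>X. open X \<and> X \<noteq> {} \<and> X \<subseteq> W \<and> (\<forall>x\<in>X. f x = 0)" if W: "open W" "W \<noteq> {}" "W \<subseteq> V" for W
    proof (rule exI[of _ "{x\<in>U. d x \<noteq> 0} \<inter> W"], intro conjI)
      show "open ({x\<in>U. d x \<noteq> 0} \<inter> W)" using holo_on_open_nonzero U W \<open>open U\<close> by blast
      show "{x\<in>U. d x \<noteq> 0} \<inter> W \<noteq> {}" using U(2)[of W] W V by auto
    qed (use W p0 U(3) in auto)
    then show ?thesis unfolding A_def using V(1) by blast
  qed
  have "open A" unfolding A_def by auto
  have "closed A"
  proof -
    have "z \<in> A" if z: "z \<in> closure A" for z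
    proof -
      obtain U p d where U: "open U" "z \<in> U" "holo_on p U" "holo_on d U"
        "\<And>V. open V \<Longrightarrow> V \<noteq> {} \<Longrightarrow> V \<subseteq> U \<Longrightarrow> \<exists>x\<in>V. d x \<noteq> 0"
        "\<And>x. x \<in> U \<Longrightarrow> d x \<noteq> 0 \<Longrightarrow> f x = p x / d x"
        using mero_funE[OF f, of z] by blast
      obtain r where r: "r > 0" "ball z r \<subseteq> U" using U(1,2) openE by blast
      have "ball z r \<inter> A \<noteq> {}"
        using z r(1) open_Int_closure_eq_empty[OF open_ball, of z r A] centre_in_ball[of z r] by blast
      then obtain a where a1: "a \<in> ball z r" "a \<in> A" by auto
      then obtain V where a2: "a \<in> V" "open V" "\<forall>W. open W \<and> W \<noteq> {} \<and> W \<subseteq> V \<longrightarrow>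
     (\<exists>X. open X \<and> X \<noteq> {} \<and> X \<subseteq> W \<and> (\<forall>x\<in>X. f x = 0))" unfolding A_def by blast
      note a = a1(1) a2
      have "open (V \<inter> ball z r) \<and> V \<inter> ball z r \<noteq> {} \<and> V \<inter> ball z r \<subseteq> V" using a by auto
      from a(4)[rule_format, OF this] obtain X where X: "open X" "X \<noteq> {}" "X \<subseteq> V \<inter> ball z r" "\<forall>x\<in>X. f x = 0" by blast
      let ?Y = "{x\<in>U. d x \<noteq> 0} \<inter> X"
      have "open ?Y" using holo_on_open_nonzero U X by blast
      moreover have "X \<subseteq> U" using X(3) r(2) by blast
      from U(5)[OF X(1,2) this] this have "?Y \<noteq> {}" by blast
      moreover have "?Y \<subseteq> ball z r" using X by auto
      moreover have "p x = 0" if "x \<in> ?Y" for x using that U(6)[of x] X by auto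
      ultimately have "\<And>x. x \<in> ball z r \<Longrightarrow> p x = 0"
        using holo_on_ball_zero[OF holo_on_subset[OF U(3) r(2)]] by blast
      from AI[OF open_ball r(2) U(1) this U(4-6)] have "ball z r \<subseteq> A" by blast
      then show ?thesis using r by auto
    qed
    then show ?thesis using closure_subset_eq by blast
  qed
  have "A \<noteq> {}" using AI[OF V(1,3) U(1) p0 U(3-5)] V(2) by blast
  then have "A = UNIV" using \<open>open A\<close> \<open>closed A\<close> clopen by blast
  have "generically (\<lambda>x. f x = 0)"
  proof (rule genericallyI)
    fix V :: "(complex^'n) set" assume V: "open V" "V \<noteq> {}"
    then obtain a where "a \<in> V" by auto
    have "a \<in> A" using \<open>A = UNIV\<close> by simp
    then obtain V' where V': "a \<in> V'" "open V'" "\<forall>W. open W \<and> W \<noteq> {} \<and> W \<subseteq> V' \<longrightarrow>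
       (\<exists>X. open X \<and> X \<noteq> {} \<and> X \<subseteq> W \<and> (\<forall>x\<in>X. f x = 0))"
      unfolding A_def by blast
    have "open (V \<inter> V') \<and> V \<inter> V' \<noteq> {} \<and> V \<inter> V' \<subseteq> V'" using V V' \<open>a \<in> V\<close> by auto
    from V'(3)[rule_format, OF this] show "\<exists>W. open W \<and> W \<noteq> {} \<and> W \<subseteq> V \<and> (\<forall>x\<in>W. f x = 0)" by blast
  qed
  with nz show False by blast
qed

lemma mero_fun_inverse_nonzero:
  fixes f :: "complex^'n \<Rightarrow> complex"
  assumes f: "mero_fun f" and nz: "\<not> generically (\<lambda>x. f x = 0)"
  shows "mero_fun (\<lambda>x. inverse (f x))" "generically (\<lambda>x. f x \<noteq> 0)"
proof -
  show "mero_fun (\<lambda>x. inverse (f x))"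
  proof (rule mero_funI)
    fix z
    obtain U p d where U: "open U" "z \<in> U" "holo_on p U" "holo_on d U"
      "\<And>V. open V \<Longrightarrow> V \<noteq> {} \<Longrightarrow> V \<subseteq> U \<Longrightarrow> \<exists>x\<in>V. d x \<noteq> 0"
      "\<And>x. x \<in> U \<Longrightarrow> d x \<noteq> 0 \<Longrightarrow> f x = p x / d x"
      using mero_funE[OF f, of z] by blast
    have pn: "\<And>V. open V \<Longrightarrow> V \<noteq> {} \<Longrightarrow> V \<subseteq> U \<Longrightarrow> \<exists>x\<in>V. p x \<noteq> 0"
      using mero_fun_zero_or_nonvanishing[OF f nz U(1,3,4,5,6)] by blast
    have "\<And>V. open V \<Longrightarrow> V \<noteq> {} \<Longrightarrow> V \<subseteq> U \<Longrightarrow> \<exists>x\<in>V. d x * p x \<noteq> 0"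
      using mult_nonvanishing[OF U(4,1,5) pn] by blast
    moreover have "holo_on (\<lambda>x. d x * d x) U" "holo_on (\<lambda>x. d x * p x) U"
      using U by (auto intro: holo_on_mult)
    moreover have "\<And>x. x \<in> U \<Longrightarrow> d x * p x \<noteq> 0 \<Longrightarrow> inverse (f x) = (d x * d x) / (d x * p x)"
      using U(6) by auto
    ultimately show "\<exists>U p d. open U \<and> z \<in> U \<and> holo_on p U \<and> holo_on d U \<and>
     (\<forall>V. open V \<and> V \<noteq> {} \<and> V \<subseteq> U \<longrightarrow> (\<exists>x\<in>V. d x \<noteq> 0)) \<and>
     (\<forall>x\<in>U. d x \<noteq> 0 \<longrightarrow> inverse (f x) = p x / d x)" 
      by (intro exI[of _ U] exI[of _ "\<lambda>x. d x * d x"] exI[of _ "\<lambda>x. d x * p x"])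
         (use U(1,2) in auto)
  qed
  show "generically (\<lambda>x. f x \<noteq> 0)"
  proof (rule genericallyI)
    fix V :: "(complex^'n) set" assume V: "open V" "V \<noteq> {}"
    then obtain z where "z \<in> V" by auto
    obtain U p d where U: "open U" "z \<in> U" "holo_on p U" "holo_on d U"
      "\<And>V. open V \<Longrightarrow> V \<noteq> {} \<Longrightarrow> V \<subseteq> U \<Longrightarrow> \<exists>x\<in>V. d x \<noteq> 0"
      "\<And>x. x \<in> U \<Longrightarrow> d x \<noteq> 0 \<Longrightarrow> f x = p x / d x"
      using mero_funE[OF f, of z] by blast
    have pn: "\<And>V. open V \<Longrightarrow> V \<noteq> {} \<Longrightarrow> V \<subseteq> U \<Longrightarrow> \<exists>x\<in>V. p x \<noteq> 0"
      using mero_fun_zero_or_nonvanishing[OF f nz U(1,3,4,5,6)] by blast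
    let ?W = "{x\<in>U. d x * p x \<noteq> 0} \<inter> V"
    have "\<exists>x\<in>V \<inter> U. d x * p x \<noteq> 0"
      using mult_nonvanishing[OF U(4,1,5) pn] U V \<open>z \<in> V\<close> by blast
    then have "?W \<noteq> {}" by auto
    moreover have "open ?W" using holo_on_open_nonzero[OF holo_on_mult[OF U(4,3)] U(1)] V by blast
    ultimately show "\<exists>W. open W \<and> W \<noteq> {} \<and> W \<subseteq> V \<and> (\<forall>x\<in>W. f x \<noteq> 0)"
      using U(6) by (intro exI[of _ ?W]) auto
  qed
qed

lemma mero_fun_inverse:
  fixes f :: "complex^'n \<Rightarrow> complex"
  assumes f: "mero_fun f" shows "mero_fun (\<lambda>x. inverse (f x))"
proof (cases "generically (\<lambda>x. f x = 0)")
  case False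
  then show ?thesis using mero_fun_inverse_nonzero f by blast
next
  case True
  show ?thesis
  proof (rule mero_funI)
    fix z
    obtain U p d where U: "open U" "z \<in> U" "holo_on p U" "holo_on d U"
      "\<And>V. open V \<Longrightarrow> V \<noteq> {} \<Longrightarrow> V \<subseteq> U \<Longrightarrow> \<exists>x\<in>V. d x \<noteq> 0"
      "\<And>x. x \<in> U \<Longrightarrow> d x \<noteq> 0 \<Longrightarrow> f x = p x / d x"
      using mero_funE[OF f, of z] by blast
    have p0: "p x = 0" if "x \<in> U" for x
    proof (rule ccontr)
      assume "p x \<noteq> 0"
      let ?V = "{x\<in>U. p x \<noteq> 0}"
      have V: "open ?V" "?V \<noteq> {}" using holo_on_open_nonzero[OF U(3,1)] that \<open>p x \<noteq> 0\<close> by auto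
      obtain W where W: "open W" "W \<noteq> {}" "W \<subseteq> ?V" "\<forall>x\<in>W. f x = 0" using genericallyD[OF True V] .
      then obtain y where "y \<in> W" "d y \<noteq> 0" using U(5)[of W] by auto
      then show False using W U(6)[of y] by auto
    qed
    have "\<And>x. x \<in> U \<Longrightarrow> d x \<noteq> 0 \<Longrightarrow> inverse (f x) = 0 / d x" using U(6) p0 by auto
    then show "\<exists>U p d. open U \<and> z \<in> U \<and> holo_on p U \<and> holo_on d U \<and>
     (\<forall>V. open V \<and> V \<noteq> {} \<and> V \<subseteq> U \<longrightarrow> (\<exists>x\<in>V. d x \<noteq> 0)) \<and>
     (\<forall>x\<in>U. d x \<noteq> 0 \<longrightarrow> inverse (f x) = p x / d x)"
      by (intro exI[of _ U] exI[of _ "\<lambda>x. 0"] exI[of _ d]) (use U holo_on_const[of 0 U] in auto)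
  qed
qed

lemma mero_eq_cong1:
  assumes "mero_eq f f'" "mero_fun (\<lambda>x. F (f x))" "mero_fun (\<lambda>x. F (f' x))"
  shows "mero_eq (\<lambda>x. F (f x)) (\<lambda>x. F (f' x))"
  using assms by (auto simp: mero_eq_def elim: generically_mono)

lemma mero_eq_cong2:
  assumes "mero_eq f f'" "mero_eq g g'" "mero_fun (\<lambda>x. F (f x) (g x))" "mero_fun (\<lambda>x. F (f' x) (g' x))"
  shows "mero_eq (\<lambda>x. F (f x) (g x)) (\<lambda>x. F (f' x) (g' x))"
  using assms generically_conj[of "\<lambda>x. f x = f' x" "\<lambda>x. g x = g' x"]
  by (auto simp: mero_eq_def elim: generically_mono)

lemma part_equivp_mero_eq: "part_equivp (mero_eq :: (complex^'n \<Rightarrow> complex) \<Rightarrow> _)"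
proof (rule part_equivpI)
  show "\<exists>f::complex^'n \<Rightarrow> complex. mero_eq f f"
    by (rule exI[of _ "\<lambda>x. 0"]) (auto simp: mero_eq_def mero_fun_const generically_True)
  show "symp (mero_eq :: (complex^'n \<Rightarrow> complex) \<Rightarrow> _)"
    by (auto simp: symp_def mero_eq_def elim: generically_mono)
  show "transp (mero_eq :: (complex^'n \<Rightarrow> complex) \<Rightarrow> _)"
  proof (rule transpI)
    fix f g h :: "complex^'n \<Rightarrow> complex"
    assume "mero_eq f g" "mero_eq g h"
    then show "mero_eq f h"
      using generically_conj[of "\<lambda>x. f x = g x" "\<lambda>x. g x = h x"]
      by (auto simp: mero_eq_def elim: generically_mono)
  qed
qed

quotient_type 'n mero = "complex^('n::finite) \<Rightarrow> complex" / partial: mero_eq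
  by (rule part_equivp_mero_eq)

lemma mero_eq_imp: "mero_eq f g \<Longrightarrow> mero_fun f" "mero_eq f g \<Longrightarrow> mero_fun g"
  by (auto simp: mero_eq_def)

instantiation mero :: (finite) field
begin
lift_definition zero_mero :: "'a mero" is "\<lambda>x. 0"
  by (auto simp: mero_eq_def mero_fun_const generically_True)
lift_definition one_mero :: "'a mero" is "\<lambda>x. 1"
  by (auto simp: mero_eq_def mero_fun_const generically_True)
lift_definition plus_mero :: "'a mero \<Rightarrow> 'a mero \<Rightarrow> 'a mero" is "\<lambda>f g x. f x + g x"
  by (rule mero_eq_cong2) (auto intro: mero_fun_add_mult dest: mero_eq_imp)
lift_definition times_mero :: "'a mero \<Rightarrow> 'a mero \<Rightarrow> 'a mero" is "\<lambda>f g x. f x * g x"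
  by (rule mero_eq_cong2) (auto intro: mero_fun_add_mult dest: mero_eq_imp)
lift_definition uminus_mero :: "'a mero \<Rightarrow> 'a mero" is "\<lambda>f x. - f x"
  by (rule mero_eq_cong1)
     (use mero_fun_add_mult(2)[OF mero_fun_const[of "-1"]] in \<open>auto dest: mero_eq_imp\<close>)
lift_definition inverse_mero :: "'a mero \<Rightarrow> 'a mero" is "\<lambda>f x. inverse (f x)"
  by (rule mero_eq_cong1) (auto intro: mero_fun_inverse dest: mero_eq_imp)
definition minus_mero :: "'a mero \<Rightarrow> 'a mero \<Rightarrow> 'a mero" where "minus_mero f g = f + - g"
definition divide_mero :: "'a mero \<Rightarrow> 'a mero \<Rightarrow> 'a mero" where "divide_mero f g = f * inverse g"
instance
proof
  fix f g h :: "'a mero"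
  note s = mero_eq_def mero_fun_add_mult generically_True mero_fun_const algebra_simps
  have um: "mero_fun (\<lambda>x. - f x)" if "mero_fun f" for f :: "complex^'a \<Rightarrow> complex"
    using mero_fun_add_mult(2)[OF mero_fun_const[of "-1"]] that by auto
  show "f + g + h = f + (g + h)" by transfer (auto simp: s)
  show "f + g = g + f" by transfer (auto simp: s)
  show "0 + f = f" by transfer (auto simp: s)
  show "- f + f = 0" by transfer (auto simp: s um)
  show "f - g = f + - g" by (simp add: minus_mero_def)
  show "f * g * h = f * (g * h)" by transfer (auto simp: s)
  show "f * g = g * f" by transfer (auto simp: s)
  show "1 * f = f" by transfer (auto simp: s)
  show "(f + g) * h = f * h + g * h" by transfer (auto simp: s)
  show "(0::'a mero) \<noteq> 1"
  proof (transfer, rule notI)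
    assume "mero_eq (\<lambda>x::complex^'a. 0) (\<lambda>x. 1)"
    then have "generically (\<lambda>x::complex^'a. False)" by (auto simp: mero_eq_def)
    then show False by (auto simp: generically_def)
  qed
  show "inverse (0::'a mero) = 0" by transfer (auto simp: s)
  show "f div g = f * inverse g" by (simp add: divide_mero_def)
  show "inverse f * f = 1" if "f \<noteq> 0"
    using that
  proof transfer
    fix f :: "complex^'a \<Rightarrow> complex" assume f: "mero_eq f f" and "\<not> mero_eq f (\<lambda>x. 0)"
    then have "mero_fun f" "\<not> generically (\<lambda>x. f x = 0)" by (auto simp: mero_eq_def mero_fun_const)
    from mero_fun_inverse_nonzero[OF this] \<open>mero_fun f\<close>
    show "mero_eq (\<lambda>x. inverse (f x) * f x) (\<lambda>x. 1)"
      by (auto simp: s elim: generically_mono)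
  qed
qed
end

lift_definition shift :: "complex^'n \<Rightarrow> 'n::finite mero \<Rightarrow> 'n mero" is "\<lambda>\<alpha> f l. f (l + \<alpha>)"
proof -
  fix \<alpha> :: "complex^'n" and f g :: "complex^'n \<Rightarrow> complex"
  assume "mero_eq f g"
  then show "mero_eq (\<lambda>l. f (l + \<alpha>)) (\<lambda>l. g (l + \<alpha>))"
    using generically_shift[of "\<lambda>x. f x = g x" \<alpha>] by (auto simp: mero_eq_def mero_fun_shift)
qed

lift_definition const_mero :: "complex \<Rightarrow> 'n::finite mero" is "\<lambda>c l. c"
  by (auto simp: mero_eq_def mero_fun_const generically_True)

text \<open>The class of a function; meaningful only for \<open>mero_fun f\<close>.  Below it is applied to functions of
  a difference of two coordinates with distinct indices.\<close>

definition mero_of :: "(complex^'n \<Rightarrow> complex) \<Rightarrow> 'n::finite mero" where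
  "mero_of f = abs_mero f"


section \<open>Complex algebras presented by generators and relations\<close>

definition monoid_algebra :: "('m, 'b) monoid_scheme \<Rightarrow> ('m \<Rightarrow>\<^sub>0 complex) ring" where
  "monoid_algebra G = \<lparr>
     carrier = {p. Poly_Mapping.keys p \<subseteq> carrier G},
     mult = (\<lambda>p q. \<Sum>x\<in>Poly_Mapping.keys p. \<Sum>y\<in>Poly_Mapping.keys q.
               Poly_Mapping.single (x \<otimes>\<^bsub>G\<^esub> y) (Poly_Mapping.lookup p x * Poly_Mapping.lookup q y)),
     one = Poly_Mapping.single \<one>\<^bsub>G\<^esub> 1,
     zero = 0,
     add = (+)\<rparr>"

lemma monoid_algebra_mult_superset:
  assumes "finite A" "Poly_Mapping.keys p \<subseteq> A" "finite B" "Poly_Mapping.keys q \<subseteq> B"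
  shows "p \<otimes>\<^bsub>monoid_algebra G\<^esub> q = (\<Sum>x\<in>A. \<Sum>y\<in>B.
     Poly_Mapping.single (x \<otimes>\<^bsub>G\<^esub> y) (Poly_Mapping.lookup p x * Poly_Mapping.lookup q y))"
proof -
  have "(\<Sum>x\<in>A. \<Sum>y\<in>B. Poly_Mapping.single (x \<otimes>\<^bsub>G\<^esub> y) (Poly_Mapping.lookup p x * Poly_Mapping.lookup q y))
    = (\<Sum>x\<in>Poly_Mapping.keys p. \<Sum>y\<in>B. Poly_Mapping.single (x \<otimes>\<^bsub>G\<^esub> y) (Poly_Mapping.lookup p x * Poly_Mapping.lookup q y))"
    using assms by (intro sum.mono_neutral_right) (auto simp: in_keys_iff)
  also have "\<dots> = p \<otimes>\<^bsub>monoid_algebra G\<^esub> q"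
  proof -
    have "(\<Sum>y\<in>B. Poly_Mapping.single (x \<otimes>\<^bsub>G\<^esub> y) (Poly_Mapping.lookup p x * Poly_Mapping.lookup q y)) =
      (\<Sum>y\<in>Poly_Mapping.keys q. Poly_Mapping.single (x \<otimes>\<^bsub>G\<^esub> y) (Poly_Mapping.lookup p x * Poly_Mapping.lookup q y))" for x
      using assms by (intro sum.mono_neutral_right) (auto simp: in_keys_iff)
    then show ?thesis by (simp add: monoid_algebra_def)
  qed
  finally show ?thesis by simp
qed

lemma monoid_algebra_mult_add:
  "(p + p') \<otimes>\<^bsub>monoid_algebra G\<^esub> q = p \<otimes>\<^bsub>monoid_algebra G\<^esub> q + p' \<otimes>\<^bsub>monoid_algebra G\<^esub> q"
  "q \<otimes>\<^bsub>monoid_algebra G\<^esub> (p + p') = q \<otimes>\<^bsub>monoid_algebra G\<^esub> p + q \<otimes>\<^bsub>monoid_algebra G\<^esub> p'"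
proof -
  let ?A = "Poly_Mapping.keys p \<union> Poly_Mapping.keys p'" and ?B = "Poly_Mapping.keys q"
  have s: "Poly_Mapping.keys (p + p') \<subseteq> ?A" by (rule keys_add)
  note e = monoid_algebra_mult_superset[of ?A _ ?B q] monoid_algebra_mult_superset[of ?B q ?A]
  show "(p + p') \<otimes>\<^bsub>monoid_algebra G\<^esub> q = p \<otimes>\<^bsub>monoid_algebra G\<^esub> q + p' \<otimes>\<^bsub>monoid_algebra G\<^esub> q"
    using s by (simp add: e lookup_add distrib_right single_add sum.distrib)
  show "q \<otimes>\<^bsub>monoid_algebra G\<^esub> (p + p') = q \<otimes>\<^bsub>monoid_algebra G\<^esub> p + q \<otimes>\<^bsub>monoid_algebra G\<^esub> p'"
    using s by (simp add: e lookup_add distrib_left single_add sum.distrib)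
qed

lemma monoid_algebra_mult_zero:
  "0 \<otimes>\<^bsub>monoid_algebra G\<^esub> q = 0" "q \<otimes>\<^bsub>monoid_algebra G\<^esub> 0 = 0"
  by (simp_all add: monoid_algebra_def)

lemma monoid_algebra_mult_single:
  "Poly_Mapping.single x a \<otimes>\<^bsub>monoid_algebra G\<^esub> Poly_Mapping.single y b = Poly_Mapping.single (x \<otimes>\<^bsub>G\<^esub> y) (a * b)"
  by (subst monoid_algebra_mult_superset[of "{x}" _ "{y}"]) auto

lemma monoid_algebra_mult_sum:
  "sum f A \<otimes>\<^bsub>monoid_algebra G\<^esub> q = (\<Sum>i\<in>A. f i \<otimes>\<^bsub>monoid_algebra G\<^esub> q)"
  "q \<otimes>\<^bsub>monoid_algebra G\<^esub> sum f A = (\<Sum>i\<in>A. q \<otimes>\<^bsub>monoid_algebra G\<^esub> f i)"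
  by (induction A rule: infinite_finite_induct)
     (simp_all add: monoid_algebra_mult_zero monoid_algebra_mult_add)

lemma poly_mapping_eq_sum_single:
  "p = (\<Sum>x\<in>Poly_Mapping.keys p. Poly_Mapping.single x (Poly_Mapping.lookup p x))"
  by (rule poly_mapping_eqI)
     (auto simp: lookup_sum lookup_single when_def in_keys_iff)

lemma ring_monoid_algebra:
  assumes "Group.monoid G" shows "ring (monoid_algebra G)"
proof -
  interpret G: Group.monoid G by fact
  let ?R = "monoid_algebra G"
  have car: "carrier ?R = {p. Poly_Mapping.keys p \<subseteq> carrier G}"
    and add: "add ?R = (+)" and zero: "\<zero>\<^bsub>?R\<^esub> = 0" and one: "\<one>\<^bsub>?R\<^esub> = Poly_Mapping.single \<one>\<^bsub>G\<^esub> 1"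
    by (simp_all add: monoid_algebra_def)
  have keys_mult: "Poly_Mapping.keys (p \<otimes>\<^bsub>?R\<^esub> q) \<subseteq> carrier G"
    if "Poly_Mapping.keys p \<subseteq> carrier G" "Poly_Mapping.keys q \<subseteq> carrier G" for p q
  proof
    fix z assume "z \<in> Poly_Mapping.keys (p \<otimes>\<^bsub>?R\<^esub> q)"
    then have "Poly_Mapping.lookup (p \<otimes>\<^bsub>?R\<^esub> q) z \<noteq> 0" by (simp add: in_keys_iff)
    then obtain x y where "x \<in> Poly_Mapping.keys p" "y \<in> Poly_Mapping.keys q" "z = x \<otimes>\<^bsub>G\<^esub> y"
      by (auto simp: monoid_algebra_def lookup_sum lookup_single when_def
               elim!: sum.not_neutral_contains_not_neutral split: if_splits)
    then show "z \<in> carrier G" using that by auto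
  qed
  have expand: "p = (\<Sum>x\<in>Poly_Mapping.keys p. Poly_Mapping.single x (Poly_Mapping.lookup p x))"
    for p :: "'a \<Rightarrow>\<^sub>0 complex" by (rule poly_mapping_eq_sum_single)
  have rev3: "(\<Sum>i\<in>A. \<Sum>j\<in>B. \<Sum>k\<in>C. f i j k) = (\<Sum>k\<in>C. \<Sum>j\<in>B. \<Sum>i\<in>A. f i j k)"
    for A B C :: "'a set" and f :: "'a \<Rightarrow> 'a \<Rightarrow> 'a \<Rightarrow> 'a \<Rightarrow>\<^sub>0 complex"
    by (subst sum.swap, subst (2) sum.swap, subst sum.swap) (rule refl)
  show ?thesis
  proof (rule ringI)
    show "abelian_group ?R"
    proof (rule abelian_groupI)
      fix p assume "p \<in> carrier ?R"
      then show "\<exists>q\<in>carrier ?R. q \<oplus>\<^bsub>?R\<^esub> p = \<zero>\<^bsub>?R\<^esub>"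
        by (intro bexI[of _ "- p"]) (auto simp: car add zero)
    qed (use keys_add in \<open>fastforce simp: car add zero algebra_simps\<close>)+
    show "Group.monoid ?R"
    proof (rule Group.monoidI)
      fix p q r assume *: "p \<in> carrier ?R" "q \<in> carrier ?R" "r \<in> carrier ?R"
      show "p \<otimes>\<^bsub>?R\<^esub> q \<in> carrier ?R" using * keys_mult by (auto simp: car)
      have "(p \<otimes>\<^bsub>?R\<^esub> q) \<otimes>\<^bsub>?R\<^esub> r = (\<Sum>x\<in>Poly_Mapping.keys p. \<Sum>y\<in>Poly_Mapping.keys q. \<Sum>z\<in>Poly_Mapping.keys r.
          Poly_Mapping.single (x \<otimes>\<^bsub>G\<^esub> y \<otimes>\<^bsub>G\<^esub> z)
            (Poly_Mapping.lookup p x * Poly_Mapping.lookup q y * Poly_Mapping.lookup r z))"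
        by (subst (1) expand[of p], subst (1) expand[of q], subst (1) expand[of r])
           (simp only: monoid_algebra_mult_sum monoid_algebra_mult_single, rule rev3)
      also have "\<dots> = (\<Sum>x\<in>Poly_Mapping.keys p. \<Sum>y\<in>Poly_Mapping.keys q. \<Sum>z\<in>Poly_Mapping.keys r.
          Poly_Mapping.single (x \<otimes>\<^bsub>G\<^esub> (y \<otimes>\<^bsub>G\<^esub> z))
            (Poly_Mapping.lookup p x * (Poly_Mapping.lookup q y * Poly_Mapping.lookup r z)))"
        using * by (intro sum.cong refl) (auto simp: car G.m_assoc subset_iff mult.assoc)
      also have "\<dots> = p \<otimes>\<^bsub>?R\<^esub> (q \<otimes>\<^bsub>?R\<^esub> r)"
        by (rule sym, subst (1) expand[of p], subst (1) expand[of q], subst (1) expand[of r])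
           (simp only: monoid_algebra_mult_sum monoid_algebra_mult_single, rule rev3)
      finally show "(p \<otimes>\<^bsub>?R\<^esub> q) \<otimes>\<^bsub>?R\<^esub> r = p \<otimes>\<^bsub>?R\<^esub> (q \<otimes>\<^bsub>?R\<^esub> r)" .
    next
      fix p assume *: "p \<in> carrier ?R"
      have "\<one>\<^bsub>?R\<^esub> \<otimes>\<^bsub>?R\<^esub> p = (\<Sum>x\<in>Poly_Mapping.keys p.
          Poly_Mapping.single (\<one>\<^bsub>G\<^esub> \<otimes>\<^bsub>G\<^esub> x) (1 * Poly_Mapping.lookup p x))"
        by (subst (1) expand[of p]) (simp only: one monoid_algebra_mult_sum monoid_algebra_mult_single)
      also have "\<dots> = (\<Sum>x\<in>Poly_Mapping.keys p. Poly_Mapping.single x (Poly_Mapping.lookup p x))"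
        using * by (intro sum.cong refl) (auto simp: car subset_iff)
      also have "\<dots> = p" by (rule expand[symmetric])
      finally show "\<one>\<^bsub>?R\<^esub> \<otimes>\<^bsub>?R\<^esub> p = p" .
      have "p \<otimes>\<^bsub>?R\<^esub> \<one>\<^bsub>?R\<^esub> = (\<Sum>x\<in>Poly_Mapping.keys p.
          Poly_Mapping.single (x \<otimes>\<^bsub>G\<^esub> \<one>\<^bsub>G\<^esub>) (Poly_Mapping.lookup p x * 1))"
        by (subst (1) expand[of p]) (simp only: one monoid_algebra_mult_sum monoid_algebra_mult_single)
      also have "\<dots> = (\<Sum>x\<in>Poly_Mapping.keys p. Poly_Mapping.single x (Poly_Mapping.lookup p x))"
        using * by (intro sum.cong refl) (auto simp: car subset_iff)
      also have "\<dots> = p" by (rule expand[symmetric])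
      finally show "p \<otimes>\<^bsub>?R\<^esub> \<one>\<^bsub>?R\<^esub> = p" .
    qed (auto simp: car one)
  qed (simp_all add: add monoid_algebra_mult_add)
qed

definition free_monoid :: "'g list monoid" where
  "free_monoid = \<lparr>carrier = UNIV, mult = (@), one = []\<rparr>"

definition free_algebra :: "('g list \<Rightarrow>\<^sub>0 complex) ring" where
  "free_algebra = monoid_algebra free_monoid"

abbreviation word :: "'g list \<Rightarrow> ('g list \<Rightarrow>\<^sub>0 complex)" where
  "word xs \<equiv> Poly_Mapping.single xs 1"

text \<open>Elements of \<open>rels\<close> are the differences of the two sides of the defining relations.\<close>

definition presented :: "('g list \<Rightarrow>\<^sub>0 complex) set \<Rightarrow> (('g list \<Rightarrow>\<^sub>0 complex) set) ring" where
  "presented rels = free_algebra Quot (Idl\<^bsub>free_algebra\<^esub> rels)"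

definition cls :: "('g list \<Rightarrow>\<^sub>0 complex) set \<Rightarrow> ('g list \<Rightarrow>\<^sub>0 complex) \<Rightarrow> ('g list \<Rightarrow>\<^sub>0 complex) set" where
  "cls rels p = (Idl\<^bsub>free_algebra\<^esub> rels) +>\<^bsub>free_algebra\<^esub> p"

definition scalar :: "('g list \<Rightarrow>\<^sub>0 complex) set \<Rightarrow> complex \<Rightarrow> ('g list \<Rightarrow>\<^sub>0 complex) set" where
  "scalar rels c = cls rels (Poly_Mapping.single [] c)"


section \<open>Weights and scalar functions\<close>

text \<open>Everything depends on the chosen logarithm \<open>logq\<close>; the deformation parameter is \<open>q = exp logq\<close>.\<close>

definition qpow :: "complex \<Rightarrow> complex \<Rightarrow> complex" where
  "qpow logq z = exp (z * logq)"

definition h0_fun :: "complex \<Rightarrow> complex \<Rightarrow> complex" where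
  "h0_fun logq z = (qpow logq (-1) - qpow logq 1) / (qpow logq (-2 * z) - 1)"

definition g_fun :: "complex \<Rightarrow> complex \<Rightarrow> complex" where
  "g_fun logq z = (qpow logq (-2 * z) - qpow logq (-2)) * (qpow logq (-2 * z) - qpow logq 2)
                / (qpow logq (-2 * z) - 1)\<^sup>2"

definition h_fun :: "complex \<Rightarrow> complex \<Rightarrow> complex" where
  "h_fun logq z = qpow logq 1 - h0_fun logq z"

definition at_diff :: "(complex \<Rightarrow> complex) \<Rightarrow> 'n::finite \<Rightarrow> 'n \<Rightarrow> 'n mero" where
  "at_diff f a b = mero_of (\<lambda>l. f (l $ a - l $ b))"

definition omega :: "'n::finite set \<Rightarrow> complex^'n" where
  "omega I = (\<Sum>i\<in>I. axis i 1)"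

definition sign_mero :: "complex \<Rightarrow> 'n::{finite,linorder} set \<Rightarrow> 'n set \<Rightarrow> 'n mero" where
  "sign_mero logq I1 I2 = (\<Prod>(k, m)\<in>{(k, m). k \<in> I1 \<and> m \<in> I2 \<and> k > m}. - at_diff (h_fun logq) k m)"


section \<open>The algebra of the dynamical quantum matrices\<close>

text \<open>\<open>Rmat logq a b c d\<close> is the entry of the R-matrix with upper indices \<open>a b\<close> and lower indices \<open>c d\<close>.\<close>

definition Rmat :: "complex \<Rightarrow> 'n::{finite,linorder} \<Rightarrow> 'n \<Rightarrow> 'n \<Rightarrow> 'n \<Rightarrow> 'n mero" where
  "Rmat logq a b c d =
     (if a = b \<and> c = a \<and> d = a then const_mero (qpow logq 1)
      else if a \<noteq> b \<and> c = a \<and> d = b then (if a < b then 1 else at_diff (g_fun logq) a b)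
      else if a \<noteq> b \<and> c = b \<and> d = a then at_diff (h0_fun logq) a b
      else 0)"

text \<open>\<open>FunL f\<close> is \<open>f\<close> in the left copy (variable \<open>\<lambda>\<close>), \<open>FunR f\<close> is \<open>f\<close> in the right copy (variable \<open>\<mu>\<close>).\<close>

datatype ('n::finite) fgen = GenT 'n 'n | FunL "'n mero" | FunR "'n mero"

definition F_rels :: "complex \<Rightarrow> ('n::{finite,linorder} fgen list \<Rightarrow>\<^sub>0 complex) set" where
  "F_rels logq =
     (\<Union>\<iota>\<in>{FunL, FunR}. {word [\<iota> (f1 + f2)] - word [\<iota> f1] - word [\<iota> f2] | f1 f2. True}
              \<union> {word [\<iota> (f1 * f2)] - word [\<iota> f1, \<iota> f2] | f1 f2. True}
              \<union> {word [\<iota> (const_mero c)] - Poly_Mapping.single [] c | c. True})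
     \<union> {word [FunL f1, FunR f2] - word [FunR f2, FunL f1] | f1 f2. True}
     \<union> {word [FunL f, GenT i j] - word [GenT i j, FunL (shift (omega {i}) f)] | f i j. True}
     \<union> {word [FunR f, GenT i j] - word [GenT i j, FunR (shift (omega {j}) f)] | f i j. True}
     \<union> {(\<Sum>x\<in>UNIV. \<Sum>y\<in>UNIV. word [FunL (Rmat logq x y a c), GenT x b, GenT y d])
         - (\<Sum>x\<in>UNIV. \<Sum>y\<in>UNIV. word [FunR (Rmat logq b d x y), GenT c y, GenT a x]) | a b c d. True}"

type_synonym 'n F_elem = "('n fgen list \<Rightarrow>\<^sub>0 complex) set"

definition F_alg :: "complex \<Rightarrow> 'n::{finite,linorder} F_elem ring" where
  "F_alg logq = presented (F_rels logq)"

definition t_gen :: "complex \<Rightarrow> 'n::{finite,linorder} \<Rightarrow> 'n \<Rightarrow> 'n F_elem" where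
  "t_gen logq i j = cls (F_rels logq) (word [GenT i j])"

definition mu_l :: "complex \<Rightarrow> 'n::{finite,linorder} mero \<Rightarrow> 'n F_elem" where
  "mu_l logq f = cls (F_rels logq) (word [FunL f])"

definition mu_r :: "complex \<Rightarrow> 'n::{finite,linorder} mero \<Rightarrow> 'n F_elem" where
  "mu_r logq f = cls (F_rels logq) (word [FunR f])"

fun ldeg :: "'n::finite fgen \<Rightarrow> complex^'n" where
  "ldeg (GenT i j) = omega {i}" | "ldeg (FunL f) = 0" | "ldeg (FunR f) = 0"

fun rdeg :: "'n::finite fgen \<Rightarrow> complex^'n" where
  "rdeg (GenT i j) = omega {j}" | "rdeg (FunL f) = 0" | "rdeg (FunR f) = 0"

definition F_hom :: "complex \<Rightarrow> (complex, 'n::{finite,linorder}) vec \<Rightarrow> (complex, 'n) vec \<Rightarrow> 'n F_elem set" where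
  "F_hom logq \<alpha> \<beta> = cls (F_rels logq) `
     {p. \<forall>xs\<in>Poly_Mapping.keys p. sum_list (map ldeg xs) = \<alpha> \<and> sum_list (map rdeg xs) = \<beta>}"


section \<open>The dynamical exterior algebra\<close>

datatype ('n::finite) wgen = GenW 'n | FunW "'n mero"

definition W_rels :: "complex \<Rightarrow> ('n::{finite,linorder} wgen list \<Rightarrow>\<^sub>0 complex) set" where
  "W_rels logq =
     {word [FunW (f1 + f2)] - word [FunW f1] - word [FunW f2] | f1 f2. True}
     \<union> {word [FunW (f1 * f2)] - word [FunW f1, FunW f2] | f1 f2. True}
     \<union> {word [FunW (const_mero c)] - Poly_Mapping.single [] c | c. True}
     \<union> {word [GenW i, GenW i] | i. True}
     \<union> {word [GenW j, GenW i] - word [FunW (- at_diff (h_fun logq) j i), GenW i, GenW j] | i j. i < j}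
     \<union> {word [FunW f, GenW i] - word [GenW i, FunW (shift (omega {i}) f)] | f i. True}"

type_synonym 'n W_elem = "('n wgen list \<Rightarrow>\<^sub>0 complex) set"

definition W_alg :: "complex \<Rightarrow> 'n::{finite,linorder} W_elem ring" where
  "W_alg logq = presented (W_rels logq)"

definition w_gen :: "complex \<Rightarrow> 'n::{finite,linorder} \<Rightarrow> 'n W_elem" where
  "w_gen logq i = cls (W_rels logq) (word [GenW i])"

definition mu_W :: "complex \<Rightarrow> 'n::{finite,linorder} mero \<Rightarrow> 'n W_elem" where
  "mu_W logq f = cls (W_rels logq) (word [FunW f])"

definition w_set :: "complex \<Rightarrow> 'n::{finite,linorder} set \<Rightarrow> 'n W_elem" where
  "w_set logq I = foldr (\<lambda>i x. w_gen logq i \<otimes>\<^bsub>W_alg logq\<^esub> x) (sorted_list_of_set I) \<one>\<^bsub>W_alg logq\<^esub>"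

fun wdeg :: "'n::finite wgen \<Rightarrow> complex^'n" where
  "wdeg (GenW i) = omega {i}" | "wdeg (FunW f) = 0"

definition W_hom :: "complex \<Rightarrow> (complex, 'n::{finite,linorder}) vec \<Rightarrow> 'n W_elem set" where
  "W_hom logq \<alpha> = cls (W_rels logq) ` {p. \<forall>xs\<in>Poly_Mapping.keys p. sum_list (map wdeg xs) = \<alpha>}"


section \<open>The dynamical tensor product and the minors\<close>

text \<open>
  The direct sum of the complex vector spaces \<open>W_hom \<alpha> \<otimes> F_hom \<alpha> \<beta>\<close>, modulo the balancing relation,
  is realised as the monoid algebra of the homogeneous pairs \<open>(v, a)\<close> of matching degree, modulo
  bilinearity and balancing.  These relations are stable under multiplication by pairs, so the ideal
  they generate is just their linear span, and \<open>(v \<otimes> a) (v' \<otimes> a') = v v' \<otimes> a a'\<close> by construction.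
\<close>

definition hom_pairs :: "complex \<Rightarrow> ('n::{finite,linorder} W_elem \<times> 'n F_elem) monoid" where
  "hom_pairs logq = (W_alg logq \<times>\<times> F_alg logq)
     \<lparr>carrier := {(v, a). \<exists>\<alpha> \<beta>. v \<in> W_hom logq \<alpha> \<and> a \<in> F_hom logq \<alpha> \<beta>}\<rparr>"

abbreviation pair :: "'n::{finite,linorder} W_elem \<Rightarrow> 'n F_elem \<Rightarrow> ('n W_elem \<times> 'n F_elem \<Rightarrow>\<^sub>0 complex)" where
  "pair v a \<equiv> Poly_Mapping.single (v, a) 1"

definition tensor_rels :: "complex \<Rightarrow> ('n::{finite,linorder} W_elem \<times> 'n F_elem \<Rightarrow>\<^sub>0 complex) set" where
  "tensor_rels logq =
     {pair (v \<oplus>\<^bsub>W_alg logq\<^esub> v') a - pair v a - pair v' a | v v' a \<alpha> \<beta>.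
        v \<in> W_hom logq \<alpha> \<and> v' \<in> W_hom logq \<alpha> \<and> a \<in> F_hom logq \<alpha> \<beta>}
     \<union> {pair v (a \<oplus>\<^bsub>F_alg logq\<^esub> a') - pair v a - pair v a' | v a a' \<alpha> \<beta>.
        v \<in> W_hom logq \<alpha> \<and> a \<in> F_hom logq \<alpha> \<beta> \<and> a' \<in> F_hom logq \<alpha> \<beta>}
     \<union> {pair (scalar (W_rels logq) c \<otimes>\<^bsub>W_alg logq\<^esub> v) a - Poly_Mapping.single (v, a) c | c v a \<alpha> \<beta>.
        v \<in> W_hom logq \<alpha> \<and> a \<in> F_hom logq \<alpha> \<beta>}
     \<union> {pair v (scalar (F_rels logq) c \<otimes>\<^bsub>F_alg logq\<^esub> a) - Poly_Mapping.single (v, a) c | c v a \<alpha> \<beta>.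
        v \<in> W_hom logq \<alpha> \<and> a \<in> F_hom logq \<alpha> \<beta>}
     \<union> {pair v (mu_l logq f \<otimes>\<^bsub>F_alg logq\<^esub> a) - pair (mu_W logq f \<otimes>\<^bsub>W_alg logq\<^esub> v) a | f v a \<alpha> \<beta>.
        v \<in> W_hom logq \<alpha> \<and> a \<in> F_hom logq \<alpha> \<beta>}"

type_synonym 'n WF_elem = "('n W_elem \<times> 'n F_elem \<Rightarrow>\<^sub>0 complex) set"

definition WF_alg :: "complex \<Rightarrow> 'n::{finite,linorder} WF_elem ring" where
  "WF_alg logq = monoid_algebra (hom_pairs logq) Quot (Idl\<^bsub>monoid_algebra (hom_pairs logq)\<^esub> (tensor_rels logq))"

definition tensor :: "complex \<Rightarrow> 'n::{finite,linorder} W_elem \<Rightarrow> 'n F_elem \<Rightarrow> 'n WF_elem" where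
  "tensor logq v a = (Idl\<^bsub>monoid_algebra (hom_pairs logq)\<^esub> (tensor_rels logq))
     +>\<^bsub>monoid_algebra (hom_pairs logq)\<^esub> pair v a"

text \<open>
  The homomorphism \<open>R\<close>.  It is complex-linear, because a scalar \<open>c\<close> of \<open>W_alg\<close> is \<open>mu_W (const_mero c)\<close>
  and is sent to \<open>1 \<otimes> mu_r (const_mero c) = c\<close>.
  Extensionality makes the function unique, not only its restriction to the carrier.
\<close>

definition coaction :: "complex \<Rightarrow> 'n::{finite,linorder} W_elem \<Rightarrow> 'n WF_elem" where
  "coaction logq = (THE \<rho>. \<rho> \<in> extensional (carrier (W_alg logq)) \<and>
     \<rho> \<in> ring_hom (W_alg logq) (WF_alg logq) \<and>
     (\<forall>i. \<rho> (w_gen logq i) = (\<Oplus>\<^bsub>WF_alg logq\<^esub>j\<in>UNIV. tensor logq (w_gen logq j) (t_gen logq j i))) \<and>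
     (\<forall>f. \<forall>x\<in>carrier (W_alg logq).
        \<rho> (mu_W logq f \<otimes>\<^bsub>W_alg logq\<^esub> x) =
          tensor logq \<one>\<^bsub>W_alg logq\<^esub> (mu_r logq f) \<otimes>\<^bsub>WF_alg logq\<^esub> \<rho> x))"

text \<open>\<open>q_minor logq I J\<close> is the minor with upper index \<open>I\<close> and lower index \<open>J\<close>, for sets of equal size.\<close>

definition q_minor :: "complex \<Rightarrow> 'n::{finite,linorder} set \<Rightarrow> 'n set \<Rightarrow> 'n F_elem" where
  "q_minor logq I J =
     (THE \<xi>. \<xi> \<in> (\<Pi>\<^sub>E K\<in>{K. card K = card J}. F_hom logq (omega K) (omega J)) \<and>
        coaction logq (w_set logq J) =
          (\<Oplus>\<^bsub>WF_alg logq\<^esub>K\<in>{K. card K = card J}. tensor logq (w_set logq K) (\<xi> K))) I"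

definition splittings :: "'n set \<Rightarrow> nat \<Rightarrow> nat \<Rightarrow> ('n set \<times> 'n set) set" where
  "splittings I r s = {(I1, I2). I1 \<union> I2 = I \<and> I1 \<inter> I2 = {} \<and> card I1 = r \<and> card I2 = s}"

end

theory Submission
  imports Defs "HOL-Library.Function_Algebras" "HOL-Computational_Algebra.Polynomial"
begin

text \<open>
  In coordinates with respect to the ordered monomials \<open>w\<^sub>I\<close>, the coaction \<open>R(w\<^sub>j)\<close> becomes an operator \<open>col j\<close>
  on functions on the subsets.  These operators satisfy the relations of the exterior algebra, so ordering
  a product of them produces the factor \<open>sign(J\<^sub>1; J\<^sub>2)(\<mu>)\<close>, while expanding the product directly
  produces the sum over \<open>I\<^sub>1\<close> and \<open>I\<^sub>2\<close>: this is the first expansion.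

  Because \<open>h(z + 1) h(-z) = 1\<close> and \<open>h(z) h(-z) = g(z)\<close>, the transposed generators satisfy the relations
  for the reversed order of the indices, and the second expansion is the first one for the transposed
  generators.  It remains to see that transposition preserves the minors.  Expanding along a column, along
  a row, and summing over all entries of the matrix, the two minors are found to agree up to the factor
  \<open>\<Sum>\<^sub>i \<Prod>\<^sub>m\<^sub>\<noteq>\<^sub>i -h(\<lambda>\<^sub>i - \<lambda>\<^sub>m)\<close>, which by Lagrange interpolation is a quantum integer up to sign; it is
  invertible because \<open>q\<close> is not a root of unity.
\<close>

text \<open>The minors are given by a definite description that rests on another one, for the
  coaction, so both must be shown to exist and to be unique before any determinant identity applies
  to them. Existence of the coaction amounts to the exterior relations for \<open>col\<close>.
  Uniqueness of the minors needs the w_K to stay independent in the dynamical tensor product, where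
  balancing moves scalars across the factors; a coefficient functional that kills the defining ideal
  settles this.

  The shifted inverse signs of the second expansion are signs in disguise: the shift turns each
  inverse of h(lambda_k - lambda_m) into h(lambda_m - lambda_k), so they are the ordinary signs for
  the reversed order. For the invariance under transposition, a single row and a single column are
  hard to compare, because their signs lie in different copies of the scalars. Summing over all rows
  and columns replaces these signs by one constant, and on constants the two copies agree.\<close>

section \<open>Calculus of meromorphic classes, shifts and exponentials\<close>

lemma mero_eq_refl: "mero_fun f \<Longrightarrow> mero_eq f f"
  by (simp add: mero_eq_def generically_True)

text \<open>The type \<open>mero\<close> is a partial quotient, so \<open>mero_of\<close> respects
  the operations only on representatives that satisfy \<open>mero_fun\<close>. These rules turn the
  concrete functions of the definitions into elements of the field.\<close>

lemma mero_of_ops: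
  assumes "mero_fun f" "mero_fun g"
  shows "mero_of (\<lambda>x. f x + g x) = mero_of f + mero_of g"
    "mero_of (\<lambda>x. f x * g x) = mero_of f * mero_of g"
    "mero_of (\<lambda>x. f x - g x) = mero_of f - mero_of g"
    "mero_of (\<lambda>x. f x / g x) = mero_of f / mero_of g"
    "shift \<alpha> (mero_of f) = mero_of (\<lambda>x. f (x + \<alpha>))"
proof -
  note e = assms[THEN mero_eq_refl]
  have m: "mero_eq (\<lambda>x. - g x) (\<lambda>x. - g x)"
    using mero_fun_add_mult(2)[OF mero_fun_const[of "-1"] assms(2)] by (simp add: mero_eq_refl)
  have i: "mero_eq (\<lambda>x. inverse (g x)) (\<lambda>x. inverse (g x))"
    using mero_fun_inverse[OF assms(2)] by (rule mero_eq_refl)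
  show "mero_of (\<lambda>x. f x + g x) = mero_of f + mero_of g"
    "mero_of (\<lambda>x. f x * g x) = mero_of f * mero_of g"
    "shift \<alpha> (mero_of f) = mero_of (\<lambda>x. f (x + \<alpha>))"
    unfolding mero_of_def using e by (simp_all add: plus_mero.abs_eq times_mero.abs_eq shift.abs_eq)
  show "mero_of (\<lambda>x. f x - g x) = mero_of f - mero_of g"
    unfolding mero_of_def minus_mero_def using e m by (simp add: plus_mero.abs_eq uminus_mero.abs_eq)
  show "mero_of (\<lambda>x. f x / g x) = mero_of f / mero_of g"
    unfolding mero_of_def divide_mero_def using e i
    by (simp add: times_mero.abs_eq inverse_mero.abs_eq divide_inverse)
qed

lemma mero_of_const: "mero_of (\<lambda>x. c) = const_mero c"
  by (simp add: mero_of_def const_mero_def)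

lemma mero_fun_diff_divide:
  assumes "mero_fun f" "mero_fun g" shows "mero_fun (\<lambda>x. f x - g x)" "mero_fun (\<lambda>x. f x / g x)"
proof -
  show "mero_fun (\<lambda>x. f x - g x)"
    using mero_fun_add_mult(1)[OF assms(1) mero_fun_add_mult(2)[OF mero_fun_const[of "-1"] assms(2)]] by simp
  show "mero_fun (\<lambda>x. f x / g x)"
    using mero_fun_add_mult(2)[OF assms(1) mero_fun_inverse[OF assms(2)]] by (simp add: divide_inverse)
qed

lemma shift_hom [simp]:
  "shift \<alpha> (f + g) = shift \<alpha> f + shift \<alpha> g" "shift \<alpha> (f * g) = shift \<alpha> f * shift \<alpha> g"
  "shift \<alpha> 0 = 0" "shift \<alpha> 1 = 1" "shift \<alpha> (- f) = - shift \<alpha> f" "shift \<alpha> (inverse f) = inverse (shift \<alpha> f)"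
  "shift \<alpha> (const_mero c) = const_mero c"
proof -
  note s = mero_eq_refl mero_fun_shift mero_fun_add_mult mero_fun_inverse mero_fun_const
  have m: "mero_fun (\<lambda>x. - f x)" if "mero_fun f" for f :: "complex^'a \<Rightarrow> complex"
    using mero_fun_add_mult(2)[OF mero_fun_const[of "-1"] that] by simp
  show "shift \<alpha> (f + g) = shift \<alpha> f + shift \<alpha> g" "shift \<alpha> (f * g) = shift \<alpha> f * shift \<alpha> g"
    by (transfer; force simp: s dest: mero_eq_imp)+
  show "shift \<alpha> 0 = 0" "shift \<alpha> 1 = 1" "shift \<alpha> (const_mero c) = const_mero c"
    by (transfer; simp add: s)+
  show "shift \<alpha> (inverse f) = inverse (shift \<alpha> f)"
    by (transfer; force simp: s dest: mero_eq_imp)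
  show "shift \<alpha> (- f) = - shift \<alpha> f"
    by (transfer; force simp: s m dest: mero_eq_imp)
qed

lemma shift_divide [simp]: "shift \<alpha> (f / g) = shift \<alpha> f / shift \<alpha> g"
  unfolding divide_mero_def by (simp only: shift_hom)

lemma shift_diff [simp]: "shift \<alpha> (f - g) = shift \<alpha> f - shift \<alpha> g"
  unfolding minus_mero_def by (simp only: shift_hom)

lemma shift_shift: "shift \<alpha> (shift \<beta> f) = shift (\<alpha> + \<beta>) f"
  by transfer (force simp: add.assoc intro: mero_eq_refl mero_fun_shift dest: mero_eq_imp)

lemma shift_0 [simp]: "shift 0 f = f"
  by transfer simp

lemma shift_prod: "shift \<alpha> (prod f A) = (\<Prod>x\<in>A. shift \<alpha> (f x))"
  by (induction A rule: infinite_finite_induct) simp_all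

lemma const_mero_0 [simp]: "const_mero 0 = 0" and const_mero_1 [simp]: "const_mero 1 = 1"
  by (transfer, simp add: mero_eq_refl mero_fun_const)+

lemma const_mero_hom:
  "const_mero (a + b) = const_mero a + const_mero b" "const_mero (a * b) = const_mero a * const_mero b"
  "const_mero (a - b) = const_mero a - const_mero b" "const_mero (a / b) = const_mero a / const_mero b"
  using mero_of_ops[OF mero_fun_const[of a] mero_fun_const[of b]] by (simp_all add: mero_of_const)

lemma const_mero_eq_0_iff: "const_mero c = 0 \<longleftrightarrow> c = 0"
proof
  assume *: "const_mero c = (0 :: 'n::finite mero)"
  show "c = 0"
  proof (rule ccontr)
    assume "c \<noteq> 0"
    then have "const_mero c * const_mero (inverse c) = (1 :: 'n mero)" by (simp flip: const_mero_hom(2))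
    then show False using * by simp
  qed
qed simp

text \<open>Splitting an exponential of a difference of coordinates into exponentials of single
  coordinates makes the structure functions rational in elements on which shifts act by
  constants.\<close>

definition exp_mero :: "complex \<Rightarrow> 'n::finite \<Rightarrow> 'n mero" where
  "exp_mero s i = mero_of (\<lambda>l. exp (s * (l $ i)))"

lemma mero_fun_exp: "mero_fun (\<lambda>l::complex^'n. exp (s * (l $ i)))"
proof -
  have "holo_on (\<lambda>l::complex^'n. exp (s * (l $ i))) UNIV"
    unfolding holo_on_def
  proof
    fix x :: "complex^'n"
    have "((\<lambda>l::complex^'n. s * (l $ i)) has_derivative (\<lambda>h. s * (h $ i))) (at x)"
      by (intro has_derivative_mult_right bounded_linear_imp_has_derivative bounded_linear_vec_nth)
    from has_derivative_compose[OF this DERIV_exp[unfolded has_field_derivative_def]]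
    show "\<exists>D. ((\<lambda>l. exp (s * (l $ i))) has_derivative D) (at x) \<and> (\<forall>c v. D (c *s v) = c * D v)"
      by (intro exI conjI) (assumption, simp add: algebra_simps)
  qed
  then show ?thesis
    by (intro mero_funI exI[of _ UNIV] exI[of _ "\<lambda>l. exp (s * (l $ i))"] exI[of _ "\<lambda>_. 1"])
       (auto intro: holo_on_const)
qed

lemma exp_mero_mult: "exp_mero s i * exp_mero t i = exp_mero (s + t) i"
  by (simp add: exp_mero_def exp_add distrib_right mero_fun_exp flip: mero_of_ops(2))

lemma exp_mero_nonzero: "exp_mero s i \<noteq> 0"
proof
  assume "exp_mero s i = 0"
  then have "exp_mero 0 i = 0" using exp_mero_mult[of s i "-s"] by simp
  then show False by (simp add: exp_mero_def mero_of_const const_mero_eq_0_iff)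
qed

lemma omega_singleton_nth: "omega {k} $ i = (if i = k then 1 else 0)"
  by (simp add: omega_def axis_def)

text \<open>The factor \<open>c\<close> covers both directions of the shift; it is used with the
  values 1 and -1.\<close>

lemma shift_exp_mero:
  "shift (c *s omega {k}) (exp_mero s i) = (if i = k then const_mero (exp (s * c)) * exp_mero s i else exp_mero s i)"
  by (cases "i = k") (simp_all add: exp_mero_def mero_of_ops(5)[OF mero_fun_exp mero_fun_exp] omega_singleton_nth
      distrib_left exp_add mero_of_ops(2)[OF mero_fun_const mero_fun_exp] mero_of_const mult.commute)

text \<open>The shift by the weight of \<open>i\<close> multiplies the left function by
  \<open>exp s\<close> and fixes the right one, so equality would force
  \<open>exp s = 1\<close>.\<close>

lemma exp_mero_eq_iff:
  assumes "exp s \<noteq> 1" "i \<noteq> j" shows "exp_mero s i \<noteq> exp_mero s j"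
proof
  assume *: "exp_mero s i = exp_mero s j"
  then have "shift (1 *s omega {i}) (exp_mero s i) = shift (1 *s omega {i}) (exp_mero s j)" by (rule arg_cong)
  then have "const_mero (exp s) * exp_mero s i = exp_mero s i"
    using assms(2) * unfolding shift_exp_mero by simp
  then have "const_mero (exp s) - 1 = (0 :: 'a mero)" using exp_mero_nonzero[of s i] by simp
  then have "const_mero (exp s - 1) = (0 :: 'a mero)" by (simp add: const_mero_hom)
  then show False using assms by (simp add: const_mero_eq_0_iff)
qed

subsection \<open>The structure functions as rational functions of \<open>q\<^sup>-\<^sup>2\<^sup>\<lambda>\<close>\<close>

lemma at_diff_h0:
  "at_diff (h0_fun c) i j = const_mero (exp (- c) - exp c) * exp_mero (-2 * c) j
     / (exp_mero (-2 * c) i - exp_mero (-2 * c) j)"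
proof -
  define s t where "s = -2 * c" and "t = 2 * c"
  have "h0_fun c (l $ i - l $ j) = (exp (- c) - exp c) / (exp (s * l $ i) * exp (t * l $ j) - 1)" for l :: "complex^'a"
    by (simp add: h0_fun_def qpow_def s_def t_def algebra_simps flip: exp_add)
  then have "at_diff (h0_fun c) i j = const_mero (exp (- c) - exp c) / (exp_mero s i * exp_mero t j - 1)"
    unfolding at_diff_def exp_mero_def
    by (simp add: mero_of_ops mero_of_const mero_fun_const mero_fun_exp mero_fun_diff_divide mero_fun_add_mult)
  \<comment> \<open>The exponentials with exponents \<open>s\<close> and \<open>t\<close> are
    inverse to each other; multiplying through by the first one clears the compound
    fraction.\<close>
  moreover have "exp_mero s j * exp_mero t j = 1"
    by (simp add: exp_mero_mult s_def t_def) (simp add: exp_mero_def mero_of_const)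
  then have "exp_mero t j = 1 / exp_mero s j"
    using exp_mero_nonzero[of s j] by (simp add: field_simps)
  ultimately have "at_diff (h0_fun c) i j = const_mero (exp (- c) - exp c) * exp_mero s j / (exp_mero s i - exp_mero s j)"
    using exp_mero_nonzero[of s j] by (simp add: divide_simps)
  then show ?thesis by (simp only: s_def)
qed

text \<open>This is the class of q^(-2 lambda_i) for q = \<open>exp c\<close>.\<close>

definition X :: "complex \<Rightarrow> 'n::finite \<Rightarrow> 'n mero" where "X c i = exp_mero (-2 * c) i"

definition H :: "complex \<Rightarrow> 'n::finite \<Rightarrow> 'n \<Rightarrow> 'n mero" where "H c i j = at_diff (h_fun c) i j"

lemma at_diff_h_g:
  shows "H c i j = const_mero (exp c) - at_diff (h0_fun c) i j"
    "at_diff (g_fun c) i j = (X c i - const_mero (exp (-2 * c)) * X c j) *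
       (X c i - const_mero (exp (2 * c)) * X c j) / (X c i - X c j)\<^sup>2"
proof -
  define s t where "s = -2 * c" and "t = 2 * c"
  let ?x = "\<lambda>l::complex^'a. exp (s * l $ i) * exp (t * l $ j)"
  have inv: "exp_mero t j = 1 / exp_mero s j"
  proof -
    have "exp_mero s j * exp_mero t j = 1"
      by (simp add: exp_mero_mult s_def t_def) (simp add: exp_mero_def mero_of_const)
    then show ?thesis using exp_mero_nonzero[of s j] by (simp add: field_simps)
  qed
  note m = mero_of_ops mero_of_const mero_fun_const mero_fun_exp mero_fun_diff_divide mero_fun_add_mult
  have x: "qpow c (-2 * (l $ i - l $ j)) = ?x l" for l :: "complex^'a"
    by (simp add: qpow_def s_def t_def algebra_simps flip: exp_add)
  have h0: "h0_fun c (l $ i - l $ j) = (exp (- c) - exp c) / (?x l - 1)" for l :: "complex^'a"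
    unfolding h0_fun_def x by (simp add: qpow_def)
  show "H c i j = const_mero (exp c) - at_diff (h0_fun c) i j"
    unfolding H_def at_diff_def h_fun_def h0 by (simp add: m qpow_def)
  have "g_fun c (l $ i - l $ j) = (?x l - exp (-2 * c)) * (?x l - exp (2 * c)) / ((?x l - 1) * (?x l - 1))"
    for l :: "complex^'a"
    unfolding g_fun_def x power2_eq_square by (simp add: qpow_def)
  then have "at_diff (g_fun c) i j =
      (exp_mero s i * exp_mero t j - const_mero (exp (-2 * c))) * (exp_mero s i * exp_mero t j - const_mero (exp (2 * c)))
      / ((exp_mero s i * exp_mero t j - 1) * (exp_mero s i * exp_mero t j - 1))"
    unfolding at_diff_def exp_mero_def by (simp add: m)
  also have "\<dots> = (exp_mero s i - const_mero (exp (-2 * c)) * exp_mero s j) *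
      (exp_mero s i - const_mero (exp (2 * c)) * exp_mero s j) / (exp_mero s i - exp_mero s j)\<^sup>2"
  proof -
    have d: "exp_mero s i * exp_mero t j - p = (exp_mero s i - p * exp_mero s j) / exp_mero s j" for p
      using exp_mero_nonzero[of s j] by (simp add: inv diff_divide_distrib)
    show ?thesis unfolding d using exp_mero_nonzero[of s j] by (simp add: power2_eq_square)
  qed
  finally show "at_diff (g_fun c) i j = (X c i - const_mero (exp (-2 * c)) * X c j) *
       (X c i - const_mero (exp (2 * c)) * X c j) / (X c i - X c j)\<^sup>2"
    unfolding X_def s_def .
qed

section \<open>Quantum integers by interpolation, and identities for the structure functions\<close>

text \<open>Lagrange interpolation of the polynomial P(y), the product of all q y - p x_m with p =
  1/q, at the nodes x_i. Removing the leading term by N, which vanishes at the nodes, leaves a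
  polynomial of smaller degree, namely the interpolant L. Since P(x_i) contains the factor (q - p)
  x_i, the quotients of the claim are the coefficients of L, and evaluation at 0 produces their
  sum.\<close>

lemma sum_prod_quotients:
  fixes x :: "'i \<Rightarrow> 'a::field"
  assumes I: "finite I" "inj_on x I" "\<And>i. i \<in> I \<Longrightarrow> x i \<noteq> 0" and q: "q \<noteq> 0"
  shows "(q - inverse q) * (\<Sum>i\<in>I. \<Prod>m\<in>I - {i}. (q * x i - inverse q * x m) / (x i - x m)) = q ^ card I - inverse q ^ card I"
proof -
  define p where "p = inverse q"
  define a where "a i = (\<Prod>m\<in>I - {i}. (q * x i - p * x m) / (x i - x m))" for i
  let ?l = "\<lambda>m. [:- x m, 1:]"
  define P where "P = (\<Prod>m\<in>I. [:- (p * x m), q:])"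
  define N where "N = smult (q ^ card I) (\<Prod>m\<in>I. ?l m)"
  define L where "L = (\<Sum>i\<in>I. smult (a i * (q - p) * x i) (\<Prod>m\<in>I - {i}. ?l m))"
  have degl: "degree (\<Prod>m\<in>J. ?l m) = card J" for J
    by (cases "finite J") (simp_all add: degree_prod_eq_sum_degree)
  have degP: "degree P = card I" using I(1) q by (simp add: P_def degree_prod_eq_sum_degree)
  have degN: "degree N \<le> card I" unfolding N_def using degl[of I] q by simp
  have degL: "degree L \<le> card I - 1" unfolding L_def
    using I(1) by (intro degree_sum_le) (auto intro!: order.trans[OF degree_smult_le] simp: degl)
  have "P = N + L"
  \<comment> \<open>For an empty index set \<open>card I - 1\<close> truncates to 0, and then
    \<open>degL\<close> does not exclude a coefficient of \<open>L\<close> in degree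
    \<open>card I\<close>.\<close>
  proof (cases "card I = 0")
    case True
    then show ?thesis using I(1) by (simp add: P_def N_def L_def)
  next
    case False
    have "coeff P (card I) = q ^ card I"
      using lead_coeff_prod[of "\<lambda>m. [:- (p * x m), q:]" I] degP q by (simp add: P_def)
    moreover have "coeff (\<Prod>m\<in>I. ?l m) (card I) = 1"
      using lead_coeff_prod[of ?l I] degl[of I] by simp
    moreover have "coeff L (card I) = 0" using degL False by (intro coeff_eq_0) simp
    ultimately have c: "coeff P (card I) = coeff (N + L) (card I)" by (simp add: N_def)
    \<comment> \<open>Both sides have degree at most \<open>card I\<close> and the same coefficient
      there, so agreement at the \<open>card I\<close> nodes suffices.\<close>
    have "poly P y = poly (N + L) y" if "y \<in> x ` I" for y
    proof -
      obtain i where i: "i \<in> I" "y = x i" using \<open>y \<in> x ` I\<close> by auto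
      have "poly (N + L) y = (\<Sum>j\<in>I. a j * (q - p) * x j * (\<Prod>m\<in>I - {j}. x i - x m))"
        using i I(1) by (simp add: N_def L_def poly_sum poly_prod) blast
      also have "\<dots> = (\<Sum>j\<in>I. if j = i then a i * (q - p) * x i * (\<Prod>m\<in>I - {i}. x i - x m) else 0)"
        using i I(1) by (intro sum.cong) auto
      also have "\<dots> = (q - p) * x i * (a i * (\<Prod>m\<in>I - {i}. x i - x m))" using i I(1) by simp
      also have "a i * (\<Prod>m\<in>I - {i}. x i - x m) = (\<Prod>m\<in>I - {i}. q * x i - p * x m)"
        unfolding a_def prod.distrib[symmetric] using i I(2) by (intro prod.cong) (auto simp: inj_on_def)
      also have "(q - p) * x i * \<dots> = poly P y"
        using i I(1) by (simp add: P_def poly_prod prod.remove[of I i] algebra_simps)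
      finally show ?thesis by simp
    qed
    moreover have "card (x ` I) = card I" using I by (intro card_image)
    ultimately show ?thesis using c degP degN degL
      by (intro poly_eqI_degree_lead_coeff[of _ "card I" _ "x ` I"]) (auto intro!: degree_add_le)
  qed
  \<comment> \<open>At 0 every linear factor becomes a multiple of some \<open>- x m\<close>, so all
    three values contain the product of all \<open>- x m\<close>, which is nonzero and can be
    cancelled.\<close>
  then have "poly P 0 = poly N 0 + poly L 0" by simp
  moreover have "poly P 0 = p ^ card I * (\<Prod>m\<in>I. - x m)"
    by (simp add: P_def poly_prod flip: prod_constant prod.distrib)
  moreover have "poly N 0 = q ^ card I * (\<Prod>m\<in>I. - x m)" by (simp add: N_def poly_prod)
  moreover have "poly L 0 = - (q - p) * (\<Sum>i\<in>I. a i) * (\<Prod>m\<in>I. - x m)"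
  proof -
    have "poly L 0 = (\<Sum>i\<in>I. a i * (q - p) * (x i * (\<Prod>m\<in>I - {i}. - x m)))"
      by (simp add: L_def poly_sum poly_prod mult.assoc)
    also have "\<dots> = (\<Sum>i\<in>I. a i * (- (q - p) * (\<Prod>m\<in>I. - x m)))"
      using I(1) by (intro sum.cong) (auto simp: prod.remove[of I] algebra_simps)
    finally show ?thesis by (simp add: sum_distrib_right sum_distrib_left mult.assoc) (simp add: algebra_simps)
  qed
  ultimately have "p ^ card I * (\<Prod>m\<in>I. - x m) = (q ^ card I - (q - p) * sum a I) * (\<Prod>m\<in>I. - x m)"
    by (simp add: algebra_simps)
  moreover have "(\<Prod>m\<in>I. - x m) \<noteq> 0" using I by simp
  ultimately have "p ^ card I = q ^ card I - (q - p) * sum a I" by simp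
  then show ?thesis by (simp add: a_def p_def)
qed

context
  fixes c :: complex
  assumes c: "exp (-2 * c) \<noteq> 1"
begin

lemma X_nonzero: "X c i \<noteq> 0"
  by (simp add: X_def exp_mero_nonzero)

text \<open>Here the assumption that q^2 is not 1 enters: it keeps the denominators of
  \<open>H\<close> from vanishing.\<close>

lemma X_distinct: "i \<noteq> j \<Longrightarrow> X c i \<noteq> X c j"
  unfolding X_def by (rule exp_mero_eq_iff[OF c])

lemma const_mero_exp_inverse: "const_mero (exp (- z)) = inverse (const_mero (exp z))"
  by (simp add: exp_minus divide_inverse[symmetric] const_mero_hom inverse_eq_divide)

lemma const_mero_exp_nonzero: "const_mero (exp z) \<noteq> 0"
  by (simp add: const_mero_eq_0_iff)

text \<open>In this form, written over the common denominator \<open>X c i - X c j\<close>,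
  exchanging the two indices amounts to exchanging q and its inverse. The identities for the pair
  \<open>H c i j\<close>, \<open>H c j i\<close> follow by inspection of the numerators.\<close>

lemma H_eq:
  assumes "i \<noteq> j"
  shows "H c i j = (const_mero (exp c) * X c i - inverse (const_mero (exp c)) * X c j) / (X c i - X c j)"
proof -
  have "q - (p - q) * y / (x - y) = (q * x - p * y) / (x - y)" if "x \<noteq> y" for p q x y :: "'a mero"
    using that by (simp add: field_simps)
  from this[OF X_distinct[OF assms]] show ?thesis
    unfolding at_diff_h_g(1) at_diff_h0 X_def[symmetric] const_mero_hom const_mero_exp_inverse .
qed

lemma at_diff_h0_eq: "at_diff (h0_fun c) i j = const_mero (exp c) - H c i j"
  by (simp add: at_diff_h_g(1))

text \<open>The sum is a constant, and constants are the same in the left and in the right copy of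
  the scalars. The crossing relation of the transposed generators rests on this.\<close>

lemma H_add_swap:
  assumes "i \<noteq> j"
  shows "H c i j + H c j i = const_mero (exp c) + inverse (const_mero (exp c))"
proof -
  have "a / x + b / (- x) = (a - b) / x" for a b x :: "'a mero" by (simp add: diff_divide_distrib)
  moreover have "X c j - X c i = - (X c i - X c j)" by simp
  ultimately have "H c i j + H c j i = ((const_mero (exp c) * X c i - inverse (const_mero (exp c)) * X c j)
     - (const_mero (exp c) * X c j - inverse (const_mero (exp c)) * X c i)) / (X c i - X c j)"
    by (simp only: H_eq[OF assms] H_eq[OF assms[symmetric]])
  also have "\<dots> = (const_mero (exp c) + inverse (const_mero (exp c))) * (X c i - X c j) / (X c i - X c j)"
    by (simp add: algebra_simps)
  finally show ?thesis using X_distinct[OF assms] by simp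
qed

lemma H_mult_swap:
  assumes "i \<noteq> j"
  shows "H c i j * H c j i = at_diff (g_fun c) i j"
proof -
  let ?q = "const_mero (exp c) :: 'a mero"
  have sq: "const_mero (exp (2 * c)) = ?q * ?q" "const_mero (exp (-2 * c)) = inverse ?q * inverse ?q"
    by (simp_all add: const_mero_exp_inverse[symmetric] flip: const_mero_hom(2) exp_add)
  have "(X c i - inverse ?q * inverse ?q * X c j) * (X c i - ?q * ?q * X c j) =
      (?q * X c i - inverse ?q * X c j) * (inverse ?q * X c i - ?q * X c j)"
  proof -
    have "(x - p * p * y) * (x - q * q * y) = (q * x - p * y) * (p * x - q * y)" if "q * p = 1" for x y p q :: "'a mero"
    proof -
      have "(x - p * p * y) * (x - q * q * y) = x * x - p * p * x * y - q * q * x * y + (q * p) * (q * p) * (y * y)"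
        "(q * x - p * y) * (p * x - q * y) = (q * p) * (x * x) - p * p * x * y - q * q * x * y + (q * p) * (y * y)"
        by (simp_all add: algebra_simps)
      then show ?thesis using that by simp
    qed
    from this[of ?q "inverse ?q"] show ?thesis by (simp add: const_mero_exp_nonzero)
  qed
  moreover have "H c j i = (inverse ?q * X c i - ?q * X c j) / (X c i - X c j)"
    using minus_divide_divide[of "inverse ?q * X c i - ?q * X c j" "X c i - X c j"]
    by (simp add: H_eq[OF assms[symmetric]])
  ultimately show ?thesis
    by (simp only: at_diff_h_g(2) sq H_eq[OF assms] power2_eq_square times_divide_times_eq)
qed

lemma shift_H: "k \<noteq> i \<Longrightarrow> k \<noteq> j \<Longrightarrow> i \<noteq> j \<Longrightarrow> shift (omega {k}) (H c i j) = H c i j"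
  using shift_exp_mero[of 1 k "-2 * c" i] shift_exp_mero[of 1 k "-2 * c" j]
  by (simp add: H_eq X_def)

text \<open>The shift multiplies \<open>X c j\<close> by q^2. This turns the numerator of
  \<open>H c i j\<close> into q times the unshifted denominator, while the shifted denominator
  becomes, up to a constant, the numerator of \<open>H c j i\<close>.\<close>

lemma H_inverse_shift:
  assumes "i \<noteq> j"
  shows "shift (- omega {j}) (inverse (H c i j)) = H c j i"
proof -
  let ?q = "const_mero (exp c) :: 'a mero"
  have m: "-1 *s omega {j} = - omega {j}" by (simp add: vec_eq_iff)
  have s: "shift (- omega {j}) (X c i) = X c i" "shift (- omega {j}) (X c j) = ?q * ?q * X c j"
    using assms shift_exp_mero[of "-1" j "-2 * c" i] shift_exp_mero[of "-1" j "-2 * c" j]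
    unfolding m X_def by (simp_all flip: const_mero_hom(2) exp_add)
  have "?q * X c i - inverse ?q * (?q * ?q * X c j) = ?q * (X c i - X c j)"
    by (simp add: field_simps const_mero_exp_nonzero)
  then have "shift (- omega {j}) (inverse (H c i j)) = (X c i - ?q * ?q * X c j) / (?q * (X c i - X c j))"
    using assms by (simp add: H_eq s)
  also have "X c i - ?q * ?q * X c j = - ?q * (?q * X c j - inverse ?q * X c i)"
    by (simp add: field_simps const_mero_exp_nonzero)
  also have "\<dots> / (?q * (X c i - X c j)) = (?q * X c j - inverse ?q * X c i) / (X c j - X c i)"
  proof -
    have "- q * u / (q * w) = u / (- w)" if "q \<noteq> 0" for q u w :: "'a mero" using that by simp
    from this[OF const_mero_exp_nonzero] show ?thesis by (simp only: minus_diff_eq)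
  qed
  also have "\<dots> = H c j i" using assms by (simp add: H_eq)
  finally show ?thesis .
qed

lemma sum_prod_H:
  "const_mero (exp c - exp (- c)) * (\<Sum>i\<in>I. \<Prod>m\<in>I - {i}. H c i m) = const_mero (exp c ^ card I - exp (- c) ^ card I)"
proof -
  have p: "const_mero (a ^ k) = (const_mero a ^ k :: 'a mero)" for a k
    by (induction k) (simp_all add: const_mero_hom)
  have "(\<Sum>i\<in>I. \<Prod>m\<in>I - {i}. H c i m) = (\<Sum>i\<in>I. \<Prod>m\<in>I - {i}.
      (const_mero (exp c) * X c i - inverse (const_mero (exp c)) * X c m) / (X c i - X c m))"
    by (intro sum.cong prod.cong refl) (auto simp: H_eq)
  then show ?thesis
    using sum_prod_quotients[of I "X c" "const_mero (exp c)"] X_distinct X_nonzero const_mero_exp_nonzero[of c]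
    by (simp add: const_mero_hom p const_mero_exp_inverse inj_on_def) blast
qed

end

section \<open>Arithmetic in free algebras\<close>

lemma ring_free_algebra: "ring (free_algebra :: ('g list \<Rightarrow>\<^sub>0 complex) ring)"
  unfolding free_algebra_def
  by (rule ring_monoid_algebra) (auto simp: free_monoid_def intro!: Group.monoidI)

lemma carrier_free_algebra [simp]: "carrier free_algebra = UNIV"
  by (simp add: free_algebra_def monoid_algebra_def free_monoid_def)

lemma free_algebra_ops [simp]:
  "add free_algebra = (+)" "\<zero>\<^bsub>free_algebra\<^esub> = 0" "\<one>\<^bsub>free_algebra\<^esub> = word []"
  by (simp_all add: free_algebra_def monoid_algebra_def free_monoid_def)

lemma monoid_algebra_minus:
  assumes "ring (monoid_algebra G)" "p \<in> carrier (monoid_algebra G)" "q \<in> carrier (monoid_algebra G)"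
  shows "p \<ominus>\<^bsub>monoid_algebra G\<^esub> q = p - q"
proof -
  interpret ring "monoid_algebra G" by fact
  have "\<ominus>\<^bsub>monoid_algebra G\<^esub> q = - q"
    using assms(3) by (intro minus_equality) (auto simp: monoid_algebra_def)
  then show ?thesis by (simp add: a_minus_def) (simp add: monoid_algebra_def)
qed

lemma free_algebra_minus: "p \<ominus>\<^bsub>free_algebra\<^esub> q = p - q"
  unfolding free_algebra_def
  by (rule monoid_algebra_minus) (simp_all add: ring_free_algebra flip: free_algebra_def)

lemma free_algebra_mult_single:
  "Poly_Mapping.single xs a \<otimes>\<^bsub>free_algebra\<^esub> Poly_Mapping.single ys b = Poly_Mapping.single (xs @ ys) (a * b)"
  by (simp add: free_algebra_def monoid_algebra_mult_single) (simp add: free_monoid_def)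

subsection \<open>Presented algebras as types\<close>

text \<open>With the relations attached to the type of generators, the quotient algebra becomes a
  type of class \<open>ring\<close>, so that ordinary sums and simplification replace reasoning
  about carriers.\<close>

class presentation =
  fixes relations :: "('a list \<Rightarrow>\<^sub>0 complex) set"

abbreviation rel_ideal :: "('g::presentation list \<Rightarrow>\<^sub>0 complex) set" where
  "rel_ideal \<equiv> Idl\<^bsub>free_algebra\<^esub> relations"

lemma ideal_rel_ideal: "ideal rel_ideal free_algebra"
  by (rule ring.genideal_ideal[OF ring_free_algebra]) auto

lemma ring_presented: "ring (presented (relations :: ('g::presentation list \<Rightarrow>\<^sub>0 complex) set))"
  unfolding presented_def by (rule ideal.quotient_is_ring[OF ideal_rel_ideal])

typedef (overloaded) 'g pres = "carrier (presented (relations :: ('g::presentation list \<Rightarrow>\<^sub>0 complex) set))"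
  using ring.ring_simprules(2)[OF ring_presented] by blast

setup_lifting type_definition_pres

instantiation pres :: (presentation) "{ring, monoid_mult}"
begin
lift_definition zero_pres :: "'a pres" is "\<zero>\<^bsub>presented relations\<^esub>"
  by (rule ring.ring_simprules(2)[OF ring_presented])
lift_definition one_pres :: "'a pres" is "\<one>\<^bsub>presented relations\<^esub>"
  by (rule ring.ring_simprules(6)[OF ring_presented])
lift_definition plus_pres :: "'a pres \<Rightarrow> 'a pres \<Rightarrow> 'a pres" is "\<lambda>x y. x \<oplus>\<^bsub>presented relations\<^esub> y"
  by (rule ring.ring_simprules(1)[OF ring_presented])
lift_definition times_pres :: "'a pres \<Rightarrow> 'a pres \<Rightarrow> 'a pres" is "\<lambda>x y. x \<otimes>\<^bsub>presented relations\<^esub> y"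
  by (rule ring.ring_simprules(5)[OF ring_presented])
lift_definition uminus_pres :: "'a pres \<Rightarrow> 'a pres" is "\<lambda>x. \<ominus>\<^bsub>presented relations\<^esub> x"
  by (rule ring.ring_simprules(3)[OF ring_presented])
lift_definition minus_pres :: "'a pres \<Rightarrow> 'a pres \<Rightarrow> 'a pres" is "\<lambda>x y. x \<ominus>\<^bsub>presented relations\<^esub> y"
  by (rule ring.ring_simprules(4)[OF ring_presented])
instance
proof
  note r = ring.ring_simprules[OF ring_presented]
  fix a b c :: "'a pres"
  show "a * b * c = a * (b * c)" by transfer (rule r(11))
  show "1 * a = a" by transfer (rule r(12))
  show "a * 1 = a" by transfer (simp add: Group.monoid.r_one[OF ring.is_monoid[OF ring_presented]])
  show "a + b + c = a + (b + c)" by transfer (rule r(7))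
  show "a + b = b + a" by transfer (rule r(10))
  show "0 + a = a" by transfer (rule r(8))
  show "- a + a = 0" by transfer (rule r(9))
  show "a - b = a + - b" by transfer (simp add: a_minus_def)
  show "(a + b) * c = a * c + b * c" by transfer (rule r(13))
  show "a * (b + c) = a * b + a * c" by transfer (rule r(23))
qed
end

lemma Rep_pres_sum: "Rep_pres (sum f A) = finsum (presented relations) (\<lambda>x. Rep_pres (f x)) A"
  if "finite A"
  using that
proof (induction A)
  case empty
  then show ?case by (simp add: zero_pres.rep_eq abelian_monoid.finsum_empty[OF abelian_group.axioms(1)[OF ring.is_abelian_group[OF ring_presented]]])
next
  case (insert x A)
  then show ?case
    by (simp add: plus_pres.rep_eq)
       (rule abelian_monoid.finsum_insert[OF abelian_group.axioms(1)[OF ring.is_abelian_group[OF ring_presented]], symmetric];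
        use Rep_pres in auto)
qed

lift_definition mk :: "('g::presentation list \<Rightarrow>\<^sub>0 complex) \<Rightarrow> 'g pres" is "cls relations"
  by (simp add: cls_def presented_def FactRing_def A_RCOSETS_def' a_r_coset_def r_coset_def)
     (auto simp: A_RCOSETS_def RCOSETS_def r_coset_def)

lemma ring_hom_cls: "cls relations \<in> ring_hom free_algebra (presented (relations :: ('g::presentation list \<Rightarrow>\<^sub>0 complex) set))"
  using ideal.rcos_ring_hom[OF ideal_rel_ideal] by (simp add: presented_def cls_def[abs_def])

lemma mk_add: "mk (p + q) = mk p + mk q"
  by transfer (use ring_hom_add[OF ring_hom_cls] in simp)

lemma mk_mult: "mk (p \<otimes>\<^bsub>free_algebra\<^esub> q) = mk p * mk q"
  by transfer (use ring_hom_mult[OF ring_hom_cls] in simp)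

lemma mk_one: "mk (word []) = 1"
  by transfer (use ring_hom_one[OF ring_hom_cls] in simp)

lemma mk_eq_iff: "mk p = mk q \<longleftrightarrow> p - q \<in> rel_ideal"
  using ring.quotient_eq_iff_same_a_r_cos[OF ring_free_algebra ideal_rel_ideal, of p q]
  by (simp add: Rep_pres_inject[symmetric] mk.rep_eq cls_def free_algebra_minus)

lemma mk_zero [simp]: "mk 0 = 0"
  using mk_add[of 0 0] by simp

lemma mk_minus: "mk (p - q) = mk p - mk q"
  using mk_add[of "p - q" q] by simp

lemma mk_sum: "mk (sum f A) = (\<Sum>x\<in>A. mk (f x))"
  by (induction A rule: infinite_finite_induct) (simp_all add: mk_add)

lemma mk_relation: "p \<in> relations \<Longrightarrow> mk p = 0"
  using mk_eq_iff[of p 0] ring.genideal_self[OF ring_free_algebra, of relations] by auto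

lemma mk_surj: obtains p where "x = mk p"
  by transfer (auto simp: presented_def FactRing_def A_RCOSETS_def RCOSETS_def cls_def a_r_coset_def)

definition gen :: "'g::presentation \<Rightarrow> 'g pres" where "gen x = mk (word [x])"
definition sc :: "complex \<Rightarrow> 'g::presentation pres" where "sc c = mk (Poly_Mapping.single [] c)"

lemma sc_add: "sc (a + b) = sc a + sc b" by (simp add: sc_def single_add mk_add)
lemma sc_mult: "sc (a * b) = sc a * sc b" by (simp add: sc_def free_algebra_mult_single flip: mk_mult)
lemma sc_0 [simp]: "sc 0 = 0" by (simp add: sc_def)
lemma sc_1 [simp]: "sc 1 = 1" by (simp add: sc_def mk_one)

lemma mk_word: "mk (word xs) = prod_list (map gen xs)"
proof (induction xs)
  case (Cons x xs)
  have "mk (word (x # xs)) = mk (word [x] \<otimes>\<^bsub>free_algebra\<^esub> word xs)"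
    by (simp add: free_algebra_mult_single)
  then show ?case by (simp add: mk_mult Cons gen_def)
qed (simp add: mk_one)

lemma mk_single: "mk (Poly_Mapping.single xs c) = sc c * prod_list (map gen xs)"
proof -
  have "mk (Poly_Mapping.single xs c) = mk (Poly_Mapping.single [] c \<otimes>\<^bsub>free_algebra\<^esub> word xs)"
    by (simp add: free_algebra_mult_single)
  then show ?thesis by (simp add: mk_mult sc_def mk_word)
qed

lemma mk_expand: "mk p = (\<Sum>xs\<in>Poly_Mapping.keys p. sc (Poly_Mapping.lookup p xs) * prod_list (map gen xs))"
  by (subst poly_mapping_eq_sum_single) (simp add: mk_sum mk_single)

lemma sc_commute: "sc c * x = x * sc c"
proof -
  have *: "sc c * gen g = gen g * sc c" for g
    unfolding sc_def gen_def by (simp add: free_algebra_mult_single flip: mk_mult)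
  have w: "sc c * prod_list (map gen xs) = prod_list (map gen xs) * sc c" for xs
    by (induction xs) (simp_all add: *, simp add: mult.assoc[symmetric] *, simp add: mult.assoc)
  have s: "sc c * sc d = sc d * sc c" for d by (simp add: mult.commute flip: sc_mult)
  obtain p where p: "x = mk p" by (rule mk_surj)
  show ?thesis unfolding p mk_expand
    by (simp add: sum_distrib_left sum_distrib_right) (intro sum.cong refl, metis mult.assoc s w)
qed


lemma pres_induct [case_names add monom]:
  assumes "\<And>x y. P x \<Longrightarrow> P y \<Longrightarrow> P (x + y)" "\<And>c xs. P (sc c * prod_list (map gen xs))"
  shows "P (x :: 'g::presentation pres)"
proof -
  have 0: "P 0" using assms(2)[of 0] by simp
  have sumP: "P (sum f A)" if "\<And>i. i \<in> A \<Longrightarrow> P (f i)" for f and A :: "'g list set"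
    using that by (induction A rule: infinite_finite_induct) (auto intro: assms 0)
  obtain p where "x = mk p" by (rule mk_surj)
  then show ?thesis unfolding mk_expand by (auto intro!: sumP assms)
qed

subsection \<open>Homogeneous elements\<close>

text \<open>The monoid of degrees is left arbitrary to cover both the weights of the exterior
  algebra and the bidegrees, which are pairs of weights.\<close>

definition homog :: "('g::presentation \<Rightarrow> 'd::comm_monoid_add) \<Rightarrow> 'd \<Rightarrow> 'g pres set" where
  "homog deg \<alpha> = mk ` {p. \<forall>xs\<in>Poly_Mapping.keys p. sum_list (map deg xs) = \<alpha>}"

lemma homog_add: "x \<in> homog deg \<alpha> \<Longrightarrow> y \<in> homog deg \<alpha> \<Longrightarrow> x + y \<in> homog deg \<alpha>"
  by (auto simp: homog_def simp flip: mk_add dest!: set_mp[OF keys_add] intro!: imageI)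

lemma homog_0 [simp]: "0 \<in> homog deg \<alpha>"
  unfolding homog_def by (rule image_eqI[of _ _ 0]) auto

lemma homog_sum: "(\<And>i. i \<in> A \<Longrightarrow> f i \<in> homog deg \<alpha>) \<Longrightarrow> sum f A \<in> homog deg \<alpha>"
  by (induction A rule: infinite_finite_induct) (auto intro: homog_add)

lemma homog_monom: "sum_list (map deg xs) = \<alpha> \<Longrightarrow> sc c * prod_list (map gen xs) \<in> homog deg \<alpha>"
  unfolding homog_def mk_single[symmetric] by (intro imageI) (auto split: if_splits)

lemma homog_induct [consumes 1, case_names add monom]:
  assumes "x \<in> homog deg \<alpha>" "\<And>x y. P x \<Longrightarrow> P y \<Longrightarrow> P (x + y)"
    "\<And>c xs. sum_list (map deg xs) = \<alpha> \<Longrightarrow> P (sc c * prod_list (map gen xs))" "P 0"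
  shows "P (x :: 'g::presentation pres)"
proof -
  have sumP: "P (sum f A)" if "\<And>i. i \<in> A \<Longrightarrow> P (f i)" for f and A :: "'g list set"
    using that by (induction A rule: infinite_finite_induct) (auto intro: assms)
  obtain p where "x = mk p" "\<forall>xs\<in>Poly_Mapping.keys p. sum_list (map deg xs) = \<alpha>"
    using assms(1) by (auto simp: homog_def)
  then show ?thesis unfolding mk_expand by (auto intro!: sumP assms)
qed

lemma homog_gen: "gen g \<in> homog deg (deg g)"
  using homog_monom[of deg "[g]" _ 1] by simp

lemma homog_sc: "sc c \<in> homog deg 0"
  using homog_monom[of deg "[]" _ c] by simp

lemma homog_1: "1 \<in> homog deg 0"
  using homog_sc[of 1] by simp

lemma homog_mult:
  assumes "x \<in> homog deg \<alpha>" "y \<in> homog deg \<beta>" shows "x * y \<in> homog deg (\<alpha> + \<beta>)"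
  using assms(1)
proof (induction rule: homog_induct)
  case (monom c xs)
  from assms(2) show ?case
  proof (induction rule: homog_induct)
    case (monom d ys)
    have "sc c * prod_list (map gen xs) * (sc d * prod_list (map gen ys)) =
        sc (c * d) * prod_list (map gen (xs @ ys))"
      by (simp add: sc_mult mult.assoc) (metis mult.assoc sc_commute)
    moreover have "sum_list (map deg (xs @ ys)) = \<alpha> + \<beta>" using monom \<open>sum_list (map deg xs) = \<alpha>\<close> by simp
    ultimately show ?case by (metis homog_monom)
  qed (auto simp: distrib_left intro: homog_add)
qed (auto simp: distrib_right intro: homog_add)

subsection \<open>Modules over a presented algebra\<close>

text \<open>Both vanishing results for an ideal given by generators take this route: what is
  annihilated is shown to be closed under the operations and to contain the generators. It serves
  for the free algebra and for the algebra of homogeneous pairs.\<close>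

lemma Idl_monoid_algebra_subset:
  assumes R: "ring (monoid_algebra G)" and S: "S \<subseteq> J" and J: "J \<subseteq> carrier (monoid_algebra G)"
    and zero: "0 \<in> J" and add: "\<And>p q. p \<in> J \<Longrightarrow> q \<in> J \<Longrightarrow> p + q \<in> J" and minus: "\<And>p. p \<in> J \<Longrightarrow> - p \<in> J"
    and l: "\<And>p q. p \<in> J \<Longrightarrow> q \<in> carrier (monoid_algebra G) \<Longrightarrow> q \<otimes>\<^bsub>monoid_algebra G\<^esub> p \<in> J"
    and r: "\<And>p q. p \<in> J \<Longrightarrow> q \<in> carrier (monoid_algebra G) \<Longrightarrow> p \<otimes>\<^bsub>monoid_algebra G\<^esub> q \<in> J"
  shows "Idl\<^bsub>monoid_algebra G\<^esub> S \<subseteq> J"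
proof -
  interpret ring "monoid_algebra G" by fact
  have ops: "add (monoid_algebra G) = (+)" "\<zero>\<^bsub>monoid_algebra G\<^esub> = 0" by (simp_all add: monoid_algebra_def)
  have neg: "\<ominus>\<^bsub>monoid_algebra G\<^esub> p = - p" if "p \<in> J" for p
    using that J minus by (intro minus_equality) (auto simp: ops)
  have "subgroup J (add_monoid (monoid_algebra G))"
    using J zero add minus neg by (intro subgroup.intro) (auto simp: ops a_inv_def)
  then have "ideal J (monoid_algebra G)" by (intro idealI R l r)
  then show ?thesis using S by (rule genideal_minimal)
qed

definition word_action :: "('g \<Rightarrow> 'v \<Rightarrow> 'v) \<Rightarrow> (complex \<Rightarrow> 'v \<Rightarrow> 'v) \<Rightarrow> ('g list \<Rightarrow>\<^sub>0 complex) \<Rightarrow> 'v \<Rightarrow> 'v::ab_group_add" where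
  "word_action act smul p v = (\<Sum>xs\<in>Poly_Mapping.keys p. smul (Poly_Mapping.lookup p xs) (foldr act xs v))"

text \<open>The scalar multiplication is a parameter because the two modules in use have different
  ones: through \<open>const_mero\<close> on functions of subsets, and through \<open>scT\<close> on
  the tensor product.\<close>

locale word_module =
  fixes act :: "'g \<Rightarrow> 'v::ab_group_add \<Rightarrow> 'v" and smul :: "complex \<Rightarrow> 'v \<Rightarrow> 'v"
  assumes act_add: "act g (v + w) = act g v + act g w"
    and act_smul: "act g (smul c v) = smul c (act g v)"
    and smul_add: "smul c (v + w) = smul c v + smul c w"
    and smul_add_left: "smul (c + d) v = smul c v + smul d v"
    and smul_mult: "smul (c * d) v = smul c (smul d v)"
    and smul_one: "smul 1 v = v"
begin

abbreviation "ev \<equiv> word_action act smul"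

lemma smul_0 [simp]: "smul c 0 = 0" "smul 0 v = 0"
  using smul_add[of c 0 0] smul_add_left[of 0 0 v] by simp_all

lemma ev_superset:
  assumes "finite A" "Poly_Mapping.keys p \<subseteq> A"
  shows "ev p v = (\<Sum>xs\<in>A. smul (Poly_Mapping.lookup p xs) (foldr act xs v))"
  unfolding word_action_def using assms by (intro sum.mono_neutral_left) (auto simp: in_keys_iff)

lemma ev_add: "ev (p + q) v = ev p v + ev q v"
  using keys_add[of p q]
  by (simp add: ev_superset[of "Poly_Mapping.keys p \<union> Poly_Mapping.keys q"] lookup_add smul_add_left sum.distrib)

lemma ev_0 [simp]: "ev 0 v = 0" by (simp add: word_action_def)

lemma ev_minus: "ev (p - q) v = ev p v - ev q v"
  using ev_add[of "p - q" q v] by simp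

lemma ev_sum: "ev (sum f A) v = (\<Sum>i\<in>A. ev (f i) v)"
  by (induction A rule: infinite_finite_induct) (simp_all add: ev_add)

lemma ev_single: "ev (Poly_Mapping.single xs c) v = smul c (foldr act xs v)"
  by (subst ev_superset[of "{xs}"]) auto

lemma foldr_act_linear:
  "foldr act xs (v + w) = foldr act xs v + foldr act xs w" "foldr act xs (smul c v) = smul c (foldr act xs v)"
  by (induction xs) (simp_all add: act_add act_smul)

lemma ev_add_right: "ev p (v + w) = ev p v + ev p w"
  by (simp add: word_action_def foldr_act_linear smul_add sum.distrib)

lemma ev_mult: "ev (p \<otimes>\<^bsub>free_algebra\<^esub> q) v = ev p (ev q v)"
proof -
  have z: "foldr act xs 0 = 0" for xs using foldr_act_linear(1)[of xs 0 0] by simp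
  have s: "smul c (foldr act xs (sum f A)) = (\<Sum>i\<in>A. smul c (foldr act xs (f i)))"
    for f c xs and A :: "'g list set"
    by (induction A rule: infinite_finite_induct) (simp_all add: smul_add foldr_act_linear z)
  have "ev (p \<otimes>\<^bsub>free_algebra\<^esub> q) v = (\<Sum>x\<in>Poly_Mapping.keys p. \<Sum>y\<in>Poly_Mapping.keys q.
      smul (Poly_Mapping.lookup p x * Poly_Mapping.lookup q y) (foldr act x (foldr act y v)))"
    by (simp add: free_algebra_def monoid_algebra_def ev_sum ev_single) (simp add: free_monoid_def)
  also have "\<dots> = ev p (ev q v)"
    unfolding word_action_def s by (simp add: foldr_act_linear smul_mult)
  finally show ?thesis .
qed

end

text \<open>Checking the defining relations on operators yields an action of the whole quotient
  algebra. One instance gives the independence of the ordered monomials, the other the existence of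
  the coaction.\<close>

locale presented_module = word_module act smul
  for act :: "'g::presentation \<Rightarrow> 'v::ab_group_add \<Rightarrow> 'v" and smul :: "complex \<Rightarrow> 'v \<Rightarrow> 'v" +
  assumes relation: "p \<in> relations \<Longrightarrow> word_action act smul p v = 0"
begin

lemma ev_rel_ideal: "p \<in> rel_ideal \<Longrightarrow> ev p v = 0"
proof -
  have z: "ev p 0 = 0" for p using ev_add_right[of p 0 0] by simp
  have m: "ev (- p) v = - ev p v" for p v using ev_minus[of 0 p v] by simp
  have "rel_ideal \<subseteq> {p. \<forall>v. ev p v = 0}"
    unfolding free_algebra_def
    by (rule Idl_monoid_algebra_subset)
       (use ring_free_algebra carrier_free_algebra in
         \<open>auto simp: relation ev_add m ev_mult z free_algebra_def[symmetric]\<close>)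
  then show "p \<in> rel_ideal \<Longrightarrow> ev p v = 0" by blast
qed

definition action :: "'g pres \<Rightarrow> 'v \<Rightarrow> 'v" where
  "action x = ev (SOME p. mk p = x)"

text \<open>Two representatives differ by an element of the ideal, which acts as 0; so the choice
  made in \<open>action\<close> does not affect the result.\<close>

lemma action_mk: "action (mk p) v = ev p v"
proof -
  have "mk (SOME p'. mk p' = mk p) = mk p" by (rule someI) (rule refl)
  then have "ev ((SOME p'. mk p' = mk p) - p) v = 0"
    by (intro ev_rel_ideal) (simp only: mk_eq_iff)
  then show ?thesis by (simp add: action_def ev_minus)
qed

lemma action_add: "action (x + y) v = action x v + action y v"
  by (metis mk_surj mk_add action_mk ev_add)

lemma action_mult: "action (x * y) v = action x (action y v)"
  by (metis mk_surj mk_mult action_mk ev_mult)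

lemma action_one [simp]: "action 1 v = v"
  unfolding mk_one[symmetric] action_mk ev_single by (simp add: smul_one)

lemma action_gen: "action (gen g) v = act g v"
  unfolding gen_def action_mk ev_single by (simp add: smul_one)

lemma action_sc: "action (sc c) v = smul c v"
  unfolding sc_def action_mk ev_single by simp

lemma action_prod_list: "action (prod_list (map gen xs)) v = foldr act xs v"
  by (induction xs) (simp_all add: action_mult action_gen)

end

subsection \<open>Normal ordering in exterior algebras\<close>

text \<open>The order is a parameter rather than that of the type because the theory is applied both
  to \<open><\<close> and to its reverse.\<close>

locale finite_strict_order =
  fixes less :: "'n::finite \<Rightarrow> 'n \<Rightarrow> bool" (infix "\<sqsubset>" 50)
  assumes irrefl: "\<not> i \<sqsubset> i" and trans: "i \<sqsubset> j \<Longrightarrow> j \<sqsubset> k \<Longrightarrow> i \<sqsubset> k"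
    and total: "i \<noteq> j \<Longrightarrow> i \<sqsubset> j \<or> j \<sqsubset> i"
begin

definition enum :: "'n set \<Rightarrow> 'n list" where
  "enum K = (THE xs. sorted_wrt (\<sqsubset>) xs \<and> set xs = K)"

lemma sorted_unique:
  "sorted_wrt (\<sqsubset>) xs \<Longrightarrow> sorted_wrt (\<sqsubset>) ys \<Longrightarrow> set xs = set ys \<Longrightarrow> xs = ys"
proof (induction xs arbitrary: ys)
  case (Cons x xs)
  then obtain y ys' where ys: "ys = y # ys'" by (cases ys) auto
  have "x = y"
  proof (rule ccontr)
    assume "x \<noteq> y"
    then have "x \<in> set ys'" "y \<in> set xs" using Cons.prems(3) ys by auto
    then have "y \<sqsubset> x" "x \<sqsubset> y" using Cons.prems ys by auto
    then show False using irrefl trans by blast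
  qed
  moreover have "x \<notin> set xs" "y \<notin> set ys'" using Cons.prems ys irrefl by auto
  then have "set xs = set ys'" using Cons.prems(3) ys \<open>x = y\<close> by auto
  then have "xs = ys'" using Cons ys by auto
  ultimately show ?case using ys by simp
qed simp

lemma ex_sorted: "\<exists>xs. sorted_wrt (\<sqsubset>) xs \<and> set xs = K"
proof -
  have "finite K" by simp
  then show ?thesis
  proof induction
    case empty
    show ?case by (rule exI[of _ "[]"]) simp
  next
    case (insert j K)
    then obtain xs where xs: "sorted_wrt (\<sqsubset>) xs" "set xs = K" by auto
    let ?ys = "filter (\<lambda>k. k \<sqsubset> j) xs @ j # filter (\<lambda>k. j \<sqsubset> k) xs"
    have "sorted_wrt (\<sqsubset>) ?ys" using xs trans by (auto simp: sorted_wrt_append sorted_wrt_filter)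
    moreover have "set ?ys = insert j K" using xs total insert by auto
    ultimately show ?case by blast
  qed
qed

lemma enum_eqI: "sorted_wrt (\<sqsubset>) xs \<Longrightarrow> enum (set xs) = xs"
  unfolding enum_def by (rule the_equality) (auto intro: sorted_unique)

lemma sorted_enum: "sorted_wrt (\<sqsubset>) (enum K)" and set_enum [simp]: "set (enum K) = K"
  using ex_sorted[of K] enum_eqI by auto

lemma enum_empty [simp]: "enum {} = []"
  using enum_eqI[of "[]"] by simp

lemma enum_insert: "(\<And>k. k \<in> K \<Longrightarrow> j \<sqsubset> k) \<Longrightarrow> enum (insert j K) = j # enum K"
  using enum_eqI[of "j # enum K"] sorted_enum[of K] by simp

lemma distinct_enum: "distinct (enum K)"
proof -
  have "sorted_wrt (\<sqsubset>) xs \<Longrightarrow> distinct xs" for xs by (induction xs) (auto simp: irrefl)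
  then show ?thesis using sorted_enum by blast
qed

lemma length_enum: "length (enum K) = card K"
  using distinct_card[OF distinct_enum[of K]] by simp

text \<open>Adding a new least element corresponds to multiplying an ordered monomial by one
  generator on the left.\<close>

lemma min_induct [case_names empty insert]:
  assumes "P {}" "\<And>j K. (\<And>k. k \<in> K \<Longrightarrow> j \<sqsubset> k) \<Longrightarrow> P K \<Longrightarrow> P (insert j K)"
  shows "P K"
proof -
  have "sorted_wrt (\<sqsubset>) xs \<Longrightarrow> P (set xs)" for xs by (induction xs) (auto intro: assms)
  then show ?thesis using sorted_enum[of K] by fastforce
qed

end

text \<open>Here \<open>h i j\<close> stands for h(lambda_i - lambda_j) and \<open>sh k\<close> for
  the shift by the weight of \<open>k\<close>. A shift in a direction that does not occur in
  \<open>h i j\<close> leaves it alone, and this is what allows signs to be moved past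
  generators.\<close>

locale structure_functions = finite_strict_order less
  for less :: "'n::finite \<Rightarrow> 'n \<Rightarrow> bool" (infix "\<sqsubset>" 50) +
  fixes h :: "'n \<Rightarrow> 'n \<Rightarrow> 'm::field" and sh :: "'n \<Rightarrow> 'm \<Rightarrow> 'm"
  assumes sh_mult: "sh k (f * g) = sh k f * sh k g" and sh_one: "sh k 1 = 1" and sh_minus: "sh k (- f) = - sh k f"
    and sh_surj: "\<exists>g. sh k g = f"
    and sh_h: "k \<noteq> i \<Longrightarrow> k \<noteq> j \<Longrightarrow> i \<noteq> j \<Longrightarrow> sh k (h i j) = h i j"
begin

text \<open>This is sign({k}; B), the factor that arises when w_k is moved from the left to its
  place in w_B.\<close>

definition sgn1 :: "'n \<Rightarrow> 'n set \<Rightarrow> 'm" where "sgn1 k B = (\<Prod>m\<in>{m\<in>B. m \<sqsubset> k}. - h k m)"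
definition sgn :: "'n set \<Rightarrow> 'n set \<Rightarrow> 'm" where "sgn A B = (\<Prod>k\<in>A. sgn1 k B)"

lemma sh_prod: "sh k (prod f A) = (\<Prod>x\<in>A. sh k (f x))"
  by (induction A rule: infinite_finite_induct) (simp_all add: sh_mult sh_one)

lemma sh_sgn1: "k \<notin> B \<Longrightarrow> k \<noteq> i \<Longrightarrow> sh k (sgn1 i B) = sgn1 i B"
  unfolding sgn1_def sh_prod
  by (intro prod.cong refl) (metis (mono_tags) mem_Collect_eq sh_minus sh_h irrefl)

lemma sh_sgn: "k \<notin> A \<Longrightarrow> k \<notin> B \<Longrightarrow> sh k (sgn A B) = sgn A B"
  unfolding sgn_def sh_prod by (intro prod.cong) (auto intro!: sh_sgn1)

lemma sgn1_Un: "B \<inter> C = {} \<Longrightarrow> sgn1 k (B \<union> C) = sgn1 k B * sgn1 k C"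
proof -
  assume "B \<inter> C = {}"
  moreover have "{m \<in> B \<union> C. m \<sqsubset> k} = {m \<in> B. m \<sqsubset> k} \<union> {m \<in> C. m \<sqsubset> k}" by auto
  ultimately show ?thesis unfolding sgn1_def by (simp add: prod.union_disjoint disjoint_iff)
qed

lemma sgn1_below: "(\<And>m. m \<in> B \<Longrightarrow> k \<sqsubset> m) \<Longrightarrow> sgn1 k B = 1"
  unfolding sgn1_def by (rule prod.neutral) (use irrefl trans in blast)

lemma sgn1_insert: "m \<notin> B \<Longrightarrow> sgn1 k (insert m B) = (if m \<sqsubset> k then - h k m else 1) * sgn1 k B"
proof -
  assume "m \<notin> B"
  moreover have "{i \<in> insert m B. i \<sqsubset> k} = (if m \<sqsubset> k then insert m {i\<in>B. i \<sqsubset> k} else {i\<in>B. i \<sqsubset> k})" by auto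
  ultimately show ?thesis unfolding sgn1_def by simp
qed

lemma sgn_empty [simp]: "sgn {} B = 1" "sgn A {} = 1" by (simp_all add: sgn_def sgn1_def)

lemma sgn_insert: "k \<notin> A \<Longrightarrow> sgn (insert k A) B = sgn1 k B * sgn A B"
  by (simp add: sgn_def)

end

text \<open>The operators imitate multiplication by the w_i, and \<open>act f\<close> imitates
  multiplication by a scalar. The instances are left multiplication in the exterior algebra and the
  column operators for either order of the indices.\<close>

locale exterior_action = structure_functions +
  fixes op :: "'a \<Rightarrow> 'v \<Rightarrow> 'v::zero" and act :: "'b \<Rightarrow> 'v \<Rightarrow> 'v"
  assumes op_square: "op i (op i v) = 0"
    and op_swap: "i \<sqsubset> j \<Longrightarrow> op j (op i v) = act (- h j i) (op i (op j v))"
    and act_op: "op k (act (sh k f) v) = act f (op k v)"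
    and act_mult: "act (f * g) v = act f (act g v)" and act_one: "act 1 v = v"
    and op_zero: "op k 0 = 0" and act_zero: "act f 0 = 0"
begin

definition ops :: "'a set \<Rightarrow> 'v \<Rightarrow> 'v" where "ops K = foldr op (enum K)"

lemma ops_empty [simp]: "ops {} v = v" by (simp add: ops_def)

lemma ops_insert: "(\<And>k. k \<in> K \<Longrightarrow> j \<sqsubset> k) \<Longrightarrow> ops (insert j K) v = op j (ops K v)"
  by (simp add: ops_def enum_insert)

lemma op_act: "sh k f = f \<Longrightarrow> op k (act f v) = act f (op k v)"
  using act_op[of k f v] by simp

lemma op_ops: "op j (ops K v) = (if j \<in> K then 0 else act (sgn1 j K) (ops (insert j K) v))"
proof (induction K rule: min_induct)
  case empty
  show ?case using ops_insert[of "{}" j v] by (simp add: sgn1_def act_one)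
next
  case (insert k K)
  have kK: "k \<notin> K" using insert(1) irrefl by blast
  consider "j \<sqsubset> k" | "j = k" | "k \<sqsubset> j" using total by blast
  then show ?case
  proof cases
    case 1
    then have b: "m \<in> insert k K \<Longrightarrow> j \<sqsubset> m" for m using insert(1) trans by blast
    then have "j \<notin> insert k K" using irrefl by blast
    then show ?thesis using ops_insert[of "insert k K" j v, OF b] sgn1_below[of "insert k K" j, OF b] by (simp add: act_one)
  next
    case 2
    then show ?thesis using ops_insert[OF insert(1), of K v] by (simp add: op_square)
  next
    case 3
    then have jk: "j \<noteq> k" using irrefl by blast
    have "op j (ops (insert k K) v) = act (- h j k) (op k (op j (ops K v)))"
      using 3 insert(1) by (simp add: ops_insert op_swap)
    also have "\<dots> = (if j \<in> K then 0 else act (- h j k) (op k (act (sgn1 j K) (ops (insert j K) v))))"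
      by (simp add: insert(2) op_zero act_zero)
    \<comment> \<open>Neither \<open>j\<close> nor any element of \<open>K\<close> equals
      \<open>k\<close>, so \<open>sgn1 j K\<close> is invariant under \<open>sh k\<close> and passes
      \<open>op k\<close> unchanged.\<close>
    also have "\<dots> = (if j \<in> K then 0 else act (- h j k * sgn1 j K) (op k (ops (insert j K) v)))"
      using kK jk by (simp add: op_act sh_sgn1 flip: act_mult)
    also have "\<dots> = (if j \<in> insert k K then 0 else act (sgn1 j (insert k K)) (ops (insert j (insert k K)) v))"
    proof -
      have "ops (insert j (insert k K)) v = op k (ops (insert j K) v)"
        using 3 insert(1) by (subst insert_commute) (rule ops_insert, auto)
      then show ?thesis using 3 jk kK by (simp add: sgn1_insert)
    qed
    finally show ?thesis .
  qed
qed

lemma ops_ops: "ops A (ops B v) = (if A \<inter> B = {} then act (sgn A B) (ops (A \<union> B) v) else 0)"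
proof (induction A rule: min_induct)
  case empty
  show ?case by (simp add: act_one)
next
  case (insert j A)
  have jA: "j \<notin> A" using insert(1) irrefl by blast
  have "ops (insert j A) (ops B v) = op j (ops A (ops B v))" using insert(1) by (simp add: ops_insert)
  also have "\<dots> = (if A \<inter> B = {} then op j (act (sgn A B) (ops (A \<union> B) v)) else 0)"
    by (simp add: insert(2) op_zero)
  also have "\<dots> = (if insert j A \<inter> B = {} then act (sgn A B * sgn1 j (A \<union> B)) (ops (insert j A \<union> B) v) else 0)"
  proof -
    \<comment> \<open>If \<open>j\<close> lies in \<open>B\<close>, the sign may depend on the
      coordinate \<open>j\<close> and need not be invariant. Writing it as a shifted function still
      lets it leave \<open>op j\<close>, and what remains is 0.\<close>
    obtain f where f: "sgn A B = sh j f" using sh_surj by metis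
    have "op j (act (sgn A B) (ops (A \<union> B) v)) = 0" if "j \<in> B"
      using that by (simp add: f act_op op_ops act_zero)
    moreover have "op j (act (sgn A B) (ops (A \<union> B) v)) = act (sgn A B * sgn1 j (A \<union> B)) (ops (insert j A \<union> B) v)"
      if "j \<notin> B"
      using that jA by (simp add: op_act sh_sgn op_ops act_mult)
    ultimately show ?thesis by auto
  qed
  also have "\<dots> = (if insert j A \<inter> B = {} then act (sgn (insert j A) B) (ops (insert j A \<union> B) v) else 0)"
    using jA insert(1) by (auto simp: sgn1_Un sgn1_below sgn_insert mult.commute)
  finally show ?case .
qed

end

subsection \<open>Minors of dynamical matrices\<close>

text \<open>The last two axioms are the relations w_i w_i = 0 and w_j w_i = -h w_i w_j after
  application of the coaction: for rows \<open>a \<sqsubset> b\<close> they compare the coefficients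
  of w_a w_b on both sides.\<close>

locale dynamical_matrix = structure_functions +
  fixes l r :: "'b \<Rightarrow> 'r::{ring, monoid_mult}" and t :: "'a \<Rightarrow> 'a \<Rightarrow> 'r"
  assumes l_add: "l (f + g) = l f + l g" and l_mult: "l (f * g) = l f * l g" and l_one [simp]: "l 1 = 1"
    and r_add: "r (f + g) = r f + r g" and r_mult: "r (f * g) = r f * r g" and r_one [simp]: "r 1 = 1"
    and l_r: "l f * r g = r g * l f"
    and l_t: "l f * t i j = t i j * l (sh i f)" and r_t: "r f * t i j = t i j * r (sh j f)"
    and t_column: "a \<sqsubset> b \<Longrightarrow> t a i * t b i = l (h b a) * t b i * t a i"
    and t_cross: "a \<sqsubset> b \<Longrightarrow> i \<sqsubset> j \<Longrightarrow> t a j * t b i - l (h b a) * t b j * t a i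
      = - r (h j i) * (t a i * t b j - l (h b a) * t b i * t a j)"
begin

lemma l_r_simps [simp]: "l 0 = 0" "r 0 = 0" "l (- f) = - l f" "r (- f) = - r f"
proof -
  show z: "l 0 = 0" "r 0 = 0" using l_add[of 0 0] r_add[of 0 0] by simp_all
  show "l (- f) = - l f" "r (- f) = - r f" 
    using l_add[of f "- f"] r_add[of f "- f"] z by (simp_all add: add_eq_0_iff)
qed

lemma l_sum: "l (sum f A) = (\<Sum>x\<in>A. l (f x))" and r_sum: "r (sum f A) = (\<Sum>x\<in>A. r (f x))"
  by (induction A rule: infinite_finite_induct) (simp_all add: l_add r_add)

text \<open>The summand for \<open>a\<close> comes from the product of w_a and w_(L - {a}), which is
  \<open>sgn1 a (L - {a})\<close> times w_L; balancing turns this sign into a left scalar.\<close>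

definition col :: "'a \<Rightarrow> ('a set \<Rightarrow> 'r) \<Rightarrow> 'a set \<Rightarrow> 'r" where
  "col j \<phi> L = (\<Sum>a\<in>L. l (sgn1 a (L - {a})) * t a j * \<phi> (L - {a}))"

text \<open>These are the coordinates of the unit element.\<close>

definition vac :: "'a set \<Rightarrow> 'r" where "vac L = (if L = {} then 1 else 0)"

lemma t_l: "sh a f = f \<Longrightarrow> t a j * (l f * x) = l f * (t a j * x)"
  using l_t[of f a j] by (simp flip: mult.assoc)

text \<open>Collecting the terms in which the two rows are exchanged reduces every relation between
  two columns to a relation between the four entries in two rows.\<close>

lemma col_col:
  "col j (col i \<phi>) L = (\<Sum>(a, b)\<in>{(a, b). a \<in> L \<and> b \<in> L \<and> a \<sqsubset> b}.
     l (sgn1 a (L - {a, b}) * sgn1 b (L - {a, b})) * (t a j * t b i - l (h b a) * t b j * t a i) * \<phi> (L - {a, b}))"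
proof -
  \<comment> \<open>This is the term in which column \<open>j\<close> uses row \<open>a\<close> and
    column \<open>i\<close> uses row \<open>b\<close>.\<close>
  define F where "F a b = l (sgn1 a (L - {a}) * sgn1 b (L - {a} - {b})) * (t a j * (t b i * \<phi> (L - {a} - {b})))" for a b
  let ?P = "{(a, b). a \<in> L \<and> b \<in> L \<and> a \<sqsubset> b}" and ?Q = "{(a, b). a \<in> L \<and> b \<in> L \<and> b \<sqsubset> a}"
  have "col j (col i \<phi>) L = (\<Sum>a\<in>L. \<Sum>b\<in>L - {a}. F a b)"
    unfolding col_def F_def sum_distrib_left
    by (intro sum.cong refl) (auto simp: l_mult mult.assoc intro!: t_l sh_sgn1 arg_cong[of _ _ "\<lambda>x. _ * x"])
  also have "\<dots> = (\<Sum>(a, b)\<in>?P \<union> ?Q. F a b)"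
    by (subst sum.Sigma) (use total irrefl in \<open>auto intro!: sum.cong\<close>)
  also have "\<dots> = (\<Sum>(a, b)\<in>?P. F a b) + (\<Sum>(a, b)\<in>?Q. F a b)"
    by (rule sum.union_disjoint) (use irrefl trans in \<open>auto intro: finite_subset[of _ UNIV]\<close>)
  also have "(\<Sum>(a, b)\<in>?Q. F a b) = (\<Sum>(a, b)\<in>?P. F b a)"
    by (rule sum.reindex_bij_witness[of _ "\<lambda>(a, b). (b, a)" "\<lambda>(a, b). (b, a)"]) auto
  also have "(\<Sum>(a, b)\<in>?P. F a b) + (\<Sum>(a, b)\<in>?P. F b a) = (\<Sum>(a, b)\<in>?P. F a b + F b a)"
    by (simp add: case_prod_unfold sum.distrib)
  also have "\<dots> = (\<Sum>(a, b)\<in>?P. l (sgn1 a (L - {a, b}) * sgn1 b (L - {a, b})) *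
      (t a j * t b i - l (h b a) * t b j * t a i) * \<phi> (L - {a, b}))"
  proof (rule sum.cong[OF refl], clarify)
    fix a b assume ab: "a \<in> L" "b \<in> L" "a \<sqsubset> b"
    define K where "K = L - {a, b}"
    have nab: "\<not> b \<sqsubset> a" "a \<noteq> b" "b \<notin> K" "a \<notin> K" using ab irrefl trans by (auto simp: K_def)
    have e: "L - {a} - {b} = K" "L - {b} - {a} = K" "L - {a} = insert b K" "L - {b} = insert a K"
      using ab nab by (auto simp: K_def)
    show "F a b + F b a = l (sgn1 a (L - {a, b}) * sgn1 b (L - {a, b})) *
      (t a j * t b i - l (h b a) * t b j * t a i) * \<phi> (L - {a, b})"
    proof -
      \<comment> \<open>Since \<open>a \<sqsubset> b\<close>, only moving \<open>b\<close> past
        \<open>a\<close> is an inversion; it supplies the coefficient \<open>- h b a\<close> of the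
        exchanged product.\<close>
      have s: "sgn1 a (insert b K) = sgn1 a K" "sgn1 b (insert a K) = - h b a * sgn1 b K"
        using nab ab by (simp_all add: sgn1_insert)
      have "- h b a * sgn1 b K * sgn1 a K = - (sgn1 a K * sgn1 b K * h b a)" by (simp add: mult_ac)
      then have "l (- h b a * sgn1 b K * sgn1 a K) = - (l (sgn1 a K * sgn1 b K) * l (h b a))"
        by (simp only: l_r_simps l_mult)
      moreover have "insert b K - {b} = K" "insert a K - {a} = K" using nab by auto
      ultimately show ?thesis unfolding F_def e K_def[symmetric] s by (simp only: s) (simp add: algebra_simps)
    qed
  qed
  finally show ?thesis .
qed

text \<open>Right scalars commute with the left signs and are shifted according to the column index
  only. They therefore play the role of the scalars of the exterior algebra, in accordance with
  R(mu_W(f) w) = (1 \<otimes> mu_r(f)) R(w).\<close>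

sublocale exterior_action less h sh col "\<lambda>f \<phi> L. r f * \<phi> L"
proof
  fix i j k :: 'a and f g :: 'b and \<phi> :: "'a set \<Rightarrow> 'r"
  show "col i (col i \<phi>) = 0"
    by (rule ext) (auto simp: col_col t_column intro!: sum.neutral)
  show "col j (col i \<phi>) = (\<lambda>L. r (- h j i) * col i (col j \<phi>) L)" if "i \<sqsubset> j"
  proof (rule ext)
    fix L
    have "l f * (- r (h j i) * x) * y = - r (h j i) * (l f * x * y)" for f x y
      using l_r[of f "h j i"] by (simp flip: mult.assoc)
    then show "col j (col i \<phi>) L = r (- h j i) * col i (col j \<phi>) L"
      using that by (auto simp: col_col sum_distrib_left t_cross intro!: sum.cong)
  qed
  show "col k (\<lambda>L. r (sh k f) * \<phi> L) = (\<lambda>L. r f * col k \<phi> L)"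
  proof (rule ext)
    fix L
    have "l g * t a k * (r (sh k f) * x) = r f * (l g * t a k * x)" for g a x
      using r_t[of f a k] l_r[of g f] by (metis mult.assoc)
    then show "col k (\<lambda>L. r (sh k f) * \<phi> L) L = r f * col k \<phi> L"
      by (simp add: col_def sum_distrib_left)
  qed
qed (auto simp: r_mult mult.assoc col_def fun_eq_iff)

text \<open>\<open>minor I J\<close> is the minor \<open>\<xi>\<close> with upper index \<open>I\<close> and lower index \<open>J\<close>.\<close>

definition minor :: "'a set \<Rightarrow> 'a set \<Rightarrow> 'r" where "minor I J = ops J vac I"

text \<open>The columns in \<open>js\<close> use up a set \<open>A\<close> of rows, and
  \<open>\<phi>\<close> receives the others. It is stated for arbitrary \<open>\<phi>\<close> so
  that a second product of columns can be inserted there. The induction rests on the fact that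
  putting \<open>a\<close> before \<open>A\<close> and then both before the remaining rows gives the
  same sign as putting \<open>a\<close> before everything and \<open>A\<close> before the
  rest.\<close>

lemma foldr_col_expand:
  "foldr col js \<phi> I = (\<Sum>A\<in>Pow I. l (sgn A (I - A)) * foldr col js vac A * \<phi> (I - A))"
proof (induction js arbitrary: I)
  case Nil
  have "(\<Sum>A\<in>Pow I. l (sgn A (I - A)) * vac A * \<phi> (I - A)) = (\<Sum>A\<in>{{}}. l (sgn A (I - A)) * vac A * \<phi> (I - A))"
    by (rule sum.mono_neutral_right) (auto simp: vac_def)
  then show ?case by (simp add: vac_def)
next
  case (Cons j js)
  let ?D = "foldr col js vac"
  have "foldr col (j # js) \<phi> I = (\<Sum>a\<in>I. \<Sum>A\<in>Pow (I - {a}).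
      l (sgn1 a (I - {a}) * sgn A (I - {a} - A)) * t a j * ?D A * \<phi> (I - {a} - A))"
    unfolding foldr.simps o_apply col_def Cons sum_distrib_left
    by (intro sum.cong refl) (auto simp: l_mult mult.assoc intro!: t_l sh_sgn arg_cong[of _ _ "\<lambda>x. _ * x"])
  \<comment> \<open>The terms are regrouped by the set \<open>B = insert a A\<close> of all rows
    used so far.\<close>
  also have "\<dots> = (\<Sum>B\<in>Pow I. \<Sum>a\<in>B. l (sgn B (I - B) * sgn1 a (B - {a})) * t a j * ?D (B - {a}) * \<phi> (I - B))"
  proof (subst (1 2) sum.Sigma; (simp; fail)?)
    show "(\<Sum>(a, A)\<in>(SIGMA a:I. Pow (I - {a})). l (sgn1 a (I - {a}) * sgn A (I - {a} - A)) * t a j * ?D A * \<phi> (I - {a} - A))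
      = (\<Sum>(B, a)\<in>Sigma (Pow I) (\<lambda>B. B). l (sgn B (I - B) * sgn1 a (B - {a})) * t a j * ?D (B - {a}) * \<phi> (I - B))"
    proof (rule sum.reindex_bij_witness[of _ "\<lambda>(B, a). (a, B - {a})" "\<lambda>(a, A). (insert a A, a)"])
      fix x assume "x \<in> (SIGMA a:I. Pow (I - {a}))"
      then obtain a A where x: "x = (a, A)" and A: "a \<in> I" "A \<subseteq> I - {a}" by auto
      then have "a \<notin> A" "I - insert a A = I - {a} - A" "insert a A - {a} = A" by auto
      moreover have "I - {a} = A \<union> (I - {a} - A)" using A by auto
      then have "sgn1 a (I - {a}) = sgn1 a A * sgn1 a (I - {a} - A)" using sgn1_Un[of A "I - {a} - A" a] by auto
      ultimately show "(case (case x of (a, A) \<Rightarrow> (insert a A, a)) of (B, a) \<Rightarrow>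
            l (sgn B (I - B) * sgn1 a (B - {a})) * t a j * ?D (B - {a}) * \<phi> (I - B))
          = (case x of (a, A) \<Rightarrow> l (sgn1 a (I - {a}) * sgn A (I - {a} - A)) * t a j * ?D A * \<phi> (I - {a} - A))"
        by (simp add: x sgn_insert mult_ac)
    qed auto
  qed
  also have "\<dots> = (\<Sum>B\<in>Pow I. l (sgn B (I - B)) * foldr col (j # js) vac B * \<phi> (I - B))"
    by (simp add: col_def l_mult sum_distrib_left sum_distrib_right mult.assoc)
  finally show ?case .
qed

text \<open>Each column removes exactly one row, and \<open>vac\<close> is nonzero only when none is
  left.\<close>

lemma foldr_col_vac_eq_0: "card A \<noteq> length js \<Longrightarrow> foldr col js vac A = 0"
proof (induction js arbitrary: A)
  case (Cons j js)
  have "foldr col js vac (A - {a}) = 0" if "a \<in> A" for a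
    using Cons.prems that by (intro Cons.IH) (metis card_Suc_Diff1 finite length_Cons)
  then show ?case by (simp add: col_def[of j])
qed (auto simp: vac_def)

lemma minor_eq_0: "card I \<noteq> card J \<Longrightarrow> minor I J = 0"
  unfolding minor_def ops_def by (rule foldr_col_vac_eq_0) (simp add: length_enum)

theorem minor_laplace:
  "(\<Sum>(I1, I2)\<in>splittings I (card J1) (card J2). l (sgn I1 I2) * minor I1 J1 * minor I2 J2)
    = (if J1 \<inter> J2 = {} then r (sgn J1 J2) * minor I (J1 \<union> J2) else 0)"
proof -
  have "(\<Sum>(I1, I2)\<in>splittings I (card J1) (card J2). l (sgn I1 I2) * minor I1 J1 * minor I2 J2)
    = (\<Sum>A\<in>{A \<in> Pow I. card A = card J1 \<and> card (I - A) = card J2}. l (sgn A (I - A)) * minor A J1 * minor (I - A) J2)"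
    by (rule sum.reindex_bij_witness[of _ "\<lambda>A. (A, I - A)" fst])
       (auto simp: splittings_def Un_Diff Diff_triv inf_commute)
  also have "\<dots> = (\<Sum>A\<in>Pow I. l (sgn A (I - A)) * minor A J1 * minor (I - A) J2)"
    by (rule sum.mono_neutral_left) (auto, (metis minor_eq_0 mult_zero_left mult_zero_right)+)
  also have "\<dots> = ops J1 (ops J2 vac) I"
    unfolding minor_def ops_def by (rule foldr_col_expand[symmetric])
  also have "\<dots> = (if J1 \<inter> J2 = {} then r (sgn J1 J2) * minor I (J1 \<union> J2) else 0)"
    unfolding ops_ops minor_def by simp
  finally show ?thesis .
qed

text \<open>This is expansion along a column; applied to the transposed generators it becomes
  expansion along a row.\<close>

lemma minor_column:
  assumes "j \<in> J"
  shows "r (sgn1 j (J - {j})) * minor I J = (\<Sum>i\<in>I. l (sgn1 i (I - {i})) * t i j * minor (I - {i}) (J - {j}))"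
  using fun_cong[OF op_ops[of j "J - {j}" vac], of I] assms
  by (simp add: minor_def insert_absorb) (simp add: col_def)

end

text \<open>Transposition reverses the order of the indices and exchanges the two copies of the scalars.\<close>

locale dynamical_matrix_transpose = dynamical_matrix +
  transpose: dynamical_matrix "\<lambda>i j. less j i" h sh r l "\<lambda>i j. t j i" +
  fixes \<kappa> :: "nat \<Rightarrow> 'b"
  assumes sum_prod_h: "(\<Sum>i\<in>I. \<Prod>m\<in>I - {i}. - h i m) = \<kappa> (card I)"
    and \<kappa>_nonzero: "n > 0 \<Longrightarrow> \<kappa> n \<noteq> 0" and l_\<kappa>: "l (\<kappa> n) = r (\<kappa> n)"
begin

text \<open>Every index other than \<open>i\<close> precedes \<open>i\<close> in exactly one of the
  two orders, so the two signs together contain each factor once.\<close>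

lemma sgn1_mult_transpose: "sgn1 i (I - {i}) * transpose.sgn1 i (I - {i}) = (\<Prod>m\<in>I - {i}. - h i m)"
proof -
  have "I - {i} = {m \<in> I - {i}. m \<sqsubset> i} \<union> {m \<in> I - {i}. i \<sqsubset> m}" using total by auto
  moreover have "{m \<in> I - {i}. m \<sqsubset> i} \<inter> {m \<in> I - {i}. i \<sqsubset> m} = {}" using trans irrefl by blast
  ultimately show ?thesis unfolding sgn1_def transpose.sgn1_def
    by (metis (no_types, lifting) finite prod.union_disjoint)
qed

theorem minor_transpose: "minor I J = transpose.minor J I"
proof (induction "card I" arbitrary: I J)
  case 0
  then have "I = {}" by simp
  then show ?case
    using minor_eq_0[of I J] transpose.minor_eq_0[of J I]
    by (cases "J = {}") (auto simp: minor_def transpose.minor_def vac_def transpose.vac_def)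
next
  case (Suc n)
  show ?case
  proof (cases "card J = card I")
    case False
    then show ?thesis using minor_eq_0[of I J] transpose.minor_eq_0[of J I] by simp
  next
    case True
    have IH: "minor (I - {i}) (J - {j}) = transpose.minor (J - {j}) (I - {i})" if "i \<in> I" for i j
      using that Suc(2) by (intro Suc(1)) simp
    let ?X = "\<lambda>i j. t i j * minor (I - {i}) (J - {j})"
    \<comment> \<open>The constant is split, for each column, into the signs for the two orders. One
      of them is the sign required by \<open>minor_column\<close>; the other will be consumed by the
      row expansion of the transpose.\<close>
    have "r (\<kappa> (card J)) * minor I J = (\<Sum>j\<in>J. r (transpose.sgn1 j (J - {j})) * (r (sgn1 j (J - {j})) * minor I J))"
      unfolding sum_prod_h[symmetric] sgn1_mult_transpose[symmetric]
      by (simp add: r_sum sum_distrib_right mult.commute[of "sgn1 _ _"]) (simp add: r_mult mult.assoc)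
    also have "\<dots> = (\<Sum>j\<in>J. \<Sum>i\<in>I. r (transpose.sgn1 j (J - {j})) * (l (sgn1 i (I - {i})) * ?X i j))"
      by (simp add: minor_column sum_distrib_left mult.assoc)
    \<comment> \<open>Left and right signs commute, so the double sum over all entries can equally
      be read row by row.\<close>
    also have "\<dots> = (\<Sum>i\<in>I. \<Sum>j\<in>J. l (sgn1 i (I - {i})) * (r (transpose.sgn1 j (J - {j})) * ?X i j))"
      by (subst sum.swap) (simp add: l_r flip: mult.assoc)
    also have "\<dots> = (\<Sum>i\<in>I. l (sgn1 i (I - {i})) * (l (transpose.sgn1 i (I - {i})) * transpose.minor J I))"
      by (simp add: transpose.minor_column sum_distrib_left mult.assoc IH)
    also have "\<dots> = l (\<kappa> (card I)) * transpose.minor J I"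
      unfolding sum_prod_h[symmetric] sgn1_mult_transpose[symmetric]
      by (simp add: l_sum l_mult sum_distrib_right mult.assoc)
    finally have "r (\<kappa> (card J)) * minor I J = r (\<kappa> (card J)) * transpose.minor J I"
      using True by (simp add: l_\<kappa>)
    \<comment> \<open>The minors are nonempty here, so the constant is nonzero, hence
      invertible.\<close>
    moreover have "r (inverse (\<kappa> (card J))) * r (\<kappa> (card J)) = 1"
      using \<kappa>_nonzero[of "card J"] True Suc(2) by (simp flip: r_mult)
    ultimately show ?thesis by (metis mult.assoc mult_1_left)
  qed
qed

end

subsection \<open>A type for the quantum matrix algebra\<close>

text \<open>The conclusion of the theorem as a predicate of the parameter, needed to speak of a
  parameter for which it fails.\<close>

definition laplace_expansions :: "'n::{finite,linorder} itself \<Rightarrow> complex \<Rightarrow> bool" where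
  "laplace_expansions _ logq \<longleftrightarrow> (\<forall>I J1 J2 :: 'n set. card I = card J1 + card J2 \<longrightarrow>
    (J1 \<inter> J2 = {} \<longrightarrow>
        mu_r logq (sign_mero logq J1 J2) \<otimes>\<^bsub>F_alg logq\<^esub> q_minor logq I (J1 \<union> J2) =
          finsum (F_alg logq)
            (\<lambda>(I1, I2). mu_l logq (sign_mero logq I1 I2) \<otimes>\<^bsub>F_alg logq\<^esub>
               q_minor logq I1 J1 \<otimes>\<^bsub>F_alg logq\<^esub> q_minor logq I2 J2)
            (splittings I (card J1) (card J2)) \<and>
        mu_l logq (shift (- omega J1) (inverse (sign_mero logq J2 J1))) \<otimes>\<^bsub>F_alg logq\<^esub> q_minor logq (J1 \<union> J2) I =
          finsum (F_alg logq)
            (\<lambda>(I1, I2). mu_r logq (shift (- omega I1) (inverse (sign_mero logq I2 I1))) \<otimes>\<^bsub>F_alg logq\<^esub>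
               q_minor logq J1 I1 \<otimes>\<^bsub>F_alg logq\<^esub> q_minor logq J2 I2)
            (splittings I (card J1) (card J2))) \<and>
     (J1 \<inter> J2 \<noteq> {} \<longrightarrow>
        \<zero>\<^bsub>F_alg logq\<^esub> =
          finsum (F_alg logq)
            (\<lambda>(I1, I2). mu_l logq (sign_mero logq I1 I2) \<otimes>\<^bsub>F_alg logq\<^esub>
               q_minor logq I1 J1 \<otimes>\<^bsub>F_alg logq\<^esub> q_minor logq I2 J2)
            (splittings I (card J1) (card J2)) \<and>
        \<zero>\<^bsub>F_alg logq\<^esub> =
          finsum (F_alg logq)
            (\<lambda>(I1, I2). mu_r logq (shift (- omega I1) (inverse (sign_mero logq I2 I1))) \<otimes>\<^bsub>F_alg logq\<^esub>
               q_minor logq J1 I1 \<otimes>\<^bsub>F_alg logq\<^esub> q_minor logq J2 I2)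
            (splittings I (card J1) (card J2))))"

definition not_root_of_unity :: "complex \<Rightarrow> bool" where
  "not_root_of_unity q \<longleftrightarrow> (\<forall>k::nat. k > 0 \<longrightarrow> q ^ k \<noteq> 1)"

text \<open>A type cannot depend on the parameter \<open>logq\<close>.  So that the algebras become types nevertheless, the
  parameter is fixed to be a counterexample to the expansions if there is one: it suffices to prove
  the expansions for this parameter.\<close>

definition generic_log :: "'n::{finite,linorder} itself \<Rightarrow> complex" where
  "generic_log n = (SOME c. not_root_of_unity (exp c) \<and>
     (laplace_expansions n c \<longrightarrow> (\<forall>c'. not_root_of_unity (exp c') \<longrightarrow> laplace_expansions n c')))"

lemma generic_log:
  "not_root_of_unity (exp (generic_log n))"
  "laplace_expansions n (generic_log n) \<Longrightarrow> not_root_of_unity (exp c) \<Longrightarrow> laplace_expansions n c"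
proof -
  have "norm (exp (1::complex)) > 1" by simp
  then have "norm (exp (1::complex) ^ k) > 1" if "k > 0" for k
    using that unfolding norm_power by (intro one_less_power)
  then have "not_root_of_unity (exp 1)" unfolding not_root_of_unity_def by (metis less_irrefl norm_one)
  \<comment> \<open>If some admissible parameter violates the expansions, it is a witness; otherwise
    1 is one, because the modulus of \<open>exp 1\<close> exceeds 1.\<close>
  then have "\<exists>c. not_root_of_unity (exp c) \<and>
     (laplace_expansions n c \<longrightarrow> (\<forall>c'. not_root_of_unity (exp c') \<longrightarrow> laplace_expansions n c'))" by blast
  from someI_ex[OF this, folded generic_log_def]
  show "not_root_of_unity (exp (generic_log n))"
    "laplace_expansions n (generic_log n) \<Longrightarrow> not_root_of_unity (exp c) \<Longrightarrow> laplace_expansions n c" by blast+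
qed

lemma generic_log_neq_1: "exp (-2 * generic_log n) \<noteq> 1"
proof
  assume "exp (-2 * generic_log n) = 1"
  then have "exp (generic_log n) ^ 2 = 1"
    by (simp add: exp_minus power2_eq_square flip: exp_add mult_2)
  then show False using generic_log(1)[of n] unfolding not_root_of_unity_def by (metis zero_less_numeral)
qed

section \<open>From the RLL-relations to the relations between columns and between rows\<close>

instantiation fgen :: ("{finite,linorder}") presentation
begin
definition relations_fgen :: "('a fgen list \<Rightarrow>\<^sub>0 complex) set" where "relations_fgen = F_rels (generic_log TYPE('a))"
instance ..
end

abbreviation Lf :: "'n::{finite,linorder} mero \<Rightarrow> 'n fgen pres" where "Lf f \<equiv> gen (FunL f)"
abbreviation Rf :: "'n::{finite,linorder} mero \<Rightarrow> 'n fgen pres" where "Rf f \<equiv> gen (FunR f)"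
abbreviation T :: "'n::{finite,linorder} \<Rightarrow> 'n \<Rightarrow> 'n fgen pres" where "T i j \<equiv> gen (GenT i j)"
abbreviation H0 :: "'n::{finite,linorder} \<Rightarrow> 'n \<Rightarrow> 'n mero" where "H0 \<equiv> H (generic_log TYPE('n))"
abbreviation sh :: "'n::{finite,linorder} \<Rightarrow> 'n mero \<Rightarrow> 'n mero" where "sh k \<equiv> shift (omega {k})"

lemma mk_relation_eq: "p - q \<in> relations \<Longrightarrow> mk p = mk q"
  using mk_relation[of "p - q"] by (simp add: mk_minus)

lemma F_scalars:
  "Lf (f + g) = Lf f + Lf g" "Rf (f + g) = Rf f + Rf g"
  "Lf (f * g) = Lf f * Lf g" "Rf (f * g) = Rf f * Rf g"
  "Lf (const_mero c :: 'n mero) = sc c" "Rf (const_mero c :: 'n mero) = sc c" "Lf f * Rf g = Rf g * Lf f"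
  "Lf f * T i j = T i j * Lf (sh i f)" "Rf f * T i j = T i j * Rf (sh j f)"
  for f g :: "'n::{finite,linorder} mero"
proof -
  let ?rel = "relations :: ('n fgen list \<Rightarrow>\<^sub>0 complex) set"
  have "word [FunL (f + g)] - word [FunL f] - word [FunL g] \<in> ?rel"
    "word [FunR (f + g)] - word [FunR f] - word [FunR g] \<in> ?rel"
    by (auto simp: relations_fgen_def F_rels_def)
  from this[THEN mk_relation] show "Lf (f + g) = Lf f + Lf g" "Rf (f + g) = Rf f + Rf g"
    by (simp_all add: mk_minus mk_add mk_word algebra_simps)
  have "word [FunL (f * g)] - word [FunL f, FunL g] \<in> ?rel"
    "word [FunR (f * g)] - word [FunR f, FunR g] \<in> ?rel"
    "word [FunL f, FunR g] - word [FunR g, FunL f] \<in> ?rel"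
    "word [FunL f, GenT i j] - word [GenT i j, FunL (sh i f)] \<in> ?rel"
    "word [FunR f, GenT i j] - word [GenT i j, FunR (sh j f)] \<in> ?rel"
    unfolding relations_fgen_def F_rels_def by blast+
  from this[THEN mk_relation_eq] show "Lf (f * g) = Lf f * Lf g" "Rf (f * g) = Rf f * Rf g"
    "Lf f * Rf g = Rf g * Lf f" "Lf f * T i j = T i j * Lf (sh i f)" "Rf f * T i j = T i j * Rf (sh j f)"
    by (simp_all add: mk_word)
  have "word [FunL (const_mero c)] - Poly_Mapping.single [] c \<in> ?rel"
    "word [FunR (const_mero c)] - Poly_Mapping.single [] c \<in> ?rel"
    unfolding relations_fgen_def F_rels_def by blast+
  from this[THEN mk_relation_eq] show "Lf (const_mero c :: 'n mero) = sc c" "Rf (const_mero c :: 'n mero) = sc c"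
    by (simp_all add: mk_word sc_def)
qed

lemma F_scalars_diff: "Lf (f - g) = Lf f - Lf g" "Rf (f - g) = Rf f - Rf g"
  using F_scalars(1,2)[of "f - g" g] by simp_all

lemma F_one: "Lf 1 = 1" "Rf 1 = 1"
  using F_scalars(5,6)[of 1] by simp_all

lemma F_zero: "Lf 0 = 0" "Rf 0 = 0"
  using F_scalars(5,6)[of 0] by simp_all

text \<open>For two different fixed indices, the R-matrix sum in an RLL-relation has just two
  nonzero terms, the direct and the exchanged one; for equal indices a single one remains.\<close>

lemma sum_UNIV_pair:
  assumes "a \<noteq> (c :: 'n::finite)" "\<And>x y. (x, y) \<noteq> (a, c) \<Longrightarrow> (x, y) \<noteq> (c, a) \<Longrightarrow> F x y = (0 :: 'b::comm_monoid_add)"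
  shows "(\<Sum>x\<in>UNIV. \<Sum>y\<in>UNIV. F x y) = F a c + F c a"
proof -
  have "(\<Sum>x\<in>UNIV. \<Sum>y\<in>UNIV. F x y) = (\<Sum>(x, y)\<in>UNIV \<times> UNIV. F x y)" by (simp add: sum.cartesian_product)
  also have "\<dots> = (\<Sum>(x, y)\<in>{(a, c), (c, a)}. F x y)"
    by (rule sum.mono_neutral_right) (use assms(2) in auto)
  finally show ?thesis using assms(1) by simp
qed

lemma sum_UNIV_diag:
  assumes "\<And>x y. (x, y) \<noteq> (a, a) \<Longrightarrow> F x y = (0 :: 'b::comm_monoid_add)"
  shows "(\<Sum>x\<in>UNIV. \<Sum>y\<in>UNIV. F x y) = F a (a :: 'n::finite)"
proof -
  have "(\<Sum>x\<in>UNIV. \<Sum>y\<in>UNIV. F x y) = (\<Sum>(x, y)\<in>UNIV \<times> UNIV. F x y)" by (simp add: sum.cartesian_product)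
  also have "\<dots> = (\<Sum>(x, y)\<in>{(a, a)}. F x y)"
    by (rule sum.mono_neutral_right) (use assms in auto)
  finally show ?thesis by simp
qed

lemma RLL:
  "(\<Sum>x\<in>UNIV. \<Sum>y\<in>UNIV. Lf (Rmat (generic_log TYPE('n)) x y a c) * T x b * T y d) =
   (\<Sum>x\<in>UNIV. \<Sum>y\<in>UNIV. Rf (Rmat (generic_log TYPE('n)) b d x y) * T c y * T a x)"
  for a b c d :: "'n::{finite,linorder}"
proof -
  have "(\<Sum>x\<in>UNIV. \<Sum>y\<in>UNIV. word [FunL (Rmat (generic_log TYPE('n)) x y a c), GenT x b, GenT y d])
     - (\<Sum>x\<in>UNIV. \<Sum>y\<in>UNIV. word [FunR (Rmat (generic_log TYPE('n)) b d x y), GenT c y, GenT a x])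
     \<in> (relations :: ('n fgen list \<Rightarrow>\<^sub>0 complex) set)"
    unfolding relations_fgen_def F_rels_def by blast
  from mk_relation_eq[OF this] show ?thesis by (simp add: mk_sum mk_word mult.assoc)
qed

text \<open>For distinct indices this is the entry R^(ac)_(ac), with g written as the product of two
  values of h by \<open>H_mult_swap\<close>.\<close>

definition R_diag :: "'n::{finite,linorder} \<Rightarrow> 'n \<Rightarrow> 'n mero" where
  "R_diag a c = (if a < c then 1 else H0 a c * H0 c a)"

context
  fixes a b c d :: "'n::{finite,linorder}"
begin

private lemma Rmat_sum_L:
  "(\<Sum>x\<in>UNIV. \<Sum>y\<in>UNIV. Lf (Rmat (generic_log TYPE('n)) x y a c) * T x b * T y d) =
   (if a = c then sc (exp (generic_log TYPE('n))) * T a b * T a d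
    else Lf (R_diag a c) * T a b * T c d + (sc (exp (generic_log TYPE('n))) - Lf (H0 c a)) * T c b * T a d)"
proof (cases "a = c")
  case True
  have "(\<Sum>x\<in>UNIV. \<Sum>y\<in>UNIV. Lf (Rmat (generic_log TYPE('n)) x y a c) * T x b * T y d) =
      Lf (Rmat (generic_log TYPE('n)) a a a c) * T a b * T a d"
    by (rule sum_UNIV_diag) (use True in \<open>auto simp: Rmat_def F_zero\<close>)
  then show ?thesis using True by (simp add: Rmat_def qpow_def F_scalars)
next
  case False
  have "(\<Sum>x\<in>UNIV. \<Sum>y\<in>UNIV. Lf (Rmat (generic_log TYPE('n)) x y a c) * T x b * T y d) =
      Lf (Rmat (generic_log TYPE('n)) a c a c) * T a b * T c d + Lf (Rmat (generic_log TYPE('n)) c a a c) * T c b * T a d"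
    by (rule sum_UNIV_pair) (use False in \<open>auto simp: Rmat_def F_zero\<close>)
  then show ?thesis using False H_mult_swap[OF generic_log_neq_1[of "TYPE('n)"], of a c]
    by (auto simp: Rmat_def R_diag_def F_scalars F_scalars_diff at_diff_h0_eq[OF generic_log_neq_1])
qed

private lemma Rmat_sum_R:
  "(\<Sum>x\<in>UNIV. \<Sum>y\<in>UNIV. Rf (Rmat (generic_log TYPE('n)) b d x y) * T c y * T a x) =
   (if b = d then sc (exp (generic_log TYPE('n))) * T c b * T a b
    else Rf (R_diag b d) * T c d * T a b + (sc (exp (generic_log TYPE('n))) - Rf (H0 b d)) * T c b * T a d)"
proof (cases "b = d")
  case True
  have "(\<Sum>x\<in>UNIV. \<Sum>y\<in>UNIV. Rf (Rmat (generic_log TYPE('n)) b d x y) * T c y * T a x) =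
      Rf (Rmat (generic_log TYPE('n)) b d b b) * T c b * T a b"
    by (rule sum_UNIV_diag) (use True in \<open>auto simp: Rmat_def F_zero\<close>)
  then show ?thesis using True by (simp add: Rmat_def qpow_def F_scalars)
next
  case False
  have "(\<Sum>x\<in>UNIV. \<Sum>y\<in>UNIV. Rf (Rmat (generic_log TYPE('n)) b d x y) * T c y * T a x) =
      Rf (Rmat (generic_log TYPE('n)) b d b d) * T c d * T a b + Rf (Rmat (generic_log TYPE('n)) b d d b) * T c b * T a d"
    by (rule sum_UNIV_pair) (use False in \<open>auto simp: Rmat_def F_zero\<close>)
  then show ?thesis using False H_mult_swap[OF generic_log_neq_1[of "TYPE('n)"], of b d]
    by (auto simp: Rmat_def R_diag_def F_scalars F_scalars_diff at_diff_h0_eq[OF generic_log_neq_1])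
qed

text \<open>When this fact is instantiated, the arguments come in the order \<open>a c b d\<close>:
  the two rows, then the two columns.\<close>

lemmas RLL_entries = RLL[of a c b d, unfolded Rmat_sum_L Rmat_sum_R]

end

interpretation F: dynamical_matrix "(<)" "H0 :: 'n \<Rightarrow> 'n \<Rightarrow> 'n::{finite,linorder} mero" sh Lf Rf T
proof
  fix i j k a b :: 'n and f g :: "'n mero"
  show "\<exists>g. sh k g = f" by (rule exI[of _ "shift (- omega {k}) f"]) (simp add: shift_shift)
  show "sh k (H0 i j) = H0 i j" if "k \<noteq> i" "k \<noteq> j" "i \<noteq> j"
    using shift_H[OF generic_log_neq_1 that] .
  show "T a i * T b i = Lf (H0 b a) * T b i * T a i" if "a < b"
    using RLL_entries[of a b i i] that less_imp_neq[OF that] by (simp add: R_diag_def F_one algebra_simps)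
  show "T a j * T b i - Lf (H0 b a) * T b j * T a i = - Rf (H0 j i) * (T a i * T b j - Lf (H0 b a) * T b i * T a j)"
    if ab: "a < b" "i < j"
  proof -
    \<comment> \<open>There are four products of an entry in row \<open>a\<close> with one in row
      \<open>b\<close>, up to exchange. Two RLL-relations express the other two of those that occur
      here through \<open>u\<close> and \<open>v\<close>, and the claim becomes an identity in
      \<open>u\<close> and \<open>v\<close>.\<close>
    define u v p m m' k where "u = T b j * T a i" "v = T b i * T a j" "p = Lf (H0 b a)" "m = Rf (H0 j i)"
      "m' = Rf (H0 i j)" "k = (sc (exp (generic_log TYPE('n))) :: 'n fgen pres)"
    note d = this[symmetric] and ab = ab less_imp_neq[OF ab(1)] less_imp_neq[OF ab(2)] order_less_not_sym[OF ab(1)] order_less_not_sym[OF ab(2)]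
    have "T a i * T b j + (k - p) * v = u + (k - m') * v"
      using RLL_entries[of a b i j] ab by (simp add: R_diag_def F_one d mult.assoc)
    moreover have "T a j * T b i + (k - p) * u = m * m' * v + (k - m) * u"
      using RLL_entries[of a b j i] ab by (simp add: R_diag_def F_scalars(4) F_one d mult.assoc)
    ultimately have e: "T a i * T b j = u + (k - m') * v - (k - p) * v"
      "T a j * T b i = m * m' * v + (k - m) * u - (k - p) * u" by (simp_all add: eq_diff_eq)
    show ?thesis unfolding d mult.assoc e by (simp add: algebra_simps)
  qed
qed (auto simp: F_scalars F_one less_trans)

text \<open>The quantum integer \<open>[m]\<close> with the sign of a product of \<open>m - 1\<close> factors \<open>-h\<close>.\<close>

definition kappa :: "'n::{finite,linorder} itself \<Rightarrow> nat \<Rightarrow> complex" where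
  "kappa n m = (let q = exp (generic_log n) in (- 1) ^ (m - 1) * ((q ^ m - inverse q ^ m) / (q - inverse q)))"

lemma generic_log_quantum_integer:
  assumes "m > 0" shows "exp (generic_log n) ^ m \<noteq> inverse (exp (generic_log n)) ^ m"
proof
  assume *: "exp (generic_log n) ^ m = inverse (exp (generic_log n)) ^ m"
  have "exp (generic_log n) ^ (m + m) = inverse (exp (generic_log n)) ^ m * exp (generic_log n) ^ m"
    by (simp add: power_add *)
  also have "\<dots> = 1" by (simp flip: power_mult_distrib)
  finally show False using generic_log(1)[of n] assms unfolding not_root_of_unity_def by (metis add_gr_0)
qed

interpretation F: dynamical_matrix_transpose "(<)" "H0 :: 'n \<Rightarrow> 'n \<Rightarrow> 'n::{finite,linorder} mero" sh Lf Rf T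
  "\<lambda>m. const_mero (kappa TYPE('n) m)"
proof
  fix i j k a b :: 'n and f g :: "'n mero" and I :: "'n set" and m :: nat
  let ?q = "exp (generic_log TYPE('n))"
  show "\<exists>g. sh k g = f" by (rule exI[of _ "shift (- omega {k}) f"]) (simp add: shift_shift)
  show "T i a * T i b = Rf (H0 b a) * T i b * T i a" if "b < a"
    using RLL_entries[of i i b a] that less_imp_neq[OF that] by (simp add: R_diag_def F_one algebra_simps)
  show "T j a * T i b - Rf (H0 b a) * T j b * T i a = - Lf (H0 j i) * (T i a * T j b - Rf (H0 b a) * T i b * T j a)"
    if ab: "b < a" "j < i"
  proof -
    define u v p m m' k where "u = T i a * T j b" "v = T i b * T j a" "p = Lf (H0 i j)" "m = Rf (H0 a b)"
      "m' = Rf (H0 b a)" "k = (sc ?q :: 'n fgen pres)"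
    note d = this[symmetric] and ab = ab less_imp_neq[OF ab(1)] less_imp_neq[OF ab(2)] order_less_not_sym[OF ab(1)] order_less_not_sym[OF ab(2)]
    \<comment> \<open>The two values of h with exchanged arguments sum to this central constant in
      either copy of the scalars. This eliminates \<open>Lf (H0 j i)\<close> and \<open>m\<close>,
      after which both sides agree because \<open>p\<close> and \<open>m'\<close> commute.\<close>
    define s where "s = (sc (?q + inverse ?q) :: 'n fgen pres)"
    have H: "H0 x y + H0 y x = const_mero (?q + inverse ?q)" if "x \<noteq> y" for x y :: 'n
      using H_add_swap[OF generic_log_neq_1[of "TYPE('n)"] that]
      by (simp add: const_mero_hom inverse_eq_divide)
    have "Lf (H0 i j + H0 j i) = s" "Rf (H0 a b + H0 b a) = s"
      using ab H[of i j] H[of a b] by (simp_all add: F_scalars s_def)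
    then have s: "Lf (H0 j i) = s - p" "m = s - m'"
      by (simp_all add: F_scalars d algebra_simps)
    have c: "x * s = s * x" "x * k = k * x" for x by (simp_all add: s_def sc_commute flip: d)
    have pm: "p * m' = m' * p" by (simp add: F_scalars flip: d)
    have "T j b * T i a + (k - p) * v = u + (k - m') * v"
      using RLL_entries[of j i b a] ab by (simp add: R_diag_def F_one d mult.assoc)
    moreover have "T j a * T i b + (k - p) * u = m * m' * v + (k - m) * u"
      using RLL_entries[of j i a b] ab by (simp add: R_diag_def F_scalars(4) F_one d mult.assoc)
    ultimately have e: "T j b * T i a = u + (k - m') * v - (k - p) * v"
      "T j a * T i b = m * m' * v + (k - m) * u - (k - p) * u" by (simp_all add: eq_diff_eq)
    have "m' * (k * x) = k * (m' * x)" "m' * (p * x) = p * (m' * x)" for x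
      using c(2)[of m'] pm by (simp_all flip: mult.assoc)
    then show ?thesis unfolding d mult.assoc e s by (simp add: algebra_simps)
  qed
  show "(\<Sum>i\<in>I. \<Prod>m\<in>I - {i}. - H0 i m) = const_mero (kappa TYPE('n) (card I))"
  proof -
    have "?q \<noteq> inverse ?q" using generic_log_quantum_integer[of 1 "TYPE('n)"] by simp
    then have q: "?q - inverse ?q \<noteq> 0" by simp
    have p: "(\<Prod>m\<in>I - {i}. - H0 i m) = const_mero ((-1) ^ (card I - 1)) * (\<Prod>m\<in>I - {i}. H0 i m)"
      if "i \<in> I" for i
    proof -
      have "const_mero (0 - 1) = (const_mero 0 - const_mero 1 :: 'n mero)" by (rule const_mero_hom)
      then have m: "const_mero (-1) = (-1 :: 'n mero)" by simp
      have "const_mero ((-1) ^ k) = ((-1) ^ k :: 'n mero)" for k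
        by (induction k) (simp_all only: power_0 power_Suc const_mero_1 const_mero_hom(2) m)
      then show ?thesis using that by (simp add: prod_uminus)
    qed
    have "const_mero (?q - inverse ?q) * (\<Sum>i\<in>I. \<Prod>m\<in>I - {i}. H0 i m)
        = const_mero (?q ^ card I - inverse ?q ^ card I)"
      using sum_prod_H[OF generic_log_neq_1[of "TYPE('n)"], of I] by (simp add: exp_minus)
    then have "(\<Sum>i\<in>I. \<Prod>m\<in>I - {i}. H0 i m) = const_mero ((?q ^ card I - inverse ?q ^ card I) / (?q - inverse ?q))"
      using q by (simp add: const_mero_hom(4) eq_divide_eq const_mero_eq_0_iff mult.commute)
    then show ?thesis
      by (simp add: p kappa_def Let_def const_mero_hom(2) del: times_divide_eq_right flip: sum_distrib_left)
  qed
  show "const_mero (kappa TYPE('n) m) \<noteq> (0 :: 'n mero)" if "0 < m"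
    using generic_log_quantum_integer[of m "TYPE('n)"] generic_log_quantum_integer[of 1 "TYPE('n)"] that
    by (simp add: const_mero_eq_0_iff kappa_def Let_def)
qed (auto simp: F_scalars F_one F.sh_h)

subsection \<open>The dynamical exterior algebra\<close>

instantiation wgen :: ("{finite,linorder}") presentation
begin
definition relations_wgen :: "('a wgen list \<Rightarrow>\<^sub>0 complex) set" where "relations_wgen = W_rels (generic_log TYPE('a))"
instance ..
end

abbreviation w :: "'n::{finite,linorder} \<Rightarrow> 'n wgen pres" where "w i \<equiv> gen (GenW i)"
abbreviation M :: "'n::{finite,linorder} mero \<Rightarrow> 'n wgen pres" where "M f \<equiv> gen (FunW f)"

lemma W_relations:
  "M (f + g) = M f + M g" "M (f * g) = M f * M g" "M (const_mero c :: 'n mero) = sc c"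
  "w i * w i = 0" "i < j \<Longrightarrow> w j * w i = M (- H0 j i) * (w i * w j)"
  "M f * w i = w i * M (sh i f)"
  for f g :: "'n::{finite,linorder} mero"
proof -
  let ?rel = "relations :: ('n wgen list \<Rightarrow>\<^sub>0 complex) set"
  have "word [FunW (f + g)] - word [FunW f] - word [FunW g] \<in> ?rel"
    unfolding relations_wgen_def W_rels_def by blast
  from this[THEN mk_relation] show "M (f + g) = M f + M g"
    by (simp add: mk_minus mk_add mk_word algebra_simps)
  have "word [FunW (f * g)] - word [FunW f, FunW g] \<in> ?rel"
    "word [FunW f, GenW i] - word [GenW i, FunW (sh i f)] \<in> ?rel"
    "word [FunW (const_mero c)] - Poly_Mapping.single [] c \<in> ?rel"
    unfolding relations_wgen_def W_rels_def by blast+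
  from this[THEN mk_relation_eq] show "M (f * g) = M f * M g" "M f * w i = w i * M (sh i f)"
    "M (const_mero c :: 'n mero) = sc c"
    by (simp_all add: mk_word) (simp add: sc_def)
  have "word [GenW i, GenW i] \<in> ?rel"
    unfolding relations_wgen_def W_rels_def by blast
  from this[THEN mk_relation] show "w i * w i = 0" by (simp add: mk_word)
  show "w j * w i = M (- H0 j i) * (w i * w j)" if "i < j"
  proof -
    have "word [GenW j, GenW i] - word [FunW (- H0 j i), GenW i, GenW j] \<in> ?rel"
      using that unfolding relations_wgen_def W_rels_def H_def by blast
    from this[THEN mk_relation_eq] show ?thesis by (simp add: mk_word)
  qed
qed

lemma M_one: "M 1 = 1"
  using W_relations(3)[of 1] by simp

interpretation W: exterior_action "(<)" "H0 :: 'n \<Rightarrow> 'n \<Rightarrow> 'n::{finite,linorder} mero" sh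
  "\<lambda>i v. w i * v" "\<lambda>f v. M f * v"
proof
  fix i j k :: 'n and f g :: "'n mero" and v :: "'n wgen pres"
  show "w i * (w i * v) = 0" by (simp add: W_relations(4) flip: mult.assoc)
  show "w j * (w i * v) = M (- H0 j i) * (w i * (w j * v))" if "i < j"
    using W_relations(5)[OF that] by (simp flip: mult.assoc)
  show "w k * (M (sh k f) * v) = M f * (w k * v)"
    using W_relations(6)[of f k] by (simp flip: mult.assoc)
  show "M (f * g) * v = M f * (M g * v)" by (simp add: W_relations mult.assoc)
qed (simp_all add: M_one)

abbreviation wset :: "'n::{finite,linorder} set \<Rightarrow> 'n wgen pres" where "wset K \<equiv> W.ops K 1"

lemma wset_insert: "(\<And>k. k \<in> K \<Longrightarrow> j < k) \<Longrightarrow> wset (insert j K) = w j * wset K"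
  by (rule W.ops_insert)

text \<open>The normally ordered monomials are linearly independent because the exterior algebra acts on
  the functions on the subsets, just as it would act by multiplication on their span.\<close>

definition wact :: "'n::{finite,linorder} wgen \<Rightarrow> ('n set \<Rightarrow> 'n mero) \<Rightarrow> 'n set \<Rightarrow> 'n mero" where
  "wact g \<phi> L = (case g of
     GenW i \<Rightarrow> if i \<in> L then F.sgn1 i (L - {i}) * shift (- omega {i}) (\<phi> (L - {i})) else 0
   | FunW f \<Rightarrow> f * \<phi> L)"

lemma shift_inv: "sh i f = f \<Longrightarrow> shift (- omega {i}) f = f"
  by (metis add.left_inverse shift_0 shift_shift)

lemma shift_sgn1: "k \<notin> B \<Longrightarrow> k \<noteq> i \<Longrightarrow> shift (- omega {k}) (F.sgn1 i B) = F.sgn1 i B"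
  by (intro shift_inv F.sh_sgn1)

interpretation W: word_module "wact :: 'n::{finite,linorder} wgen \<Rightarrow> _" "\<lambda>c \<phi> L. const_mero c * \<phi> L"
proof
  fix g :: "'n wgen" and \<phi> \<psi> :: "'n set \<Rightarrow> 'n mero" and c d :: complex
  show "wact g (\<phi> + \<psi>) = wact g \<phi> + wact g \<psi>"
    by (rule ext) (simp add: wact_def algebra_simps split: wgen.splits)
  show "wact g (\<lambda>L. const_mero c * \<phi> L) = (\<lambda>L. const_mero c * wact g \<phi> L)"
    by (rule ext) (simp add: wact_def algebra_simps split: wgen.splits)
qed (simp_all add: fun_eq_iff algebra_simps const_mero_hom)

interpretation W: presented_module "wact :: 'n::{finite,linorder} wgen \<Rightarrow> _" "\<lambda>c \<phi> L. const_mero c * \<phi> L"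
proof
  fix p :: "'n wgen list \<Rightarrow>\<^sub>0 complex" and \<phi> :: "'n set \<Rightarrow> 'n mero"
  have square: "wact (GenW i) (wact (GenW i) \<phi>) = 0" for i by (rule ext) (simp add: wact_def)
  have swap: "wact (GenW j) (wact (GenW i) \<phi>) = wact (FunW (- H0 j i)) (wact (GenW i) (wact (GenW j) \<phi>))"
    if "i < j" for i j
  proof (rule ext)
    fix L :: "'n set"
    show "wact (GenW j) (wact (GenW i) \<phi>) L = wact (FunW (- H0 j i)) (wact (GenW i) (wact (GenW j) \<phi>)) L"
    proof (cases "i \<in> L \<and> j \<in> L")
      \<comment> \<open>In the other case both sides vanish. Here \<open>- H0 j i\<close> arises on
        the left from inserting \<open>i\<close> below \<open>j\<close>, while inserting
        \<open>j\<close> above \<open>i\<close> on the right contributes no factor.\<close>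
      case True
      define K where "K = L - {i, j}"
      have K: "i \<notin> K" "j \<notin> K" "i \<noteq> j" "\<not> j < i" using that by (auto simp: K_def)
      have e: "L - {j} = insert i K" "L - {i} = insert j K" using True K by (auto simp: K_def)
      have e': "insert i K - {i} = K" "insert j K - {j} = K" using K by auto
      show ?thesis
        using True K that
        by (simp add: wact_def e e' shift_sgn1 F.sgn1_insert shift_shift add.commute mult_ac)
    qed (use that in \<open>auto simp: wact_def\<close>)
  qed
  have comm: "wact (FunW f) (wact (GenW i) \<phi>) = wact (GenW i) (wact (FunW (sh i f)) \<phi>)" for f i
    by (rule ext) (simp add: wact_def shift_shift mult_ac)
  show "p \<in> relations \<Longrightarrow> W.ev p \<phi> = 0"
    unfolding relations_wgen_def W_rels_def
    by (auto simp: W.ev_minus W.ev_single square swap[unfolded H_def] comm const_mero_hom)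
       (auto simp: wact_def fun_eq_iff algebra_simps)
qed

text \<open>The coefficient of w_K in \<open>v\<close>: the function that is 1 at the empty set
  represents the unit, so \<open>v\<close> applied to it represents \<open>v\<close> itself.\<close>

definition wcoeff :: "'n::{finite,linorder} set \<Rightarrow> 'n wgen pres \<Rightarrow> 'n mero" where
  "wcoeff K v = W.action v (\<lambda>L. if L = {} then 1 else 0) K"

lemma wcoeff_add: "wcoeff K (u + v) = wcoeff K u + wcoeff K v"
  by (simp add: wcoeff_def W.action_add)

lemma wcoeff_M: "wcoeff K (M f * v) = f * wcoeff K v"
  by (simp add: wcoeff_def W.action_mult W.action_gen wact_def)

lemma wcoeff_sc: "wcoeff K (sc c * v) = const_mero c * wcoeff K v"
  by (simp add: wcoeff_def W.action_mult W.action_sc)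

lemma wcoeff_wset: "wcoeff L (wset K) = (if L = K then 1 else 0)"
proof -
  have "W.action (wset K) (\<lambda>L. if L = {} then 1 else 0) = (\<lambda>L. if L = K then 1 else 0)"
  proof (induction K rule: F.min_induct)
    case empty
    show ?case by simp
  next
    case (insert j K)
    have "j \<notin> K" using insert(1) by blast
    then have e: "L - {j} = K \<longleftrightarrow> L = insert j K" if "j \<in> L" for L using that by auto
    have "W.action (wset (insert j K)) (\<lambda>L. if L = {} then 1 else 0) = wact (GenW j) (\<lambda>L. if L = K then 1 else 0)"
      by (simp add: wset_insert[OF insert(1)] W.action_mult W.action_gen insert(2))
    also have "\<dots> = (\<lambda>L. if L = insert j K then 1 else 0)"
      using F.sgn1_below[of K j, OF insert(1)] \<open>j \<notin> K\<close> by (auto simp: wact_def fun_eq_iff e)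
    finally show ?case .
  qed
  then show ?thesis by (simp add: wcoeff_def)
qed

subsection \<open>The dynamical tensor product\<close>

definition bideg :: "'n::finite fgen \<Rightarrow> (complex^'n) \<times> (complex^'n)" where
  "bideg g = (ldeg g, rdeg g)"

lemma W_hom_eq: "W_hom (generic_log TYPE('n)) \<alpha> = Rep_pres ` (homog wdeg \<alpha> :: 'n::{finite,linorder} wgen pres set)"
  by (simp add: W_hom_def homog_def image_image mk.rep_eq relations_wgen_def)

lemma F_hom_eq: "F_hom (generic_log TYPE('n)) \<alpha> \<beta> = Rep_pres ` (homog bideg (\<alpha>, \<beta>) :: 'n::{finite,linorder} fgen pres set)"
proof -
  have "sum_list (map bideg xs) = (sum_list (map ldeg xs), sum_list (map rdeg xs))" for xs :: "'n fgen list"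
    by (induction xs) (simp_all add: bideg_def zero_prod_def)
  then show ?thesis by (simp add: F_hom_def homog_def image_image mk.rep_eq relations_fgen_def)
qed

lemma W_alg_eq: "W_alg (generic_log TYPE('n)) = presented (relations :: ('n::{finite,linorder} wgen list \<Rightarrow>\<^sub>0 complex) set)"
  and F_alg_eq: "F_alg (generic_log TYPE('n)) = presented (relations :: ('n fgen list \<Rightarrow>\<^sub>0 complex) set)"
  by (simp_all add: W_alg_def F_alg_def relations_wgen_def relations_fgen_def)

lemma Rep_generators:
  "t_gen (generic_log TYPE('n)) i j = Rep_pres (T i j)" "mu_l (generic_log TYPE('n)) f = Rep_pres (Lf f)"
  "mu_r (generic_log TYPE('n)) f = Rep_pres (Rf f)" "w_gen (generic_log TYPE('n)) i = Rep_pres (w i)"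
  "mu_W (generic_log TYPE('n)) f = Rep_pres (M f)"
  "scalar (F_rels (generic_log TYPE('n))) c = Rep_pres (sc c :: 'n fgen pres)"
  "scalar (W_rels (generic_log TYPE('n))) c = Rep_pres (sc c :: 'n wgen pres)"
  for f :: "'n::{finite,linorder} mero" and i j :: 'n
  by (simp_all add: t_gen_def mu_l_def mu_r_def w_gen_def mu_W_def scalar_def gen_def sc_def mk.rep_eq
      relations_wgen_def relations_fgen_def)

lemma sc_mult_intertwine: "x * y = z * x \<Longrightarrow> sc c * x * y = z * (sc c * x)"
  by (metis mult.assoc sc_commute)

text \<open>Together with \<open>homog_commute_L\<close> this makes balancing compatible with
  multiplication from the left: in a pair of matching weights, a scalar acquires the same shift in
  both factors.\<close>

lemma homog_commute_M:
  assumes "v \<in> homog wdeg \<alpha>" shows "v * M f = M (shift (- \<alpha>) f) * v"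
  using assms
proof (induction rule: homog_induct)
  case (monom c xs)
  have "prod_list (map gen xs) * M f = M (shift (- sum_list (map wdeg xs)) f) * prod_list (map gen xs)" for f
  proof (induction xs)
    case (Cons g xs)
    have "gen g * M (shift (- \<beta>) f) = M (shift (- wdeg g - \<beta>) f) * gen g" for \<beta>
    proof (cases g)
      case (GenW i)
      then show ?thesis by (simp add: W_relations(6) shift_shift)
    next
      case (FunW h)
      then show ?thesis by (simp add: mult.commute flip: W_relations(2))
    qed
    note g = this[of "sum_list (map wdeg xs)"]
    have "prod_list (map gen (g # xs)) * M f = gen g * M (shift (- sum_list (map wdeg xs)) f) * prod_list (map gen xs)"
      by (simp add: mult.assoc Cons)
    then show ?case unfolding g by (simp add: mult.assoc)
  qed simp
  then show ?case using monom by (auto intro: sc_mult_intertwine)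
qed (simp_all add: algebra_simps)

lemma homog_commute_L:
  assumes "a \<in> homog bideg (\<alpha>, \<beta>)" shows "a * Lf f = Lf (shift (- \<alpha>) f) * a"
  using assms
proof (induction rule: homog_induct)
  case (monom c xs)
  have "prod_list (map gen xs) * Lf f = Lf (shift (- fst (sum_list (map bideg xs))) f) * prod_list (map gen xs)" for f
  proof (induction xs)
    case (Cons g xs)
    have "gen g * Lf (shift (- \<beta>) f) = Lf (shift (- ldeg g - \<beta>) f) * gen g" for \<beta>
    proof (cases g)
      case (GenT i j)
      then show ?thesis by (simp add: F_scalars(8) shift_shift)
    next
      case (FunL h)
      then show ?thesis by (simp add: mult.commute flip: F_scalars(3))
    next
      case (FunR h)
      then show ?thesis by (simp add: F_scalars(7))
    qed
    note g = this[of "fst (sum_list (map bideg xs))"]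
    have "prod_list (map gen (g # xs)) * Lf f
        = gen g * Lf (shift (- fst (sum_list (map bideg xs))) f) * prod_list (map gen xs)"
      by (simp add: mult.assoc Cons)
    then show ?case unfolding g by (simp add: bideg_def[of g] mult.assoc)
  qed simp
  then show ?case using monom by (auto intro: sc_mult_intertwine)
qed (simp_all add: algebra_simps)

abbreviation HP :: "('n::{finite,linorder} W_elem \<times> 'n F_elem) monoid" where
  "HP \<equiv> hom_pairs (generic_log TYPE('n))"

definition bimon :: "complex \<Rightarrow> 'n::{finite,linorder} wgen pres \<Rightarrow> 'n fgen pres \<Rightarrow> ('n W_elem \<times> 'n F_elem \<Rightarrow>\<^sub>0 complex)" where
  "bimon c v a = Poly_Mapping.single (Rep_pres v, Rep_pres a) c"

lemma carrier_HP: "x \<in> carrier HP \<longleftrightarrow>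
  (\<exists>v a \<alpha> \<beta>. v \<in> homog wdeg \<alpha> \<and> a \<in> homog bideg (\<alpha>, \<beta>) \<and> x = (Rep_pres v, Rep_pres a))"
  by (cases x) (auto simp: hom_pairs_def W_hom_eq F_hom_eq)

lemma HP_mult: "(Rep_pres v, Rep_pres a) \<otimes>\<^bsub>HP\<^esub> (Rep_pres v', Rep_pres a') = (Rep_pres (v * v'), Rep_pres (a * a'))"
  by (simp add: hom_pairs_def DirProd_def W_alg_eq F_alg_eq times_pres.rep_eq)

lemma HP_one: "\<one>\<^bsub>HP\<^esub> = (Rep_pres 1, Rep_pres 1)"
  by (simp add: hom_pairs_def DirProd_def W_alg_eq F_alg_eq one_pres.rep_eq)

lemma homog_pair_mult:
  "a \<in> homog deg (\<alpha>, \<beta>) \<Longrightarrow> a' \<in> homog deg (\<alpha>', \<beta>') \<Longrightarrow> a * a' \<in> homog deg (\<alpha> + \<alpha>', \<beta> + \<beta>')"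
  using homog_mult[of a deg "(\<alpha>, \<beta>)" a' "(\<alpha>', \<beta>')"] by simp

lemma homog_one: "1 \<in> homog wdeg 0" "1 \<in> homog bideg (0, 0)"
  using homog_1[of wdeg] homog_1[of bideg] by (simp_all add: zero_prod_def)

lemma monoid_HP: "Group.monoid (HP :: ('n::{finite,linorder} W_elem \<times> 'n F_elem) monoid)"
proof (rule Group.monoidI)
  show "x \<otimes>\<^bsub>HP\<^esub> y \<in> carrier HP" if "x \<in> carrier HP" "y \<in> carrier HP" for x y :: "'n W_elem \<times> 'n F_elem"
    using that unfolding carrier_HP by (metis HP_mult homog_mult homog_pair_mult)
  show "\<one>\<^bsub>HP\<^esub> \<in> carrier (HP :: ('n W_elem \<times> 'n F_elem) monoid)"
    unfolding carrier_HP HP_one using homog_one by blast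
qed (auto simp: carrier_HP HP_mult HP_one mult.assoc)

abbreviation MA :: "('n::{finite,linorder} W_elem \<times> 'n F_elem \<Rightarrow>\<^sub>0 complex) ring" where
  "MA \<equiv> monoid_algebra HP"

lemma ring_MA: "ring MA"
  by (rule ring_monoid_algebra[OF monoid_HP])

lemma MA_ops: "\<zero>\<^bsub>MA\<^esub> = 0" "add MA = (+)" "\<one>\<^bsub>MA\<^esub> = bimon 1 1 1"
  "carrier MA = {p. Poly_Mapping.keys p \<subseteq> carrier HP}"
  by (simp_all add: monoid_algebra_def bimon_def HP_one)

lemma bimon_mult: "bimon c v a \<otimes>\<^bsub>MA\<^esub> bimon d v' a' = bimon (c * d) (v * v') (a * a')"
  by (simp add: bimon_def monoid_algebra_mult_single HP_mult)

lemma monoid_algebra_mult_diff: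
  "(p - p') \<otimes>\<^bsub>monoid_algebra G\<^esub> q = p \<otimes>\<^bsub>monoid_algebra G\<^esub> q - p' \<otimes>\<^bsub>monoid_algebra G\<^esub> q"
  "q \<otimes>\<^bsub>monoid_algebra G\<^esub> (p - p') = q \<otimes>\<^bsub>monoid_algebra G\<^esub> p - q \<otimes>\<^bsub>monoid_algebra G\<^esub> p'"
  by (simp_all add: eq_diff_eq flip: monoid_algebra_mult_add)

lemma bimon_in_carrier: "v \<in> homog wdeg \<alpha> \<Longrightarrow> a \<in> homog bideg (\<alpha>, \<beta>) \<Longrightarrow> bimon c v a \<in> carrier MA"
  by (auto simp: MA_ops bimon_def carrier_HP split: if_splits)

lemma MA_closed:
  "p \<in> carrier MA \<Longrightarrow> q \<in> carrier MA \<Longrightarrow> p + q \<in> carrier MA"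
  "p \<in> carrier MA \<Longrightarrow> q \<in> carrier MA \<Longrightarrow> p - q \<in> carrier MA"
  using keys_add[of p q] keys_diff[of p q] by (auto simp: MA_ops)

lemma MA_induct [consumes 1, case_names zero add bimon]:
  assumes "p \<in> carrier MA" "P 0" "\<And>p q. P p \<Longrightarrow> P q \<Longrightarrow> P (p + q)"
    "\<And>c v a \<alpha> \<beta>. v \<in> homog wdeg \<alpha> \<Longrightarrow> a \<in> homog bideg (\<alpha>, \<beta>) \<Longrightarrow> P (bimon c v a)"
  shows "P p"
proof -
  have "P (\<Sum>x\<in>A. Poly_Mapping.single x (Poly_Mapping.lookup p x))" if "A \<subseteq> Poly_Mapping.keys p" for A
    using that
  proof (induction A rule: infinite_finite_induct)
    case (insert x A)
    have "x \<in> carrier HP" using insert.prems assms(1) by (auto simp: MA_ops)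
    then have "P (Poly_Mapping.single x c)" for c
      unfolding carrier_HP using assms(4) by (auto simp: bimon_def)
    then show ?case using insert by (simp add: assms(3))
  qed (simp_all add: assms(2))
  from this[of "Poly_Mapping.keys p"] show ?thesis by (simp flip: poly_mapping_eq_sum_single)
qed

definition trels :: "('n::{finite,linorder} W_elem \<times> 'n F_elem \<Rightarrow>\<^sub>0 complex) set" where
  "trels = tensor_rels (generic_log TYPE('n))"

lemma trels_cases [consumes 1, case_names left right scalar_left scalar_right balance]:
  assumes "z \<in> trels"
  obtains v v' a \<alpha> \<beta> where "v \<in> homog wdeg \<alpha>" "v' \<in> homog wdeg \<alpha>" "a \<in> homog bideg (\<alpha>, \<beta>)"
      "z = bimon 1 (v + v') a - bimon 1 v a - bimon 1 v' a"
  | v a a' \<alpha> \<beta> where "v \<in> homog wdeg \<alpha>" "a \<in> homog bideg (\<alpha>, \<beta>)" "a' \<in> homog bideg (\<alpha>, \<beta>)"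
      "z = bimon 1 v (a + a') - bimon 1 v a - bimon 1 v a'"
  | c v a \<alpha> \<beta> where "v \<in> homog wdeg \<alpha>" "a \<in> homog bideg (\<alpha>, \<beta>)" "z = bimon 1 (sc c * v) a - bimon c v a"
  | c v a \<alpha> \<beta> where "v \<in> homog wdeg \<alpha>" "a \<in> homog bideg (\<alpha>, \<beta>)" "z = bimon 1 v (sc c * a) - bimon c v a"
  | f v a \<alpha> \<beta> where "v \<in> homog wdeg \<alpha>" "a \<in> homog bideg (\<alpha>, \<beta>)" "z = bimon 1 v (Lf f * a) - bimon 1 (M f * v) a"
  using assms unfolding trels_def tensor_rels_def W_hom_eq F_hom_eq W_alg_eq F_alg_eq Rep_generators
  by (auto simp flip: plus_pres.rep_eq times_pres.rep_eq bimon_def)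

lemma trels_intros:
  assumes "v \<in> homog wdeg \<alpha>" "a \<in> homog bideg (\<alpha>, \<beta>)"
  shows "v' \<in> homog wdeg \<alpha> \<Longrightarrow> bimon 1 (v + v') a - bimon 1 v a - bimon 1 v' a \<in> trels"
    "a' \<in> homog bideg (\<alpha>, \<beta>) \<Longrightarrow> bimon 1 v (a + a') - bimon 1 v a - bimon 1 v a' \<in> trels"
    "bimon 1 v (sc c * a) - bimon c v a \<in> trels" "bimon 1 v (Lf f * a) - bimon 1 (M f * v) a \<in> trels"
proof -
  note u = trels_def tensor_rels_def W_hom_eq F_hom_eq W_alg_eq F_alg_eq Rep_generators bimon_def
    plus_pres.rep_eq times_pres.rep_eq
  note i = assms[THEN imageI, of Rep_pres]
  show "bimon 1 (v + v') a - bimon 1 v a - bimon 1 v' a \<in> trels" if "v' \<in> homog wdeg \<alpha>"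
    unfolding u using i imageI[OF that, of Rep_pres] by (intro UnI1) blast
  show "bimon 1 v (a + a') - bimon 1 v a - bimon 1 v a' \<in> trels" if "a' \<in> homog bideg (\<alpha>, \<beta>)"
    unfolding u using i imageI[OF that, of Rep_pres] by (intro UnI1[OF UnI1[OF UnI1[OF UnI2]]]) blast
  show "bimon 1 v (sc c * a) - bimon c v a \<in> trels"
    unfolding u using i by (intro UnI1[OF UnI2]) blast
  show "bimon 1 v (Lf f * a) - bimon 1 (M f * v) a \<in> trels"
    unfolding u using i by (intro UnI2) blast
qed

lemma homog_scalars:
  "M f \<in> homog wdeg 0" "Lf f \<in> homog bideg (0, 0)" "Rf f \<in> homog bideg (0, 0)"
  "sc c \<in> homog bideg (0, 0)"
  "w i \<in> homog wdeg (omega {i})" "T i j \<in> homog bideg (omega {i}, omega {j})"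
  using homog_gen[where deg=wdeg and g="FunW f"] homog_gen[where deg=bideg and g="FunL f"]
    homog_gen[where deg=bideg and g="FunR f"] homog_sc[of c bideg]
    homog_gen[where deg=wdeg and g="GenW i"] homog_gen[where deg=bideg and g="GenT i j"]
  by (simp_all add: bideg_def zero_prod_def)

lemma homog_scalar_mult:
  "v \<in> homog wdeg \<alpha> \<Longrightarrow> M f * v \<in> homog wdeg \<alpha>" "v \<in> homog wdeg \<alpha> \<Longrightarrow> sc c * v \<in> homog wdeg \<alpha>"
  "a \<in> homog bideg (\<alpha>, \<beta>) \<Longrightarrow> Lf f * a \<in> homog bideg (\<alpha>, \<beta>)"
  "a \<in> homog bideg (\<alpha>, \<beta>) \<Longrightarrow> Rf f * a \<in> homog bideg (\<alpha>, \<beta>)"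
  "a \<in> homog bideg (\<alpha>, \<beta>) \<Longrightarrow> sc c * a \<in> homog bideg (\<alpha>, \<beta>)"
  using homog_mult[OF homog_scalars(1)] homog_mult[OF homog_sc] homog_pair_mult[OF homog_scalars(2)]
    homog_pair_mult[OF homog_scalars(3)] homog_pair_mult[OF homog_scalars(4)]
  by (metis add_0)+

lemma trels_carrier: "trels \<subseteq> carrier MA"
proof
  fix z :: "'a W_elem \<times> 'a F_elem \<Rightarrow>\<^sub>0 complex" assume "z \<in> trels"
  then show "z \<in> carrier MA"
    by (cases rule: trels_cases) (auto intro!: MA_closed intro: bimon_in_carrier homog_add homog_scalar_mult)
qed

abbreviation NI :: "('n::{finite,linorder} W_elem \<times> 'n F_elem \<Rightarrow>\<^sub>0 complex) set" where
  "NI \<equiv> Idl\<^bsub>MA\<^esub> trels"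

lemma ideal_NI: "ideal NI MA"
  by (rule ring.genideal_ideal[OF ring_MA trels_carrier])

abbreviation WF :: "'n::{finite,linorder} WF_elem ring" where
  "WF \<equiv> WF_alg (generic_log TYPE('n))"

lemma WF_eq: "WF = MA Quot NI"
  by (simp add: WF_alg_def trels_def)

lemma ring_WF: "ring WF"
  unfolding WF_eq by (rule ideal.quotient_is_ring[OF ideal_NI])

typedef (overloaded) 'n wf = "carrier (WF :: 'n::{finite,linorder} WF_elem ring)"
  using ring.ring_simprules(2)[OF ring_WF] by blast

setup_lifting type_definition_wf

instantiation wf :: ("{finite,linorder}") "{ring, monoid_mult}"
begin
lift_definition zero_wf :: "'a wf" is "\<zero>\<^bsub>WF\<^esub>"
  by (rule ring.ring_simprules(2)[OF ring_WF])
lift_definition one_wf :: "'a wf" is "\<one>\<^bsub>WF\<^esub>"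
  by (rule ring.ring_simprules(6)[OF ring_WF])
lift_definition plus_wf :: "'a wf \<Rightarrow> 'a wf \<Rightarrow> 'a wf" is "\<lambda>x y. x \<oplus>\<^bsub>WF\<^esub> y"
  by (rule ring.ring_simprules(1)[OF ring_WF])
lift_definition times_wf :: "'a wf \<Rightarrow> 'a wf \<Rightarrow> 'a wf" is "\<lambda>x y. x \<otimes>\<^bsub>WF\<^esub> y"
  by (rule ring.ring_simprules(5)[OF ring_WF])
lift_definition uminus_wf :: "'a wf \<Rightarrow> 'a wf" is "\<lambda>x. \<ominus>\<^bsub>WF\<^esub> x"
  by (rule ring.ring_simprules(3)[OF ring_WF])
lift_definition minus_wf :: "'a wf \<Rightarrow> 'a wf \<Rightarrow> 'a wf" is "\<lambda>x y. x \<ominus>\<^bsub>WF\<^esub> y"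
  by (rule ring.ring_simprules(4)[OF ring_WF])
instance
proof
  note r = ring.ring_simprules[OF ring_WF]
  fix a b c :: "'a wf"
  show "a * b * c = a * (b * c)" by transfer (rule r(11))
  show "1 * a = a" by transfer (rule r(12))
  show "a * 1 = a" by transfer (simp add: Group.monoid.r_one[OF ring.is_monoid[OF ring_WF]])
  show "a + b + c = a + (b + c)" by transfer (rule r(7))
  show "a + b = b + a" by transfer (rule r(10))
  show "0 + a = a" by transfer (rule r(8))
  show "- a + a = 0" by transfer (rule r(9))
  show "a - b = a + - b" by transfer (simp add: a_minus_def)
  show "(a + b) * c = a * c + b * c" by transfer (rule r(13))
  show "a * (b + c) = a * b + a * c" by transfer (rule r(23))
qed
end

lemma Rep_wf_sum: "Rep_wf (sum f A) = finsum WF (\<lambda>x. Rep_wf (f x)) A"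
  if "finite A" for f :: "_ \<Rightarrow> 'n::{finite,linorder} wf"
  using that
proof (induction A)
  case empty
  then show ?case by (simp add: zero_wf.rep_eq abelian_monoid.finsum_empty[OF abelian_group.axioms(1)[OF ring.is_abelian_group[OF ring_WF]]])
next
  case (insert x A)
  then show ?case
    by (simp add: plus_wf.rep_eq)
       (rule abelian_monoid.finsum_insert[OF abelian_group.axioms(1)[OF ring.is_abelian_group[OF ring_WF]], symmetric];
        use Rep_wf in auto)
qed

definition mkT :: "('n::{finite,linorder} W_elem \<times> 'n F_elem \<Rightarrow>\<^sub>0 complex) \<Rightarrow> 'n wf" where
  "mkT p = Abs_wf (NI +>\<^bsub>MA\<^esub> p)"

lemma carrier_WF: "carrier WF = (\<lambda>p. NI +>\<^bsub>MA\<^esub> p) ` carrier MA"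
  by (auto simp: WF_eq FactRing_def A_RCOSETS_def RCOSETS_def a_r_coset_def)

lemma Rep_mkT: "p \<in> carrier MA \<Longrightarrow> Rep_wf (mkT p) = NI +>\<^bsub>MA\<^esub> p"
  by (simp add: mkT_def Abs_wf_inverse carrier_WF)

lemma mkT_surj: obtains p where "p \<in> carrier MA" "x = mkT p"
proof -
  obtain p where p: "p \<in> carrier MA" "Rep_wf x = NI +>\<^bsub>MA\<^esub> p"
    using Rep_wf[of x] unfolding carrier_WF by blast
  from p(2) have "x = mkT p" unfolding mkT_def by (simp flip: p(2) add: Rep_wf_inverse)
  with p(1) show ?thesis by (rule that)
qed

lemma mkT_add: "p \<in> carrier MA \<Longrightarrow> q \<in> carrier MA \<Longrightarrow> mkT (p + q) = mkT p + mkT q"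
  using ring_hom_add[OF ideal.rcos_ring_hom[OF ideal_NI], of p q]
  by (simp add: Rep_wf_inject[symmetric] plus_wf.rep_eq Rep_mkT MA_closed WF_eq MA_ops(2))

lemma mkT_mult: "p \<in> carrier MA \<Longrightarrow> q \<in> carrier MA \<Longrightarrow> mkT (p \<otimes>\<^bsub>MA\<^esub> q) = mkT p * mkT q"
  using ring_hom_mult[OF ideal.rcos_ring_hom[OF ideal_NI], of p q] ring.ring_simprules(5)[OF ring_MA, of p q]
  by (simp add: Rep_wf_inject[symmetric] times_wf.rep_eq Rep_mkT WF_eq)

lemma mkT_one: "mkT (bimon 1 1 1) = 1"
  using ring_hom_one[OF ideal.rcos_ring_hom[OF ideal_NI]]
  by (simp add: Rep_wf_inject[symmetric] one_wf.rep_eq Rep_mkT[OF bimon_in_carrier[OF homog_one]] WF_eq MA_ops(3))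

lemma mkT_eq_iff: "p \<in> carrier MA \<Longrightarrow> q \<in> carrier MA \<Longrightarrow> mkT p = mkT q \<longleftrightarrow> p - q \<in> NI"
  using ring.quotient_eq_iff_same_a_r_cos[OF ring_MA ideal_NI, of p q] monoid_algebra_minus[OF ring_MA, of p q]
  by (simp add: Rep_wf_inject[symmetric] Rep_mkT)

lemma mkT_eqI: "p \<in> carrier MA \<Longrightarrow> q \<in> carrier MA \<Longrightarrow> p - q \<in> trels \<Longrightarrow> mkT p = mkT q"
  using ring.genideal_self[OF ring_MA trels_carrier] mkT_eq_iff by blast

definition tens :: "'n::{finite,linorder} wgen pres \<Rightarrow> 'n fgen pres \<Rightarrow> 'n wf" where
  "tens v a = mkT (bimon 1 v a)"

lemma Rep_tens:
  assumes "v \<in> homog wdeg \<alpha>" "a \<in> homog bideg (\<alpha>, \<beta>)"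
  shows "Rep_wf (tens v a) = tensor (generic_log TYPE('n)) (Rep_pres v) (Rep_pres (a :: 'n::{finite,linorder} fgen pres))"
  using Rep_mkT[OF bimon_in_carrier[OF assms, of 1]] by (simp add: tens_def tensor_def bimon_def trels_def)

context
  fixes v :: "'n::{finite,linorder} wgen pres" and a :: "'n fgen pres" and \<alpha> \<beta>
  assumes va: "v \<in> homog wdeg \<alpha>" "a \<in> homog bideg (\<alpha>, \<beta>)"
begin

lemma tens_add_left: "v' \<in> homog wdeg \<alpha> \<Longrightarrow> tens (v + v') a = tens v a + tens v' a"
  using va mkT_eqI[of "bimon 1 (v + v') a" "bimon 1 v a + bimon 1 v' a"] trels_intros(1)[OF va, of v']
  by (simp add: tens_def mkT_add[symmetric] bimon_in_carrier[where \<alpha>=\<alpha> and \<beta>=\<beta>] MA_closed homog_add diff_diff_eq)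

lemma tens_add_right: "a' \<in> homog bideg (\<alpha>, \<beta>) \<Longrightarrow> tens v (a + a') = tens v a + tens v a'"
  using va mkT_eqI[of "bimon 1 v (a + a')" "bimon 1 v a + bimon 1 v a'"] trels_intros(2)[OF va, of a']
  by (simp add: tens_def mkT_add[symmetric] bimon_in_carrier[where \<alpha>=\<alpha> and \<beta>=\<beta>] MA_closed homog_add diff_diff_eq)

lemma tens_balance: "tens v (Lf f * a) = tens (M f * v) a"
  unfolding tens_def using va trels_intros(4)[OF va, of f]
  by (intro mkT_eqI) (auto intro!: bimon_in_carrier[where \<alpha>=\<alpha> and \<beta>=\<beta>] homog_scalar_mult)

lemma tens_sc: "tens v (sc c * a) = mkT (bimon c v a)"
  unfolding tens_def using va trels_intros(3)[OF va, of c]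
  by (intro mkT_eqI) (auto intro!: bimon_in_carrier[where \<alpha>=\<alpha> and \<beta>=\<beta>] homog_scalar_mult)

lemma tens_mult: "v' \<in> homog wdeg \<alpha>' \<Longrightarrow> a' \<in> homog bideg (\<alpha>', \<beta>') \<Longrightarrow> tens v a * tens v' a' = tens (v * v') (a * a')"
  unfolding tens_def using va
  by (simp add: mkT_mult[symmetric] bimon_in_carrier[where \<alpha>=\<alpha> and \<beta>=\<beta>] bimon_in_carrier[where \<alpha>=\<alpha>' and \<beta>=\<beta>'] bimon_mult)

end

lemma tens_one: "tens 1 1 = 1"
  by (simp add: tens_def mkT_one)

lemma tens_zero_right:
  assumes "v \<in> homog wdeg \<alpha>" shows "tens v 0 = 0"
  using tens_add_right[OF assms homog_0[of bideg "(\<alpha>, 0)"] homog_0] by simp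

lemma tens_zero_left:
  assumes "a \<in> homog bideg (\<alpha>, \<beta>)" shows "tens 0 a = 0"
  using tens_add_left[OF homog_0[of wdeg \<alpha>] assms homog_0] by simp

lemma tens_sum_right:
  assumes "v \<in> homog wdeg \<alpha>" "\<And>i. i \<in> A \<Longrightarrow> f i \<in> homog bideg (\<alpha>, \<beta>)"
  shows "tens v (sum f A) = (\<Sum>i\<in>A. tens v (f i))"
  using assms(2)
proof (induction A rule: infinite_finite_induct)
  case (insert i A)
  then show ?case using tens_add_right[OF assms(1), of "f i" \<beta> "sum f A"] by (simp add: homog_sum)
qed (simp_all add: tens_zero_right[OF assms(1)])

definition scT :: "complex \<Rightarrow> 'n::{finite,linorder} wf" where "scT c = tens 1 (sc c)"

lemma scT_eq: "scT c = mkT (bimon c 1 1)"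
  using tens_sc[OF homog_one] by (simp add: scT_def)

lemma scT_commute: "scT c * z = z * (scT c :: 'n::{finite,linorder} wf)"
proof -
  obtain p where p: "p \<in> carrier MA" "z = mkT p" by (rule mkT_surj)
  have c: "bimon c 1 1 \<in> carrier (MA :: ('n W_elem \<times> 'n F_elem \<Rightarrow>\<^sub>0 complex) ring)" by (rule bimon_in_carrier[OF homog_one])
  have "bimon c 1 1 \<otimes>\<^bsub>MA\<^esub> p = p \<otimes>\<^bsub>MA\<^esub> bimon c 1 1"
    using p(1) by (induction rule: MA_induct)
      (simp_all add: monoid_algebra_mult_zero monoid_algebra_mult_add bimon_mult mult.commute)
  then show ?thesis unfolding p scT_eq using mkT_mult[OF c p(1)] mkT_mult[OF p(1) c] by simp
qed

subsection \<open>The coaction\<close>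

lemma omega_insert: "i \<notin> K \<Longrightarrow> omega (insert i K) = omega {i} + omega K"
  by (simp add: omega_def)

lemma homog_wset: "wset K \<in> homog wdeg (omega K)"
proof (induction K rule: F.min_induct)
  case empty
  show ?case using homog_one by (simp add: omega_def)
next
  case (insert j K)
  have "j \<notin> K" using insert(1) by blast
  then show ?case using homog_mult[OF homog_scalars(5)[of j] insert(2)] by (simp add: wset_insert[OF insert(1)] omega_insert[of j K])
qed

text \<open>The left weight \<open>omega K\<close> is the one for which \<open>wset K\<close> and
  \<open>\<phi> K\<close> form a homogeneous pair of the tensor product.\<close>

definition coords :: "(complex, 'n) vec \<Rightarrow> ('n::{finite,linorder} set \<Rightarrow> 'n fgen pres) set" where
  "coords \<beta> = {\<phi>. \<forall>K. \<phi> K \<in> homog bideg (omega K, \<beta>)}"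

definition from_coords :: "('n::{finite,linorder} set \<Rightarrow> 'n fgen pres) \<Rightarrow> 'n wf" where
  "from_coords \<phi> = (\<Sum>K\<in>UNIV. tens (wset K) (\<phi> K))"

definition coact_gen :: "'n::{finite,linorder} \<Rightarrow> 'n wf" where
  "coact_gen i = (\<Sum>j\<in>UNIV. tens (w j) (T j i))"

lemma coords_vac: "F.vac \<in> coords 0"
  using homog_one by (simp add: coords_def F.vac_def omega_def)

lemma from_coords_vac: "from_coords F.vac = 1"
proof -
  have "from_coords F.vac = (\<Sum>K\<in>{{}}. tens (wset K) (F.vac K))"
    unfolding from_coords_def using homog_wset tens_zero_right
    by (intro sum.mono_neutral_right) (auto simp: F.vac_def)
  then show ?thesis by (simp add: F.vac_def tens_one)
qed

lemma homog_col_summand: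
  assumes "\<phi> \<in> coords \<beta>" "a \<in> L"
  shows "Lf f * T a i * \<phi> (L - {a}) \<in> homog bideg (omega L, omega {i} + \<beta>)"
proof -
  have "\<phi> (L - {a}) \<in> homog bideg (omega (L - {a}), \<beta>)" using assms by (simp add: coords_def)
  from homog_pair_mult[OF homog_scalar_mult(3)[OF homog_scalars(6)] this, of f a i] show ?thesis
    using omega_insert[of a "L - {a}"] assms(2) by (simp add: insert_absorb)
qed

lemma coords_col: "\<phi> \<in> coords \<beta> \<Longrightarrow> F.col i \<phi> \<in> coords (omega {i} + \<beta>)"
  unfolding coords_def[of "omega {i} + \<beta>"] F.col_def by (auto intro!: homog_sum homog_col_summand)

lemma coords_scalar: "\<phi> \<in> coords \<beta> \<Longrightarrow> (\<lambda>L. Rf f * \<phi> L) \<in> coords \<beta>"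
  by (simp add: coords_def homog_scalar_mult)

text \<open>The products of w_j with w_K vanish or are signs times w_L for L = K with j added.
  Balancing carries the sign to the second factor, and collecting the terms with the same L gives
  \<open>col\<close>.\<close>

lemma coact_gen_from_coords:
  assumes "\<phi> \<in> coords \<beta>" shows "coact_gen i * from_coords \<phi> = from_coords (F.col i \<phi>)"
proof -
  have \<phi>: "\<phi> K \<in> homog bideg (omega K, \<beta>)" for K using assms by (simp add: coords_def)
  have "coact_gen i * from_coords \<phi> = (\<Sum>j\<in>UNIV. \<Sum>K\<in>UNIV. tens (w j * wset K) (T j i * \<phi> K))"
    unfolding coact_gen_def from_coords_def sum_product
    by (intro sum.cong refl tens_mult[OF homog_scalars(5,6) homog_wset \<phi>])
  also have "\<dots> = (\<Sum>j\<in>UNIV. \<Sum>K\<in>{K. j \<notin> K}. tens (wset (insert j K)) (Lf (F.sgn1 j K) * T j i * \<phi> K))"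
  proof (rule sum.cong[OF refl])
    fix j
    have T: "T j i * \<phi> K \<in> homog bideg (omega (insert j K), omega {i} + \<beta>)" if "j \<notin> K" for K
      using homog_pair_mult[OF homog_scalars(6) \<phi>] omega_insert[OF that] by simp
    have z: "tens 0 (T j i * \<phi> K) = 0" for K
      using homog_pair_mult[OF homog_scalars(6)[of j i] \<phi>[of K]] by (rule tens_zero_left)
    have "(\<Sum>K\<in>UNIV. tens (w j * wset K) (T j i * \<phi> K)) = (\<Sum>K\<in>{K. j \<notin> K}. tens (w j * wset K) (T j i * \<phi> K))"
      by (rule sum.mono_neutral_right) (auto simp: W.op_ops z)
    also have "\<dots> = (\<Sum>K\<in>{K. j \<notin> K}. tens (wset (insert j K)) (Lf (F.sgn1 j K) * T j i * \<phi> K))"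
      by (intro sum.cong refl) (simp add: W.op_ops tens_balance[OF homog_wset T, symmetric] mult.assoc)
    finally show "(\<Sum>K\<in>UNIV. tens (w j * wset K) (T j i * \<phi> K)) =
        (\<Sum>K\<in>{K. j \<notin> K}. tens (wset (insert j K)) (Lf (F.sgn1 j K) * T j i * \<phi> K))" .
  qed
  also have "\<dots> = (\<Sum>L\<in>UNIV. \<Sum>j\<in>L. tens (wset L) (Lf (F.sgn1 j (L - {j})) * T j i * \<phi> (L - {j})))"
    by (subst (1 2) sum.Sigma; simp?)
       (rule sum.reindex_bij_witness[of _ "\<lambda>(L, j). (j, L - {j})" "\<lambda>(j, K). (insert j K, j)"]; auto)
  also have "\<dots> = from_coords (F.col i \<phi>)"
    unfolding from_coords_def F.col_def
    by (rule sum.cong[OF refl], rule tens_sum_right[OF homog_wset, symmetric], rule homog_col_summand[OF assms])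
  finally show ?thesis .
qed

lemma scalar_from_coords:
  assumes "\<phi> \<in> coords \<beta>" shows "tens 1 (Rf f) * from_coords \<phi> = from_coords (\<lambda>L. Rf f * \<phi> L)"
proof -
  have \<phi>: "\<phi> K \<in> homog bideg (omega K, \<beta>)" for K using assms by (simp add: coords_def)
  show ?thesis unfolding from_coords_def sum_distrib_left
    using tens_mult[OF homog_one(1) homog_scalars(3) homog_wset \<phi>] by simp
qed

fun coact_op :: "'n::{finite,linorder} wgen \<Rightarrow> 'n wf \<Rightarrow> 'n wf" where
  "coact_op (GenW i) z = coact_gen i * z" | "coact_op (FunW f) z = tens 1 (Rf f) * z"

fun coord_op :: "'n::{finite,linorder} wgen \<Rightarrow> ('n set \<Rightarrow> 'n fgen pres) \<Rightarrow> 'n set \<Rightarrow> 'n fgen pres" where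
  "coord_op (GenW i) \<phi> = F.col i \<phi>" | "coord_op (FunW f) \<phi> = (\<lambda>L. Rf f * \<phi> L)"

lemma scT_hom: "scT (c + d) = scT c + scT d" "scT (c * d) = scT c * scT d" "scT 1 = 1"
  by (simp_all add: scT_def sc_add sc_mult tens_one tens_add_right[OF homog_one(1) homog_scalars(4) homog_scalars(4)]
      tens_mult[OF homog_one(1) homog_scalars(4) homog_one(1) homog_scalars(4)])

lemma tens_Rf:
  "tens 1 (Rf (f + g)) = tens 1 (Rf f) + tens 1 (Rf g)"
  "tens 1 (Rf (f * g)) = tens 1 (Rf f) * tens 1 (Rf g)"
  "tens 1 (Rf (const_mero c)) = scT c"
  by (simp_all add: F_scalars(2,4,6) scT_def tens_add_right[OF homog_one(1) homog_scalars(3) homog_scalars(3)]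
      tens_mult[OF homog_one(1) homog_scalars(3) homog_one(1) homog_scalars(3)])

lemma coact_op_mult: "coact_op g z = coact_op g 1 * z"
  by (cases g) simp_all

lemma foldr_coact_op: "foldr coact_op xs z = foldr coact_op xs 1 * z"
  by (induction xs) (simp, metis coact_op_mult foldr_Cons comp_apply mult.assoc)

text \<open>Not every element of the tensor product is given by homogeneous coordinates, but the
  images of 1 under words are. As all \<open>coact_op\<close> are left multiplications, an identity
  between words holds everywhere once it holds on 1, where it follows from the identity for
  coordinates.\<close>

lemma foldr_coord_op:
  "\<exists>\<beta>. foldr coord_op xs F.vac \<in> coords \<beta> \<and> foldr coact_op xs 1 = from_coords (foldr coord_op xs F.vac)"
proof (induction xs)
  case Nil
  show ?case using coords_vac from_coords_vac by auto
next
  case (Cons g xs)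
  then obtain \<beta> where *: "foldr coord_op xs F.vac \<in> coords \<beta>"
    "foldr coact_op xs 1 = from_coords (foldr coord_op xs F.vac)" by blast
  show ?case
  proof (cases g)
    case (GenW i)
    then show ?thesis using *(2) coact_gen_from_coords[OF *(1)] coords_col[OF *(1)] by auto
  next
    case (FunW f)
    then show ?thesis using *(2) scalar_from_coords[OF *(1)] coords_scalar[OF *(1)]
      by (intro exI[of _ \<beta>]) simp
  qed
qed

interpretation C: word_module "coact_op :: 'n::{finite,linorder} wgen \<Rightarrow> _" "\<lambda>c z. scT c * z"
proof
  fix g :: "'n wgen" and c d :: complex and z z' :: "'n wf"
  show "coact_op g (z + z') = coact_op g z + coact_op g z'" by (cases g) (simp_all add: distrib_left)
  show "coact_op g (scT c * z) = scT c * coact_op g z"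
    by (cases g) (simp_all add: scT_commute mult.assoc flip: scT_commute[of _ "_ * _"])
qed (simp_all add: scT_hom algebra_simps)

text \<open>This is the existence of the coaction: the exterior relations, known for the columns,
  let the exterior algebra act on the tensor product.\<close>

interpretation C: presented_module "coact_op :: 'n::{finite,linorder} wgen \<Rightarrow> _" "\<lambda>c z. scT c * z"
proof
  fix p :: "'n wgen list \<Rightarrow>\<^sub>0 complex" and z :: "'n wf"
  have words: "foldr coact_op xs z = foldr coact_op ys z"
    if "foldr coord_op xs F.vac = foldr coord_op ys F.vac" for xs ys :: "'n wgen list"
    using foldr_coord_op[of xs] foldr_coord_op[of ys] that foldr_coact_op[of xs z] foldr_coact_op[of ys z] by metis
  \<comment> \<open>The right hand side 0 is not a word, so this relation is read off from the
    coordinates directly.\<close>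
  have square: "coact_op (GenW i) (coact_op (GenW i) z) = 0" for i
  proof -
    have "foldr coact_op [GenW i, GenW i] 1 = from_coords (foldr coord_op [GenW i, GenW i] F.vac)"
      using foldr_coord_op by metis
    also have "\<dots> = 0"
      by (simp add: F.op_square from_coords_def tens_zero_right[OF homog_wset])
    finally show ?thesis using foldr_coact_op[of "[GenW i, GenW i]" z] by simp
  qed
  have swap: "coact_op (GenW j) (coact_op (GenW i) z) = coact_op (FunW (- H0 j i)) (coact_op (GenW i) (coact_op (GenW j) z))"
    if "i < j" for i j
    using words[of "[GenW j, GenW i]" "[FunW (- H0 j i), GenW i, GenW j]"] F.op_swap[OF that] by simp
  have comm: "coact_op (FunW f) (coact_op (GenW i) z) = coact_op (GenW i) (coact_op (FunW (sh i f)) z)" for f i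
    using words[of "[FunW f, GenW i]" "[GenW i, FunW (sh i f)]"] F.act_op[of i f] by simp
  show "p \<in> relations \<Longrightarrow> C.ev p z = 0"
    unfolding relations_wgen_def W_rels_def
    by (auto simp: C.ev_minus C.ev_single scT_hom square swap[unfolded H_def] comm simp del: coact_op.simps)
       (simp_all add: tens_Rf algebra_simps)
qed

text \<open>The action is by left multiplication with R(x), so applying it to 1 recovers
  R(x).\<close>

definition coact :: "'n::{finite,linorder} wgen pres \<Rightarrow> 'n wf" where "coact x = C.action x 1"

lemma coact_add: "coact (x + y) = coact x + coact y"
  by (simp add: coact_def C.action_add)

lemma coact_one: "coact 1 = 1"
  by (simp add: coact_def)

lemma coact_w: "coact (w i) = coact_gen i"
  by (simp add: coact_def C.action_gen)

lemma action_eq_coact_mult: "C.action x z = coact x * z"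
  unfolding coact_def
proof (induction x rule: pres_induct)
  case (add x y)
  then show ?case by (simp add: C.action_add distrib_right)
next
  case (monom c xs)
  show ?case using foldr_coact_op[of xs z]
    by (simp add: C.action_mult C.action_sc C.action_prod_list mult.assoc)
qed

lemma coact_mult: "coact (x * y) = coact x * coact y"
  unfolding coact_def[of "x * y"] C.action_mult by (simp add: action_eq_coact_mult)

lemma coact_M: "coact (M f * x) = tens 1 (Rf f) * coact x"
  by (simp add: coact_def C.action_mult C.action_gen)

text \<open>Here the column operators meet the definition of the minors: the coordinate of R(w_J) at
  \<open>K\<close> is \<open>F.minor K J\<close>.\<close>

lemma coact_wset: "coact (wset J) = from_coords (F.ops J F.vac)" "F.ops J F.vac \<in> coords (omega J)"
proof -
  have "coact (wset J) = from_coords (F.ops J F.vac) \<and> F.ops J F.vac \<in> coords (omega J)"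
  proof (induction J rule: F.min_induct)
    case empty
    show ?case using coords_vac from_coords_vac by (simp add: coact_one omega_def)
  next
    case (insert j K)
    have "j \<notin> K" using insert(1) by blast
    then show ?case
      using insert(2) coact_gen_from_coords[of "F.ops K F.vac" "omega K" j] coords_col[of "F.ops K F.vac" "omega K" j]
        omega_insert[of j K]
      by (simp add: wset_insert[OF insert(1)] F.ops_insert[OF insert(1)] coact_mult coact_w)
  qed
  then show "coact (wset J) = from_coords (F.ops J F.vac)" "F.ops J F.vac \<in> coords (omega J)" by blast+
qed

lemma coact_unique:
  assumes add: "\<And>x y. \<sigma> (x + y) = \<sigma> x + \<sigma> y" and mult: "\<And>x y. \<sigma> (x * y) = \<sigma> x * \<sigma> y" and one: "\<sigma> 1 = 1"
    and w: "\<And>i. \<sigma> (w i) = coact_gen i" and M: "\<And>f x. \<sigma> (M f * x) = tens 1 (Rf f) * \<sigma> x"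
  shows "\<sigma> x = coact x"
proof (induction x rule: pres_induct)
  case (monom c xs)
  have "\<sigma> (prod_list (map gen xs)) = coact (prod_list (map gen xs))"
  proof (induction xs)
    case (Cons g xs)
    show ?case
    proof (cases g)
      case (GenW i)
      then show ?thesis by (simp add: Cons mult w coact_mult coact_w)
    next
      case (FunW f)
      then show ?thesis by (simp add: Cons M coact_M)
    qed
  qed (simp add: one coact_one)
  \<comment> \<open>Compatibility with complex scalars comes from the condition on \<open>M\<close>,
    because \<open>sc c\<close> equals \<open>M (const_mero c)\<close>.\<close>
  then show ?case by (simp add: M coact_M flip: W_relations(3))
qed (simp add: add coact_add)

section \<open>Uniqueness of coordinates in the tensor product\<close>

text \<open>The coefficient functional of w_L, which sends v \<otimes> a to mu_l of the coefficient
  of w_L in v, times a. It is defined on formal combinations of pairs, before passing to the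
  quotient.\<close>

definition coord :: "'n::{finite,linorder} set \<Rightarrow> ('n W_elem \<times> 'n F_elem \<Rightarrow>\<^sub>0 complex) \<Rightarrow> 'n fgen pres" where
  "coord L p = (\<Sum>x\<in>Poly_Mapping.keys p. sc (Poly_Mapping.lookup p x) *
     (Lf (wcoeff L (Abs_pres (fst x))) * Abs_pres (snd x)))"

lemma coord_superset:
  assumes "finite A" "Poly_Mapping.keys p \<subseteq> A"
  shows "coord L p = (\<Sum>x\<in>A. sc (Poly_Mapping.lookup p x) * (Lf (wcoeff L (Abs_pres (fst x))) * Abs_pres (snd x)))"
  unfolding coord_def using assms by (intro sum.mono_neutral_left) (auto simp: in_keys_iff)

lemma coord_add: "coord L (p + q) = coord L p + coord L q"
  using keys_add[of p q]
  by (simp add: coord_superset[of "Poly_Mapping.keys p \<union> Poly_Mapping.keys q"] lookup_add sc_add sum.distrib distrib_right)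

lemma coord_0 [simp]: "coord L 0 = 0" by (simp add: coord_def)

lemma coord_diff: "coord L (p - q) = coord L p - coord L q"
  using coord_add[of L "p - q" q] by simp

lemma coord_sum: "coord L (sum f A) = (\<Sum>i\<in>A. coord L (f i))"
  by (induction A rule: infinite_finite_induct) (simp_all add: coord_add)

lemma coord_bimon: "coord L (bimon c v a) = sc c * (Lf (wcoeff L v) * a)"
  by (subst coord_superset[of "{(Rep_pres v, Rep_pres a)}"]) (auto simp: bimon_def Rep_pres_inverse)

text \<open>The factors on both sides are there because the relations generate a two-sided ideal. In
  the balancing case the scalar has to pass \<open>v1\<close> and \<open>a1\<close>, and the
  matching weight \<open>\<alpha>1\<close> gives it the same shift in both.\<close>

lemma coord_trels:
  assumes z: "z \<in> trels" and 1: "v1 \<in> homog wdeg \<alpha>1" "a1 \<in> homog bideg (\<alpha>1, \<beta>1)"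
  shows "coord L (bimon c v1 a1 \<otimes>\<^bsub>MA\<^esub> z \<otimes>\<^bsub>MA\<^esub> bimon d v2 a2) = 0"
proof -
  have ss: "sc (c * 1 * d) * (sc e * x) = sc (c * e * d) * x" for e and x :: "'a fgen pres"
  proof -
    have "c * e * d = c * 1 * d * e" by simp
    then show ?thesis by (simp only: sc_mult mult.assoc)
  qed
  from z show ?thesis
  proof (cases rule: trels_cases)
    case (left v v' a \<alpha> \<beta>)
    show ?thesis unfolding left(4)
      by (simp add: monoid_algebra_mult_diff bimon_mult coord_diff coord_bimon wcoeff_add F_scalars(1) distrib_left distrib_right)
  next
    case (right v a a' \<alpha> \<beta>)
    show ?thesis unfolding right(4)
      by (simp add: monoid_algebra_mult_diff bimon_mult coord_diff coord_bimon distrib_left distrib_right)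
  next
    case (scalar_left e v a \<alpha> \<beta>)
    have "v1 * (sc e * v) * v2 = sc e * (v1 * v * v2)"
      using arg_cong[OF sc_commute[of e v1], of "\<lambda>x. x * v * v2"] by (simp only: mult.assoc)
    moreover have "Lf (wcoeff L (sc e * u)) * x = sc e * (Lf (wcoeff L u) * x)" for u x
      by (simp only: wcoeff_sc F_scalars(3,5) mult.assoc)
    ultimately show ?thesis unfolding scalar_left(3)
      by (simp only: monoid_algebra_mult_diff bimon_mult coord_diff coord_bimon ss diff_self)
  next
    case (scalar_right e v a \<alpha> \<beta>)
    have "Lf g * (a1 * (sc e * a) * a2) = sc e * (Lf g * (a1 * a * a2))" for g
      using arg_cong[OF sc_commute[of e "Lf g * a1"], of "\<lambda>x. x * a * a2"] by (simp only: mult.assoc)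
    then show ?thesis unfolding scalar_right(3)
      by (simp only: monoid_algebra_mult_diff bimon_mult coord_diff coord_bimon ss diff_self)
  next
    case (balance f v a \<alpha> \<beta>)
    have "v1 * (M f * v) * v2 = M (shift (- \<alpha>1) f) * (v1 * v * v2)"
      using homog_commute_M[OF 1(1), of f] by (metis mult.assoc)
    moreover have "a1 * (Lf f * a) * a2 = Lf (shift (- \<alpha>1) f) * (a1 * a * a2)"
      using homog_commute_L[OF 1(2), of f] by (metis mult.assoc)
    moreover have "Lf (shift (- \<alpha>1) f * g) * x = Lf g * (Lf (shift (- \<alpha>1) f) * x)" for g x
      by (simp add: mult.commute F_scalars(3) mult.assoc)
    ultimately show ?thesis using balance
      by (simp add: monoid_algebra_mult_diff bimon_mult coord_diff coord_bimon wcoeff_M)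
  qed
qed

text \<open>The functional is not multiplicative, and its kernel is not visibly an ideal. The ideal
  \<open>J\<close> consists of the elements that it kills even after multiplication from both
  sides.\<close>

lemma coord_NI:
  assumes "z \<in> NI" shows "coord L z = 0"
proof -
  interpret ring MA by (rule ring_MA)
  define J where "J = {z \<in> carrier MA. \<forall>p\<in>carrier MA. \<forall>q\<in>carrier MA. coord L (p \<otimes>\<^bsub>MA\<^esub> z \<otimes>\<^bsub>MA\<^esub> q) = 0}"
  have "NI \<subseteq> J"
  proof (rule Idl_monoid_algebra_subset[OF ring_MA])
    show "trels \<subseteq> J"
    proof
      fix z :: "'a W_elem \<times> 'a F_elem \<Rightarrow>\<^sub>0 complex" assume z: "z \<in> trels"
      have "coord L (p \<otimes>\<^bsub>MA\<^esub> z \<otimes>\<^bsub>MA\<^esub> q) = 0" if "p \<in> carrier MA" "q \<in> carrier MA" for p q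
        using that(1)
      proof (induction rule: MA_induct)
        case (bimon c v a \<alpha> \<beta>)
        from that(2) show ?case
          by (induction rule: MA_induct)
             (simp_all add: monoid_algebra_mult_zero monoid_algebra_mult_add coord_add coord_trels[OF z bimon])
      qed (simp_all add: monoid_algebra_mult_zero monoid_algebra_mult_add coord_add)
      then show "z \<in> J" using z trels_carrier by (auto simp: J_def)
    qed
    have neg: "p \<otimes>\<^bsub>MA\<^esub> - q = - (p \<otimes>\<^bsub>MA\<^esub> q)" "- p \<otimes>\<^bsub>MA\<^esub> q = - (p \<otimes>\<^bsub>MA\<^esub> q)"
      "coord L (- p) = - coord L p" for p q :: "'a W_elem \<times> 'a F_elem \<Rightarrow>\<^sub>0 complex"
      by (metis diff_0 monoid_algebra_mult_diff(2) monoid_algebra_mult_zero(2),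
          metis diff_0 monoid_algebra_mult_diff(1) monoid_algebra_mult_zero(1), metis diff_0 coord_diff coord_0)
    show "- p \<in> J" if "p \<in> J" for p
      using that by (auto simp: J_def neg MA_ops(4))
    show "J \<subseteq> carrier MA" "0 \<in> J" by (auto simp: J_def monoid_algebra_mult_zero MA_ops(4))
    show "p + q \<in> J" if "p \<in> J" "q \<in> J" for p q
      using that by (simp add: J_def monoid_algebra_mult_add coord_add MA_closed)
    show "q \<otimes>\<^bsub>MA\<^esub> p \<in> J" "p \<otimes>\<^bsub>MA\<^esub> q \<in> J" if pq: "p \<in> J" "q \<in> carrier MA" for p q
    proof -
      have p: "p \<in> carrier MA" "\<And>a b. a \<in> carrier MA \<Longrightarrow> b \<in> carrier MA \<Longrightarrow> coord L (a \<otimes>\<^bsub>MA\<^esub> p \<otimes>\<^bsub>MA\<^esub> b) = 0"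
        using pq(1) unfolding J_def by blast+
      have "a \<otimes>\<^bsub>MA\<^esub> (q \<otimes>\<^bsub>MA\<^esub> p) \<otimes>\<^bsub>MA\<^esub> b = (a \<otimes>\<^bsub>MA\<^esub> q) \<otimes>\<^bsub>MA\<^esub> p \<otimes>\<^bsub>MA\<^esub> b"
        "a \<otimes>\<^bsub>MA\<^esub> (p \<otimes>\<^bsub>MA\<^esub> q) \<otimes>\<^bsub>MA\<^esub> b = a \<otimes>\<^bsub>MA\<^esub> p \<otimes>\<^bsub>MA\<^esub> (q \<otimes>\<^bsub>MA\<^esub> b)"
        if "a \<in> carrier MA" "b \<in> carrier MA" for a b
        using that p(1) pq(2) by (simp_all add: m_assoc)
      then show "q \<otimes>\<^bsub>MA\<^esub> p \<in> J" "p \<otimes>\<^bsub>MA\<^esub> q \<in> J"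
        unfolding J_def using p pq(2) by auto
    qed
  qed
  then have "coord L (\<one>\<^bsub>MA\<^esub> \<otimes>\<^bsub>MA\<^esub> z \<otimes>\<^bsub>MA\<^esub> \<one>\<^bsub>MA\<^esub>) = 0" "z \<in> carrier MA"
    using assms unfolding J_def by blast+
  then show ?thesis by simp
qed

text \<open>Applying \<open>coord L\<close> to the combination of the \<open>wset K\<close> returns
  the entry at \<open>L\<close>, and it does not depend on the representative. This is what makes
  the minors well defined.\<close>

lemma from_coords_inject:
  assumes "\<phi> \<in> coords \<beta>" "\<psi> \<in> coords \<gamma>" "from_coords \<phi> = from_coords \<psi>"
  shows "\<phi> = \<psi>"
proof -
  define P where "P \<phi> = (\<Sum>K\<in>UNIV. bimon 1 (wset K) (\<phi> K))" for \<phi> :: "'a set \<Rightarrow> 'a fgen pres"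
  have P: "P \<phi> \<in> carrier MA \<and> mkT (P \<phi>) = from_coords \<phi>" if "\<phi> \<in> coords \<beta>" for \<phi> \<beta>
  proof -
    have m: "bimon 1 (wset K) (\<phi> K) \<in> carrier MA" for K
      by (rule bimon_in_carrier[OF homog_wset, where \<beta>=\<beta>]) (use that in \<open>simp add: coords_def\<close>)
    have z: "0 \<in> carrier MA" by (simp add: MA_ops)
    have mz: "mkT 0 = 0" using mkT_add[OF z z] by simp
    have "sum f A \<in> carrier MA \<and> mkT (sum f A) = (\<Sum>K\<in>A. mkT (f K))"
      if "\<And>K. f K \<in> carrier MA" for f and A :: "'a set set"
      by (induction A rule: infinite_finite_induct) (simp_all add: z mz that MA_closed mkT_add)
    from this[of "\<lambda>K. bimon 1 (wset K) (\<phi> K)"] m show ?thesis by (simp add: P_def from_coords_def tens_def)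
  qed
  have "P \<phi> - P \<psi> \<in> NI" using P[OF assms(1)] P[OF assms(2)] assms(3) mkT_eq_iff by metis
  then have "coord L (P \<phi>) = coord L (P \<psi>)" for L using coord_NI[of _ L] coord_diff[of L] by fastforce
  moreover have "coord L (P \<phi>) = \<phi> L" for L \<phi>
  proof -
    have "coord L (P \<phi>) = (\<Sum>K\<in>UNIV. if K = L then \<phi> L else 0)"
      unfolding P_def coord_sum by (intro sum.cong refl) (auto simp: coord_bimon wcoeff_wset F_one F_zero)
    then show ?thesis by simp
  qed
  ultimately show ?thesis by auto
qed

subsection \<open>Identification of the quantum minors\<close>

lemma enum_eq: "F.enum K = sorted_list_of_set K"
  using F.enum_eqI[of "sorted_list_of_set K"] by simp

lemma Rep_wset: "w_set (generic_log TYPE('n)) K = Rep_pres (wset K)" for K :: "'n::{finite,linorder} set"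
proof -
  have "foldr (\<lambda>i x. w_gen (generic_log TYPE('n)) i \<otimes>\<^bsub>W_alg (generic_log TYPE('n))\<^esub> x) xs \<one>\<^bsub>W_alg (generic_log TYPE('n))\<^esub>
      = Rep_pres (foldr (\<lambda>i v. w i * v) xs 1)" for xs :: "'n list"
    by (induction xs) (simp_all add: W_alg_eq one_pres.rep_eq times_pres.rep_eq Rep_generators)
  then show ?thesis unfolding w_set_def W.ops_def enum_eq .
qed

lemma Rep_coact_gen:
  "Rep_wf (coact_gen i) = (\<Oplus>\<^bsub>WF\<^esub>j\<in>UNIV. tensor (generic_log TYPE('n)) (w_gen (generic_log TYPE('n)) j) (t_gen (generic_log TYPE('n)) j i))"
  for i :: "'n::{finite,linorder}"
  by (simp add: coact_gen_def Rep_wf_sum Rep_tens[OF homog_scalars(5,6)] Rep_generators)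

lemma coaction_Rep: "coaction (generic_log TYPE('n)) (Rep_pres x) = Rep_wf (coact x)"
  for x :: "'n::{finite,linorder} wgen pres"
proof -
  let ?c = "generic_log TYPE('n)"
  let ?W = "W_alg ?c :: 'n W_elem ring"
  define \<rho> where "\<rho> = restrict (\<lambda>x. Rep_wf (coact (Abs_pres x))) (carrier ?W)"
  have W: "carrier ?W = range Rep_pres"
    unfolding W_alg_eq by (metis type_definition.Rep_range type_definition_pres)
  have \<rho>: "\<rho> (Rep_pres x) = Rep_wf (coact x)" for x by (simp add: \<rho>_def W Rep_pres_inverse)
  have ops: "Rep_pres x \<otimes>\<^bsub>?W\<^esub> Rep_pres y = Rep_pres (x * y)" "Rep_pres x \<oplus>\<^bsub>?W\<^esub> Rep_pres y = Rep_pres (x + y)"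
    "\<one>\<^bsub>?W\<^esub> = Rep_pres 1" for x y :: "'n wgen pres"
    by (simp_all add: W_alg_eq times_pres.rep_eq plus_pres.rep_eq one_pres.rep_eq)
  have t: "tensor ?c \<one>\<^bsub>?W\<^esub> (mu_r ?c f) = Rep_wf (tens 1 (Rf f))" for f :: "'n mero"
    by (simp add: ops Rep_generators Rep_tens[OF homog_one(1) homog_scalars(3)])
  have "coaction ?c = \<rho>"
    unfolding coaction_def
  proof (rule the_equality)
    have "\<rho> \<in> ring_hom ?W WF"
      by (rule ring_hom_memI)
         (auto simp: W ops \<rho> coact_mult coact_add coact_one times_wf.rep_eq plus_wf.rep_eq one_wf.rep_eq
           intro: Rep_wf)
    moreover have "\<rho> \<in> extensional (carrier ?W)" by (simp add: \<rho>_def)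
    ultimately show "\<rho> \<in> extensional (carrier ?W) \<and> \<rho> \<in> ring_hom ?W WF \<and>
      (\<forall>i. \<rho> (w_gen ?c i) = (\<Oplus>\<^bsub>WF\<^esub>j\<in>UNIV. tensor ?c (w_gen ?c j) (t_gen ?c j i))) \<and>
      (\<forall>f. \<forall>x\<in>carrier ?W. \<rho> (mu_W ?c f \<otimes>\<^bsub>?W\<^esub> x) = tensor ?c \<one>\<^bsub>?W\<^esub> (mu_r ?c f) \<otimes>\<^bsub>WF\<^esub> \<rho> x)"
      unfolding t Rep_coact_gen[symmetric]
      by (auto simp: Rep_generators W ops \<rho> coact_w coact_M times_wf.rep_eq)
  next
    fix \<rho>' assume "\<rho>' \<in> extensional (carrier ?W) \<and> \<rho>' \<in> ring_hom ?W WF \<and>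
      (\<forall>i. \<rho>' (w_gen ?c i) = (\<Oplus>\<^bsub>WF\<^esub>j\<in>UNIV. tensor ?c (w_gen ?c j) (t_gen ?c j i))) \<and>
      (\<forall>f. \<forall>x\<in>carrier ?W. \<rho>' (mu_W ?c f \<otimes>\<^bsub>?W\<^esub> x) = tensor ?c \<one>\<^bsub>?W\<^esub> (mu_r ?c f) \<otimes>\<^bsub>WF\<^esub> \<rho>' x)"
    then have ext: "\<rho>' \<in> extensional (carrier ?W)" and hom: "\<rho>' \<in> ring_hom ?W WF"
      and gen: "\<And>i. \<rho>' (Rep_pres (w i)) = Rep_wf (coact_gen i)"
      and M: "\<And>f x. \<rho>' (Rep_pres (M f * x)) = Rep_wf (tens 1 (Rf f)) \<otimes>\<^bsub>WF\<^esub> \<rho>' (Rep_pres x)"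
      unfolding t Rep_coact_gen[symmetric] by (auto simp: Rep_generators W ops)
    define \<sigma> where "\<sigma> x = Abs_wf (\<rho>' (Rep_pres x))" for x
    have \<sigma>: "\<rho>' (Rep_pres x) = Rep_wf (\<sigma> x)" for x
      unfolding \<sigma>_def using ring_hom_closed[OF hom, of "Rep_pres x"] by (simp add: W Abs_wf_inverse)
    have "\<sigma> x = coact x" for x
    proof (rule coact_unique)
      show "\<sigma> (x + y) = \<sigma> x + \<sigma> y" for x y
        using ring_hom_add[OF hom, of "Rep_pres x" "Rep_pres y"]
        by (simp add: W ops \<sigma> plus_wf.rep_eq[symmetric] Rep_wf_inject)
      show "\<sigma> (x * y) = \<sigma> x * \<sigma> y" for x y
        using ring_hom_mult[OF hom, of "Rep_pres x" "Rep_pres y"]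
        by (simp add: W ops \<sigma> times_wf.rep_eq[symmetric] Rep_wf_inject)
      show "\<sigma> 1 = 1"
        using ring_hom_one[OF hom] by (simp add: W ops \<sigma> one_wf.rep_eq[symmetric] Rep_wf_inject)
      show "\<sigma> (w i) = coact_gen i" for i using gen[of i] by (simp add: \<sigma> Rep_wf_inject)
      show "\<sigma> (M f * x) = tens 1 (Rf f) * \<sigma> x" for f x
        using M[of f x] by (simp add: \<sigma> times_wf.rep_eq[symmetric] Rep_wf_inject)
    qed
    then show "\<rho>' = \<rho>"
      by (intro extensionalityI[OF ext, of \<rho>]) (auto simp: \<rho>_def W \<sigma> Rep_pres_inverse)
  qed
  then show ?thesis using \<rho> by simp
qed

text \<open>Minors of sets of different sizes vanish, so the sum over sets of the right size already
  equals the full coordinate expansion; its uniqueness resolves the description.\<close>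

lemma q_minor_Rep:
  assumes "card I = card J"
  shows "q_minor (generic_log TYPE('n)) I J = Rep_pres (F.minor I (J :: 'n::{finite,linorder} set))"
proof -
  let ?c = "generic_log TYPE('n)"
  let ?S = "{K :: 'n set. card K = card J}"
  have hom: "F.minor K J \<in> homog bideg (omega K, omega J)" for K
    using coact_wset(2)[of J] by (simp add: coords_def F.minor_def)
  have expand: "(\<Oplus>\<^bsub>WF\<^esub>K\<in>?S. tensor ?c (w_set ?c K) (\<xi> K)) = Rep_wf (from_coords \<phi>)"
    if \<phi>: "\<phi> \<in> coords (omega J)" "\<And>K. K \<in> ?S \<Longrightarrow> \<xi> K = Rep_pres (\<phi> K)" "\<And>K. K \<notin> ?S \<Longrightarrow> \<phi> K = 0"
    for \<xi> \<phi>
  proof -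
    interpret abelian_monoid WF using ring_WF abelian_group.axioms(1) ring.is_abelian_group by blast
    have t: "tensor ?c (w_set ?c K) (\<xi> K) = Rep_wf (tens (wset K) (\<phi> K))" if "K \<in> ?S" for K
    proof -
      have "\<phi> K \<in> homog bideg (omega K, omega J)" using \<phi>(1) by (simp add: coords_def)
      from Rep_tens[OF homog_wset this] show ?thesis by (simp add: \<phi>(2)[OF that] Rep_wset)
    qed
    have "(\<Oplus>\<^bsub>WF\<^esub>K\<in>?S. tensor ?c (w_set ?c K) (\<xi> K)) = (\<Oplus>\<^bsub>WF\<^esub>K\<in>?S. Rep_wf (tens (wset K) (\<phi> K)))"
      by (rule finsum_cong') (use t Rep_wf in auto)
    also have "\<dots> = Rep_wf (\<Sum>K\<in>?S. tens (wset K) (\<phi> K))" by (simp add: Rep_wf_sum)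
    also have "(\<Sum>K\<in>?S. tens (wset K) (\<phi> K)) = from_coords \<phi>"
      unfolding from_coords_def using \<phi>(3) tens_zero_right[OF homog_wset] by (intro sum.mono_neutral_left) auto
    finally show ?thesis .
  qed
  have lhs: "coaction ?c (w_set ?c J) = Rep_wf (from_coords (\<lambda>K. F.minor K J))"
    unfolding Rep_wset coaction_Rep coact_wset(1) F.minor_def ..
  have m: "(\<lambda>K. F.minor K J) \<in> coords (omega J)" using hom by (simp add: coords_def)
  have "(THE \<xi>. \<xi> \<in> (\<Pi>\<^sub>E K\<in>?S. F_hom ?c (omega K) (omega J)) \<and>
        coaction ?c (w_set ?c J) = (\<Oplus>\<^bsub>WF\<^esub>K\<in>?S. tensor ?c (w_set ?c K) (\<xi> K)))
      = restrict (\<lambda>K. Rep_pres (F.minor K J)) ?S" (is "_ = ?\<xi>")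
  proof (rule the_equality)
    have "coaction ?c (w_set ?c J) = (\<Oplus>\<^bsub>WF\<^esub>K\<in>?S. tensor ?c (w_set ?c K) (?\<xi> K))"
      unfolding lhs by (rule expand[OF m, symmetric]) (auto simp: F.minor_eq_0)
    then show "?\<xi> \<in> (\<Pi>\<^sub>E K\<in>?S. F_hom ?c (omega K) (omega J)) \<and>
        coaction ?c (w_set ?c J) = (\<Oplus>\<^bsub>WF\<^esub>K\<in>?S. tensor ?c (w_set ?c K) (?\<xi> K))"
      using hom by (auto simp: F_hom_eq)
  next
    fix \<xi> assume \<xi>: "\<xi> \<in> (\<Pi>\<^sub>E K\<in>?S. F_hom ?c (omega K) (omega J)) \<and>
        coaction ?c (w_set ?c J) = (\<Oplus>\<^bsub>WF\<^esub>K\<in>?S. tensor ?c (w_set ?c K) (\<xi> K))"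
    \<comment> \<open>A competing family is extended by 0 to all subsets, so that uniqueness of
      coordinates applies to it.\<close>
    define \<phi> where "\<phi> K = (if K \<in> ?S then Abs_pres (\<xi> K) else 0)" for K
    have S: "\<xi> K = Rep_pres (\<phi> K) \<and> \<phi> K \<in> homog bideg (omega K, omega J)" if K: "K \<in> ?S" for K
    proof -
      have "\<xi> K \<in> Rep_pres ` homog bideg (omega K, omega J)"
        using PiE_mem[OF conjunct1[OF \<xi>] K] unfolding F_hom_eq .
      then obtain x where x: "\<xi> K = Rep_pres x" "x \<in> homog bideg (omega K, omega J)" by (rule imageE)
      moreover have "\<phi> K = x" using K by (simp add: \<phi>_def x Rep_pres_inverse)
      ultimately show ?thesis by simp
    qed
    have \<phi>: "\<phi> \<in> coords (omega J)" using S by (auto simp: coords_def \<phi>_def split: if_splits)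
    have "(\<Oplus>\<^bsub>WF\<^esub>K\<in>?S. tensor ?c (w_set ?c K) (\<xi> K)) = Rep_wf (from_coords \<phi>)"
      by (rule expand[OF \<phi>]) (use S in \<open>simp_all add: \<phi>_def\<close>)
    then have "Rep_wf (from_coords (\<lambda>K. F.minor K J)) = Rep_wf (from_coords \<phi>)"
      using conjunct2[OF \<xi>] unfolding lhs by (rule trans[rotated])
    then have "from_coords (\<lambda>K. F.minor K J) = from_coords \<phi>" by (simp only: Rep_wf_inject)
    then have "(\<lambda>K. F.minor K J) = \<phi>" by (rule from_coords_inject[OF m \<phi>])
    moreover have "\<xi> \<in> extensional ?S" using conjunct1[OF \<xi>] by (simp only: PiE_def Int_iff)
    ultimately show "\<xi> = ?\<xi>"
      using S by (intro extensionalityI[of \<xi> ?S]) auto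
  qed
  then show ?thesis using assms by (simp add: q_minor_def)
qed

section \<open>Signs for both orders and transfer to the stated algebra\<close>

lemma sign_mero_eq: "sign_mero (generic_log TYPE('n)) A B = F.sgn A (B :: 'n::{finite,linorder} set)"
proof -
  have "{(k, m). k \<in> A \<and> m \<in> B \<and> k > m} = Sigma A (\<lambda>k. {m \<in> B. m < k})" by auto
  then show ?thesis by (simp add: sign_mero_def F.sgn_def F.sgn1_def prod.Sigma H_def)
qed

lemma shift_omega_fixed:
  assumes "\<And>a. a \<in> A \<Longrightarrow> sh a f = f" shows "shift (- omega A) f = f"
proof -
  have "finite A" by simp
  then show ?thesis using assms
  proof (induction A)
    case (insert a A)
    have "shift (- omega (insert a A)) f = shift (- omega {a}) (shift (- omega A) f)"
      unfolding omega_insert[OF insert(2)] shift_shift by simp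
    then show ?case using insert by (simp add: shift_inv)
  qed (simp add: omega_def)
qed

text \<open>In the factor for \<open>k\<close> in \<open>B\<close> and \<open>m\<close> in
  \<open>A\<close> only the part of the shift in direction \<open>m\<close> acts, because
  \<open>A\<close> and \<open>B\<close> are disjoint. It turns the inverse of h(lambda_k - lambda_m)
  into h(lambda_m - lambda_k), and k > m means that \<open>k\<close> precedes \<open>m\<close> in
  the reversed order.\<close>

lemma shift_inverse_sign:
  fixes A B :: "'n::{finite,linorder} set"
  assumes "A \<inter> B = {}"
  shows "shift (- omega A) (inverse (sign_mero (generic_log TYPE('n)) B A)) = F.transpose.sgn A B"
proof -
  have 1: "shift (- omega A) (inverse (H0 k m)) = H0 m k" if "k \<in> B" "m \<in> A" for k m
  proof -
    have km: "k \<noteq> m" "k \<notin> A" using that assms by auto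
    have "omega A = omega {m} + omega (A - {m})"
      using omega_insert[of m "A - {m}"] that by (simp add: insert_absorb)
    then have "shift (- omega A) (inverse (H0 k m)) = shift (- omega {m}) (shift (- omega (A - {m})) (inverse (H0 k m)))"
      by (simp add: shift_shift)
    also have "shift (- omega (A - {m})) (inverse (H0 k m)) = inverse (H0 k m)"
    proof (rule shift_omega_fixed)
      fix a assume "a \<in> A - {m}"
      then have "sh a (H0 k m) = H0 k m" using km by (intro shift_H[OF generic_log_neq_1]) auto
      then show "sh a (inverse (H0 k m)) = inverse (H0 k m)" by simp
    qed
    also have "shift (- omega {m}) (inverse (H0 k m)) = H0 m k"
      by (rule H_inverse_shift[OF generic_log_neq_1 km(1)])
    finally show ?thesis .
  qed
  have inv: "inverse (prod f S) = (\<Prod>x\<in>S. inverse (f x))" for f :: "'n \<times> 'n \<Rightarrow> 'n mero" and S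
    by (induction S rule: infinite_finite_induct) simp_all
  have "shift (- omega A) (inverse (sign_mero (generic_log TYPE('n)) B A))
      = (\<Prod>(k, m)\<in>{(k, m). k \<in> B \<and> m \<in> A \<and> k > m}. - H0 m k)"
    unfolding sign_mero_def inv shift_prod H_def[symmetric]
    by (intro prod.cong refl) (auto simp: 1[simplified])
  also have "\<dots> = (\<Prod>(m, k)\<in>Sigma A (\<lambda>m. {k \<in> B. m < k}). - H0 m k)"
    by (rule prod.reindex_bij_witness[of _ "\<lambda>(k, m). (m, k)" "\<lambda>(k, m). (m, k)"]) auto
  also have "\<dots> = F.transpose.sgn A B"
    by (simp add: F.transpose.sgn_def F.transpose.sgn1_def prod.Sigma)
  finally show ?thesis .
qed

lemma finsum_Rep:
  assumes "\<And>x. x \<in> A \<Longrightarrow> f x = Rep_pres (g x)" "finite A"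
  shows "finsum (F_alg (generic_log TYPE('n))) f A = Rep_pres (sum g A :: 'n::{finite,linorder} fgen pres)"
proof -
  interpret abelian_monoid "F_alg (generic_log TYPE('n)) :: 'n F_elem ring"
    unfolding F_alg_eq by (rule abelian_group.axioms(1)[OF ring.is_abelian_group[OF ring_presented]])
  have "finsum (F_alg (generic_log TYPE('n))) f A = finsum (F_alg (generic_log TYPE('n))) (\<lambda>x. Rep_pres (g x)) A"
    by (rule finsum_cong') (use assms Rep_pres in \<open>auto simp: F_alg_eq\<close>)
  then show ?thesis using assms(2) by (simp add: Rep_pres_sum F_alg_eq)
qed

lemma laplace_expansions_generic_log: "laplace_expansions TYPE('n::{finite,linorder}) (generic_log TYPE('n))"
proof -
  let ?c = "generic_log TYPE('n)"
  let ?F = "F_alg ?c :: 'n F_elem ring"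
  have mult: "Rep_pres x \<otimes>\<^bsub>?F\<^esub> Rep_pres y = Rep_pres (x * y)" and zero: "\<zero>\<^bsub>?F\<^esub> = Rep_pres 0" for x y
    by (simp_all add: F_alg_eq times_pres.rep_eq zero_pres.rep_eq)
  have fin: "finite (splittings I r s)" for I :: "'n set" and r s by simp
  have rows: "finsum ?F (\<lambda>(I1, I2). mu_l ?c (sign_mero ?c I1 I2) \<otimes>\<^bsub>?F\<^esub> q_minor ?c I1 J1 \<otimes>\<^bsub>?F\<^esub> q_minor ?c I2 J2)
        (splittings I (card J1) (card J2))
      = Rep_pres (if J1 \<inter> J2 = {} then Rf (F.sgn J1 J2) * F.minor I (J1 \<union> J2) else 0)" for I J1 J2 :: "'n set"
    unfolding F.minor_laplace[symmetric]
    by (rule finsum_Rep[OF _ fin]) (auto simp: splittings_def q_minor_Rep Rep_generators sign_mero_eq mult)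
  \<comment> \<open>This is the first expansion for the transposed generators, in which the two
    copies of the scalars have exchanged roles. The shifted signs in the sum are covered because
    \<open>I1\<close> and \<open>I2\<close> are disjoint even when \<open>J1\<close> and
    \<open>J2\<close> are not.\<close>
  have cols: "finsum ?F (\<lambda>(I1, I2). mu_r ?c (shift (- omega I1) (inverse (sign_mero ?c I2 I1))) \<otimes>\<^bsub>?F\<^esub>
          q_minor ?c J1 I1 \<otimes>\<^bsub>?F\<^esub> q_minor ?c J2 I2) (splittings I (card J1) (card J2))
      = Rep_pres (if J1 \<inter> J2 = {} then Lf (F.transpose.sgn J1 J2) * F.minor (J1 \<union> J2) I else 0)" for I J1 J2 :: "'n set"
    unfolding F.minor_transpose F.transpose.minor_laplace[symmetric]
    by (rule finsum_Rep[OF _ fin])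
       (auto simp: splittings_def q_minor_Rep Rep_generators shift_inverse_sign mult F.minor_transpose simp del: shift_hom)
  show ?thesis
    unfolding laplace_expansions_def rows cols
    by (auto simp: q_minor_Rep card_Un_disjoint Rep_generators sign_mero_eq
        shift_inverse_sign[unfolded sign_mero_eq] mult zero simp del: shift_hom)
qed

theorem proposition4p1:
  fixes q logq :: complex and I J1 J2 :: "'n::{finite,linorder} set"
  assumes "exp logq = q"
    and "\<And>k::nat. k > 0 \<Longrightarrow> q ^ k \<noteq> 1"
    and "card I = card J1 + card J2"
  shows
    "(J1 \<inter> J2 = {} \<longrightarrow>
        mu_r logq (sign_mero logq J1 J2) \<otimes>\<^bsub>F_alg logq\<^esub> q_minor logq I (J1 \<union> J2) =
          finsum (F_alg logq)
            (\<lambda>(I1, I2). mu_l logq (sign_mero logq I1 I2) \<otimes>\<^bsub>F_alg logq\<^esub>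
               q_minor logq I1 J1 \<otimes>\<^bsub>F_alg logq\<^esub> q_minor logq I2 J2)
            (splittings I (card J1) (card J2)) \<and>
        mu_l logq (shift (- omega J1) (inverse (sign_mero logq J2 J1))) \<otimes>\<^bsub>F_alg logq\<^esub> q_minor logq (J1 \<union> J2) I =
          finsum (F_alg logq)
            (\<lambda>(I1, I2). mu_r logq (shift (- omega I1) (inverse (sign_mero logq I2 I1))) \<otimes>\<^bsub>F_alg logq\<^esub>
               q_minor logq J1 I1 \<otimes>\<^bsub>F_alg logq\<^esub> q_minor logq J2 I2)
            (splittings I (card J1) (card J2))) \<and>
     (J1 \<inter> J2 \<noteq> {} \<longrightarrow>
        \<zero>\<^bsub>F_alg logq\<^esub> =
          finsum (F_alg logq)
            (\<lambda>(I1, I2). mu_l logq (sign_mero logq I1 I2) \<otimes>\<^bsub>F_alg logq\<^esub>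
               q_minor logq I1 J1 \<otimes>\<^bsub>F_alg logq\<^esub> q_minor logq I2 J2)
            (splittings I (card J1) (card J2)) \<and>
        \<zero>\<^bsub>F_alg logq\<^esub> =
          finsum (F_alg logq)
            (\<lambda>(I1, I2). mu_r logq (shift (- omega I1) (inverse (sign_mero logq I2 I1))) \<otimes>\<^bsub>F_alg logq\<^esub>
               q_minor logq J1 I1 \<otimes>\<^bsub>F_alg logq\<^esub> q_minor logq J2 I2)
            (splittings I (card J1) (card J2)))"
proof -
  have "not_root_of_unity (exp logq)"
    unfolding not_root_of_unity_def using assms(1,2) by blast
  from generic_log(2)[OF laplace_expansions_generic_log this] assms(3)
  show ?thesis unfolding laplace_expansions_def by blast
qed

end
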